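(* There exists an $\omega$-categorical structure $M$ (in a countable relational language) such that no $\omega$-categorical expansion of $M$ has the fixed points on type spaces property (FPT).
   Context: For a Hausdorff topological group $G$, a $G$-flow is a continuous action of $G$ on a nonempty compact Hausdorff space; a subflow is a nonempty closed $G$-invariant subset with the restricted action. For a structure $M$ with $G=\mathrm{Aut}(M)$ (pointwise convergence topology) and $n\ge 1$, let $S_n(M)$ be the Stone space of complete $n$-types with parameters from $M$; $G$ acts on it by $g\cdot p(\bar x)=\{\varphi(\bar x,g\bar m):\varphi(\bar x,\bar m)\in p(\bar x)\}$, which is a $G$-flow. $M$ has the fixed points on type spaces property (FPT) if for every $n\ge1$, every subflow of $S_n(M)$ contains a $G$-fixed point. An expansion of $M$ is a structure in a larger (countable relational) language on the same domain whose reduct to the original language is $M$. *)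

theory Defs
  imports "HOL-Analysis.Analysis"
begin

section \<open>Relational first-order logic with equality\<close>

record 'r language =
  symbols :: "'r set"
  arity :: "'r \<Rightarrow> nat"

definition countable_language :: "'r language \<Rightarrow> bool" where
  "countable_language L \<longleftrightarrow> countable (symbols L)"

text \<open>The universe of a structure is the whole (nonempty) type \<open>'a\<close>. A structure is given by
  its interpretation of the relation symbols; for an \<open>L\<close>-structure only the values at
  symbols \<open>r\<close> of \<open>L\<close> and lists of length \<open>arity L r\<close> matter.\<close>

type_synonym ('r, 'a) struct = "'r \<Rightarrow> 'a list \<Rightarrow> bool"

text \<open>A term is a variable or a parameter (an element of the structure, used as a name for
  itself). Parameter-free formulas are the formulas of the language proper.\<close>

datatype 'a trm = Var nat | Par 'a

datatype ('r, 'a) fm =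
    Equal "'a trm" "'a trm"
  | Atom 'r "'a trm list"
  | Neg "('r, 'a) fm"
  | Conj "('r, 'a) fm" "('r, 'a) fm"
  | Exi nat "('r, 'a) fm"

primrec trm_vars :: "'a trm \<Rightarrow> nat set" where
  "trm_vars (Var i) = {i}"
| "trm_vars (Par a) = {}"

primrec free_vars :: "('r, 'a) fm \<Rightarrow> nat set" where
  "free_vars (Equal s t) = trm_vars s \<union> trm_vars t"
| "free_vars (Atom r ts) = (\<Union>t\<in>set ts. trm_vars t)"
| "free_vars (Neg \<phi>) = free_vars \<phi>"
| "free_vars (Conj \<phi> \<psi>) = free_vars \<phi> \<union> free_vars \<psi>"
| "free_vars (Exi i \<phi>) = free_vars \<phi> - {i}"

definition params :: "('r, 'a) fm \<Rightarrow> 'a set" where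
  "params \<phi> = set2_fm \<phi>"

primrec is_formula :: "'r language \<Rightarrow> ('r, 'a) fm \<Rightarrow> bool" where
  "is_formula L (Equal s t) \<longleftrightarrow> True"
| "is_formula L (Atom r ts) \<longleftrightarrow> r \<in> symbols L \<and> length ts = arity L r"
| "is_formula L (Neg \<phi>) \<longleftrightarrow> is_formula L \<phi>"
| "is_formula L (Conj \<phi> \<psi>) \<longleftrightarrow> is_formula L \<phi> \<and> is_formula L \<psi>"
| "is_formula L (Exi i \<phi>) \<longleftrightarrow> is_formula L \<phi>"

primrec trm_val :: "(nat \<Rightarrow> 'a) \<Rightarrow> 'a trm \<Rightarrow> 'a" where
  "trm_val e (Var i) = e i"
| "trm_val e (Par a) = a"

primrec sat :: "('r, 'a) struct \<Rightarrow> (nat \<Rightarrow> 'a) \<Rightarrow> ('r, 'a) fm \<Rightarrow> bool" where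
  "sat M e (Equal s t) \<longleftrightarrow> trm_val e s = trm_val e t"
| "sat M e (Atom r ts) \<longleftrightarrow> M r (map (trm_val e) ts)"
| "sat M e (Neg \<phi>) \<longleftrightarrow> \<not> sat M e \<phi>"
| "sat M e (Conj \<phi> \<psi>) \<longleftrightarrow> sat M e \<phi> \<and> sat M e \<psi>"
| "sat M e (Exi i \<phi>) \<longleftrightarrow> (\<exists>a. sat M (e(i := a)) \<phi>)"


section \<open>Isomorphisms, theories, \<open>\<omega>\<close>-categoricity, expansions\<close>

definition is_isomorphism ::
  "'r language \<Rightarrow> ('r, 'a) struct \<Rightarrow> ('r, 'b) struct \<Rightarrow> ('a \<Rightarrow> 'b) \<Rightarrow> bool" where
  "is_isomorphism L M N f \<longleftrightarrow> bij f \<and>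
     (\<forall>r\<in>symbols L. \<forall>xs. length xs = arity L r \<longrightarrow> M r xs = N r (map f xs))"

definition isomorphic :: "'r language \<Rightarrow> ('r, 'a) struct \<Rightarrow> ('r, 'b) struct \<Rightarrow> bool" where
  "isomorphic L M N \<longleftrightarrow> (\<exists>f. is_isomorphism L M N f)"

definition Aut :: "'r language \<Rightarrow> ('r, 'a) struct \<Rightarrow> ('a \<Rightarrow> 'a) set" where
  "Aut L M = {g. is_isomorphism L M M g}"

definition is_sentence :: "'r language \<Rightarrow> ('r, 'a) fm \<Rightarrow> bool" where
  "is_sentence L \<phi> \<longleftrightarrow> is_formula L \<phi> \<and> params \<phi> = {} \<and> free_vars \<phi> = {}"

definition models :: "('r, 'a) struct \<Rightarrow> ('r, 'a) fm set \<Rightarrow> bool" where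
  "models M T \<longleftrightarrow> (\<forall>\<phi>\<in>T. \<forall>e. sat M e \<phi>)"

definition theory_of :: "'r language \<Rightarrow> ('r, 'a) struct \<Rightarrow> ('r, 'a) fm set" where
  "theory_of L M = {\<phi>. is_sentence L \<phi> \<and> (\<forall>e. sat M e \<phi>)}"

text \<open>\<open>M\<close> is countably infinite and is, up to isomorphism, the only countable model of its
  theory. As \<open>M\<close> is infinite, every countable model of its theory is countably infinite, hence
  has an isomorphic copy with the same universe \<open>'a\<close> as \<open>M\<close>; so it suffices
  to quantify over those.\<close>

definition omega_categorical :: "'r language \<Rightarrow> ('r, 'a) struct \<Rightarrow> bool" where
  "omega_categorical L M \<longleftrightarrow>
     countable (UNIV :: 'a set) \<and> infinite (UNIV :: 'a set) \<and>
     (\<forall>N :: ('r, 'a) struct. models N (theory_of L M) \<longrightarrow> isomorphic L M N)"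

text \<open>The symbols of an expanded language are drawn from a sum type: \<open>Inl r\<close> is the original
  symbol \<open>r\<close>, and the right summand (and any \<open>Inl r\<close> with \<open>r\<close> not in
  the original language) provides new symbols. Thus there is always room for countably many new
  symbols, even if the original language uses up its whole type of symbols.\<close>

definition is_expansion ::
  "'r language \<Rightarrow> ('r, 'a) struct \<Rightarrow> ('r + 's) language \<Rightarrow> ('r + 's, 'a) struct \<Rightarrow> bool" where
  "is_expansion L M L' M' \<longleftrightarrow>
     (\<forall>r\<in>symbols L. Inl r \<in> symbols L' \<and> arity L' (Inl r) = arity L r \<and>
        (\<forall>xs. length xs = arity L r \<longrightarrow> M' (Inl r) xs = M r xs))"


section \<open>Type spaces\<close>

text \<open>Formulas with parameters from the universe, in the free variables \<open>x\<^sub>0, \<dots>, x\<^sub>n\<^sub>-\<^sub>1\<close>.\<close>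

definition formulas :: "'r language \<Rightarrow> nat \<Rightarrow> ('r, 'a) fm set" where
  "formulas L n = {\<phi>. is_formula L \<phi> \<and> free_vars \<phi> \<subseteq> {..<n}}"

text \<open>Only the values \<open>e 0, \<dots>, e (n - 1)\<close> of the assignment are relevant for formulas
  in \<open>formulas L n\<close>.\<close>

definition finitely_satisfiable :: "('r, 'a) struct \<Rightarrow> ('r, 'a) fm set \<Rightarrow> bool" where
  "finitely_satisfiable M p \<longleftrightarrow>
     (\<forall>F. finite F \<and> F \<subseteq> p \<longrightarrow> (\<exists>e. \<forall>\<phi>\<in>F. sat M e \<phi>))"

definition type_space :: "'r language \<Rightarrow> ('r, 'a) struct \<Rightarrow> nat \<Rightarrow> ('r, 'a) fm set set" where
  "type_space L M n = {p. p \<subseteq> formulas L n \<and> finitely_satisfiable M p \<and>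
     (\<forall>\<phi>\<in>formulas L n. \<phi> \<in> p \<or> Neg \<phi> \<in> p)}"

definition stone_topology ::
  "'r language \<Rightarrow> ('r, 'a) struct \<Rightarrow> nat \<Rightarrow> ('r, 'a) fm set topology" where
  "stone_topology L M n =
     topology_generated_by ((\<lambda>\<phi>. {p \<in> type_space L M n. \<phi> \<in> p}) ` formulas L n)"

text \<open>\<open>map_fm id g\<close> replaces each parameter \<open>m\<close> of a formula by \<open>g m\<close>.\<close>

definition type_act :: "('a \<Rightarrow> 'a) \<Rightarrow> ('r, 'a) fm set \<Rightarrow> ('r, 'a) fm set" where
  "type_act g p = map_fm id g ` p"


section \<open>Subflows and fixed points on type spaces\<close>

definition is_subflow ::
  "'x topology \<Rightarrow> 'g set \<Rightarrow> ('g \<Rightarrow> 'x \<Rightarrow> 'x) \<Rightarrow> 'x set \<Rightarrow> bool" where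
  "is_subflow X G act Y \<longleftrightarrow> Y \<noteq> {} \<and> closedin X Y \<and> (\<forall>g\<in>G. \<forall>y\<in>Y. act g y \<in> Y)"

definition FPT :: "'r language \<Rightarrow> ('r, 'a) struct \<Rightarrow> bool" where
  "FPT L M \<longleftrightarrow> (\<forall>n\<ge>1. \<forall>Y. is_subflow (stone_topology L M n) (Aut L M) type_act Y \<longrightarrow>
     (\<exists>p\<in>Y. \<forall>g\<in>Aut L M. type_act g p = p))"


section \<open>Basic facts\<close>

lemma topspace_stone_topology: "topspace (stone_topology L M n) = type_space L M n"
proof -
  have "\<exists>\<phi>\<in>formulas L n. \<phi> \<in> p" if "p \<in> type_space L M n" for p
  proof -
    let ?\<phi> = "Exi 0 (Equal (Var 0) (Var 0))"
    have "?\<phi> \<in> formulas L n" "Neg ?\<phi> \<in> formulas L n"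
      by (auto simp: formulas_def)
    then show ?thesis using that by (auto simp: type_space_def)
  qed
  then show ?thesis
    by (auto simp: stone_topology_def topology_generated_by_topspace)
qed

lemma trm_val_map: "trm_val (g \<circ> e) (map_trm g t) = g (trm_val e t)"
  by (cases t) auto

lemma trm_vars_map: "trm_vars (map_trm g t) = trm_vars t"
  by (cases t) auto

lemma free_vars_map: "free_vars (map_fm id g \<phi>) = free_vars \<phi>"
  by (induction \<phi>) (auto simp: trm_vars_map)

lemma is_formula_map: "is_formula L (map_fm id g \<phi>) = is_formula L \<phi>"
  by (induction \<phi>) auto

lemma map_formulas_iff: "map_fm id g \<phi> \<in> formulas L n \<longleftrightarrow> \<phi> \<in> formulas L n"
  by (simp add: formulas_def free_vars_map is_formula_map)

lemma sat_map_aut: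
  assumes "g \<in> Aut L M" "is_formula L \<phi>"
  shows "sat M (g \<circ> e) (map_fm id g \<phi>) \<longleftrightarrow> sat M e \<phi>"
  using assms(2)
proof (induction \<phi> arbitrary: e)
  case (Equal s t)
  have "inj g" using assms(1) by (auto simp: Aut_def is_isomorphism_def bij_def)
  then show ?case by (simp only: fm.map sat.simps trm_val_map inj_eq)
next
  case (Atom r ts)
  have vals: "map (trm_val (g \<circ> e)) (map (map_trm g) ts) = map g (map (trm_val e) ts)"
    by (induction ts) (simp_all only: list.map trm_val_map)
  have "M r xs = M r (map g xs)" if "length xs = arity L r" for xs
    using assms(1) Atom that unfolding Aut_def is_isomorphism_def is_formula.simps by blast
  moreover have "length (map (trm_val e) ts) = arity L r" using Atom by simp
  ultimately have "M r (map (trm_val e) ts) = M r (map g (map (trm_val e) ts))" by blast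
  then show ?case by (simp only: fm.map sat.simps id_apply vals)
next
  case (Exi i \<phi>)
  have upd: "(g \<circ> e)(i := g a) = g \<circ> e(i := a)" for a by auto
  have "surj g" using assms(1) by (auto simp: Aut_def is_isomorphism_def bij_def)
  then have ex: "(\<exists>b. P b) \<longleftrightarrow> (\<exists>a. P (g a))" for P
    by (metis surjD)
  have "sat M (g \<circ> e) (map_fm id g (Exi i \<phi>)) \<longleftrightarrow>
      (\<exists>b. sat M ((g \<circ> e)(i := b)) (map_fm id g \<phi>))"
    by (simp only: fm.map sat.simps)
  also have "\<dots> \<longleftrightarrow> (\<exists>a. sat M (g \<circ> e(i := a)) (map_fm id g \<phi>))"
    by (simp only: ex[of "\<lambda>b. sat M ((g \<circ> e)(i := b)) (map_fm id g \<phi>)"] upd)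
  also have "\<dots> \<longleftrightarrow> sat M e (Exi i \<phi>)"
    using Exi by (simp only: sat.simps is_formula.simps)
  finally show ?case .
qed auto

lemma type_act_in_type_space:
  assumes g: "g \<in> Aut L M" and p: "p \<in> type_space L M n"
  shows "type_act g p \<in> type_space L M n"
proof -
  have form: "p \<subseteq> formulas L n" and fs: "finitely_satisfiable M p"
    and compl: "\<And>\<phi>. \<phi> \<in> formulas L n \<Longrightarrow> \<phi> \<in> p \<or> Neg \<phi> \<in> p"
    using p by (auto simp: type_space_def)
  have surj: "surj g" using g by (auto simp: Aut_def is_isomorphism_def bij_def)
  have "finitely_satisfiable M (type_act g p)"
    unfolding finitely_satisfiable_def
  proof (intro allI impI)
    fix F assume F: "finite F \<and> F \<subseteq> type_act g p"
    then obtain F' where F': "finite F'" "F' \<subseteq> p" "F = map_fm id g ` F'"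
      unfolding type_act_def by (meson finite_subset_image)
    then obtain e where "\<forall>\<phi>\<in>F'. sat M e \<phi>"
      using fs by (auto simp: finitely_satisfiable_def)
    then have "\<forall>\<phi>\<in>F'. sat M (g \<circ> e) (map_fm id g \<phi>)"
      using F'(2) form sat_map_aut[OF g] by (fastforce simp: formulas_def)
    then show "\<exists>e. \<forall>\<phi>\<in>F. sat M e \<phi>" using F'(3) by blast
  qed
  moreover have "\<phi> \<in> type_act g p \<or> Neg \<phi> \<in> type_act g p" if "\<phi> \<in> formulas L n" for \<phi>
  proof -
    have "map_fm id g (map_fm id (inv g) \<phi>) = \<phi>"
      using surj by (simp add: fm.map_comp surj_iff fm.map_id)
    then obtain \<psi> where \<psi>: "\<phi> = map_fm id g \<psi>" by (rule that[OF sym])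
    then have "\<psi> \<in> p \<or> Neg \<psi> \<in> p"
      using compl that by (simp add: map_formulas_iff)
    then show ?thesis unfolding type_act_def \<psi> fm.map(3)[symmetric] by blast
  qed
  moreover have "type_act g p \<subseteq> formulas L n"
    using form by (auto simp: type_act_def map_formulas_iff)
  ultimately show ?thesis by (simp add: type_space_def)
qed

end

theory Submission
  imports Defs "HOL-Library.Diagonal_Subsequence"
begin

text \<open>The structure is a Hrushovski construction in the style of Evans, Hubicka and
  Nesetril: a generic digraph \<open>E\<close> in which every finite set \<open>X\<close> of vertices satisfies
  \<open>|X| \<le> 2 ^ (2 * |X| - e(X))\<close>, together with a generic ternary relation \<open>R\<close>. The exponential bound
  bounds the size of closures, whence \<open>\<omega>\<close>-categoricity; it also gives \<open>e(X) \<le> 2 * |X|\<close>, so by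
  Hall's theorem finite subgraphs can be oriented with out-degrees at most \<open>2\<close>. As the binary
  relations \<open>R(x, \<cdot>, \<cdot>)\<close> are arbitrary on finite sets, orientations of the whole graph with
  out-degrees at most \<open>2\<close> are coded by the \<open>1\<close>-types in a nonempty subflow of \<open>S\<^sub>1\<close>, over any
  expansion.

  A fixed point in this subflow is an orientation invariant under the automorphism group of the
  expansion, which is oligomorphic if the expansion is \<open>\<omega>\<close>-categorical (Ryll-Nardzewski). The sets of
  vertices reachable in \<open>k\<close> steps are then constant for large \<open>k\<close>, so sets of descendants
  are finite of bounded size. But every vertex has infinite degree, and all but finitely many of its
  neighbours have strictly more descendants than it has.\<close>

section \<open>Formulas without parameters\<close>

text \<open>Both constants in the bound are forced by counting. Gluing two finite graphs over a
  strong common part at most doubles the larger half of a set and, when the set leaves that half,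
  raises \<open>delta\<close> by at least 1: this is why the bound is a power of 2. With weight 2
  per vertex a new vertex may carry one edge and still raise \<open>delta\<close> by 1, whence
  infinite degrees; with weight 1 it would gain nothing. The obstacle is that an expansion has
  unknown symbols. The subflow is therefore cut out by conditions on the formulas
  \<open>R(x, a, b)\<close> alone, and a member of it is a limit of realised types along a sequence
  that decides every formula of the expanded language. All that is used of the automorphism group is
  that it is oligomorphic and preserves \<open>E\<close>. As \<open>omega_categorical\<close> means
  uniqueness of the countable model, one half of Ryll-Nardzewski is proved by building countable
  models as limits of assignments with Henkin witnesses. For the converse half, the language of the
  witness structure has a symbol for each orbit of tuples, so that back-and-forth only has to look
  at atoms.\<close>

instance trm :: (countable) countable
  by countable_datatype

instance fm :: (countable, countable) countable
  by countable_datatype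

definition pure :: "'r language \<Rightarrow> ('r, 'a) fm set" where
  "pure L = {\<phi>. is_formula L \<phi> \<and> params \<phi> = {}}"

definition pure_upto :: "'r language \<Rightarrow> nat \<Rightarrow> ('r, 'a) fm set" where
  "pure_upto L n = {\<phi> \<in> pure L. free_vars \<phi> \<subseteq> {..<n}}"

lemma pure_uptoD:
  assumes "\<phi> \<in> pure_upto L n"
  shows "\<phi> \<in> pure L" "free_vars \<phi> \<subseteq> {..<n}"
  using assms by (auto simp: pure_upto_def)

lemma params_simps [simp]:
  "params (Equal s t :: ('r, 'a) fm) = set_trm s \<union> set_trm t"
  "params (Atom r ts :: ('r, 'a) fm) = (\<Union>t\<in>set ts. set_trm t)"
  "params (Neg \<phi>) = params \<phi>"
  "params (Conj \<phi> \<psi>) = params \<phi> \<union> params \<psi>"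
  "params (Exi i \<phi>) = params \<phi>"
  by (auto simp: params_def)

lemma pure_simps [simp]:
  "Equal s t \<in> pure L \<longleftrightarrow> set_trm s = {} \<and> set_trm t = {}"
  "Atom r ts \<in> pure L \<longleftrightarrow> r \<in> symbols L \<and> length ts = arity L r \<and> (\<forall>t\<in>set ts. set_trm t = {})"
  "Neg \<phi> \<in> pure L \<longleftrightarrow> \<phi> \<in> pure L"
  "Conj \<phi> \<psi> \<in> pure L \<longleftrightarrow> \<phi> \<in> pure L \<and> \<psi> \<in> pure L"
  "Exi i \<phi> \<in> pure L \<longleftrightarrow> \<phi> \<in> pure L"
  by (auto simp: pure_def)

lemma finite_free_vars: "finite (free_vars \<phi>)"
proof (induction \<phi>)
  case (Equal s t)
  show ?case by (cases s; cases t) auto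
next
  case (Atom r ts)
  have "finite (trm_vars t)" for t :: "'b trm"
    by (cases t) auto
  then show ?case by auto
qed auto

lemma sat_cong:
  "(\<And>i. i \<in> free_vars \<phi> \<Longrightarrow> e i = e' i) \<Longrightarrow> sat M e \<phi> \<longleftrightarrow> sat M e' \<phi>"
proof (induction \<phi> arbitrary: e e')
  case (Equal s t)
  then show ?case by (cases s; cases t) auto
next
  case (Atom r ts)
  have "trm_val e t = trm_val e' t" if "t \<in> set ts" for t
    using Atom[of ] that by (cases t) force+
  then have "map (trm_val e) ts = map (trm_val e') ts" by simp
  then show ?case by (simp only: sat.simps)
next
  case (Neg \<phi>)
  then show ?case by (metis free_vars.simps(3) sat.simps(3))
next
  case (Conj \<phi> \<psi>)
  then show ?case by (metis UnCI free_vars.simps(4) sat.simps(4))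
next
  case (Exi i \<phi>)
  have "sat M (e(i := a)) \<phi> \<longleftrightarrow> sat M (e'(i := a)) \<phi>" for a
    by (rule Exi.IH) (use Exi.prems in auto)
  then show ?case by simp
qed

text \<open>Substitution of variables along an arbitrary \<open>v\<close>, possibly not injective.
  One \<open>\<psi>\<close> serves all structures and assignments, which lets choices made from
  \<open>\<psi>\<close> be independent of the assignment.\<close>

lemma rename_formula:
  fixes \<phi> :: "('r, 'a) fm"
  assumes "\<phi> \<in> pure L"
  shows "\<exists>\<psi>. \<psi> \<in> pure L \<and> free_vars \<psi> \<subseteq> v ` free_vars \<phi> \<and>
    (\<forall>M :: ('r, 'a) struct. \<forall>e. sat M e \<psi> \<longleftrightarrow> sat M (e \<circ> v) \<phi>)"
  using assms
proof (induction \<phi> arbitrary: v)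
  case (Equal s t)
  then obtain i j where "s = Var i" "t = Var j"
    by (cases s; cases t) auto
  then show ?case
    by (intro exI[of _ "Equal (Var (v i)) (Var (v j))"]) auto
next
  case (Atom r ts)
  define ren where "ren = (\<lambda>t :: 'a trm. case t of Var i \<Rightarrow> Var (v i) | Par a \<Rightarrow> Par a)"
  have ren: "set_trm (ren t) = {}" "trm_vars (ren t) = v ` trm_vars t"
    "trm_val e (ren t) = trm_val (e \<circ> v) t" if "t \<in> set ts" for t e
    using Atom that by (cases t; force simp: ren_def)+
  have "map (trm_val e) (map ren ts) = map (trm_val (e \<circ> v)) ts" for e
    using ren(3) by simp
  then have "sat M e (Atom r (map ren ts)) \<longleftrightarrow> sat M (e \<circ> v) (Atom r ts)"
    for M :: "('r, 'a) struct" and e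
    by (simp only: sat.simps)
  moreover have "free_vars (Atom r (map ren ts)) \<subseteq> v ` free_vars (Atom r ts)"
    using ren(2) by auto
  moreover have "Atom r (map ren ts) \<in> pure L"
    using Atom ren(1) by auto
  ultimately show ?case by blast
next
  case (Neg \<phi>)
  then obtain \<psi> where "\<psi> \<in> pure L" "free_vars \<psi> \<subseteq> v ` free_vars \<phi>"
    "\<forall>M :: ('r, 'a) struct. \<forall>e. sat M e \<psi> \<longleftrightarrow> sat M (e \<circ> v) \<phi>"
    by (metis pure_simps(3))
  then show ?case
    by (intro exI[of _ "Neg \<psi>"]) (simp only: pure_simps free_vars.simps sat.simps simp_thms)
next
  case (Conj \<phi>1 \<phi>2)
  obtain \<psi>1 where "\<psi>1 \<in> pure L" "free_vars \<psi>1 \<subseteq> v ` free_vars \<phi>1"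
    "\<forall>M :: ('r, 'a) struct. \<forall>e. sat M e \<psi>1 \<longleftrightarrow> sat M (e \<circ> v) \<phi>1"
    using Conj by (metis pure_simps(4))
  moreover obtain \<psi>2 where "\<psi>2 \<in> pure L" "free_vars \<psi>2 \<subseteq> v ` free_vars \<phi>2"
    "\<forall>M :: ('r, 'a) struct. \<forall>e. sat M e \<psi>2 \<longleftrightarrow> sat M (e \<circ> v) \<phi>2"
    using Conj by (metis pure_simps(4))
  ultimately show ?case by (intro exI[of _ "Conj \<psi>1 \<psi>2"])
      (simp only: pure_simps free_vars.simps sat.simps image_Un, blast)
next
  case (Exi i \<phi>)
  \<comment> \<open>The bound variable moves outside the image of the free variables, so no capture
    can occur.\<close>
  obtain j where j: "j \<notin> v ` free_vars \<phi>"
    using finite_free_vars[of \<phi>] by (meson ex_new_if_finite finite_imageI infinite_UNIV_nat)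
  obtain \<psi> where \<psi>: "\<psi> \<in> pure L" "free_vars \<psi> \<subseteq> v(i := j) ` free_vars \<phi>"
    "\<And>M :: ('r, 'a) struct. \<And>e. sat M e \<psi> \<longleftrightarrow> sat M (e \<circ> v(i := j)) \<phi>"
    using Exi by (metis pure_simps(5))
  have "sat M (e(j := a) \<circ> v(i := j)) \<phi> \<longleftrightarrow> sat M ((e \<circ> v)(i := a)) \<phi>"
    for M :: "('r, 'a) struct" and e a
    by (rule sat_cong) (use j in auto)
  moreover have "free_vars \<psi> - {j} \<subseteq> v ` (free_vars \<phi> - {i})"
    using \<psi>(2) by auto
  ultimately show ?case
    using \<psi> by (intro exI[of _ "Exi j \<psi>"])
      (simp only: pure_simps free_vars.simps sat.simps simp_thms)
qed

lemma sat_isomorphism: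
  fixes M N :: "('r, 'a) struct"
  assumes f: "is_isomorphism L M N f" and "\<phi> \<in> pure L"
  shows "sat N (f \<circ> e) \<phi> \<longleftrightarrow> sat M e \<phi>"
  using assms(2)
proof (induction \<phi> arbitrary: e)
  case (Equal s t)
  have "inj f" using f by (auto simp: is_isomorphism_def bij_def)
  then show ?case using Equal by (cases s; cases t) (auto simp: inj_eq)
next
  case (Atom r ts)
  have "trm_val (f \<circ> e) t = f (trm_val e t)" if "t \<in> set ts" for t
    using Atom that by (cases t) auto
  then have "map (trm_val (f \<circ> e)) ts = map f (map (trm_val e) ts)" by simp
  then show ?case
    using f Atom by (simp only: sat.simps is_isomorphism_def pure_simps length_map)
next
  case (Exi i \<phi>)
  have upd: "(f \<circ> e)(i := f a) = f \<circ> e(i := a)" for a by auto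
  have "surj f" using f by (auto simp: is_isomorphism_def bij_def)
  then have "(\<exists>b. sat N ((f \<circ> e)(i := b)) \<phi>) \<longleftrightarrow> (\<exists>a. sat N ((f \<circ> e)(i := f a)) \<phi>)"
    by (metis surjD)
  also have "\<dots> \<longleftrightarrow> (\<exists>a. sat M (e(i := a)) \<phi>)"
    using Exi by (simp only: upd pure_simps)
  finally show ?case by (simp only: sat.simps)
qed auto

text \<open>The empty conjunction is quantified so that it has no free variable; it later isolates
  the type of the empty tuple.\<close>

primrec conjs :: "('r, 'a) fm list \<Rightarrow> ('r, 'a) fm" where
  "conjs [] = Exi 0 (Equal (Var 0) (Var 0))"
| "conjs (\<phi> # \<phi>s) = Conj \<phi> (conjs \<phi>s)"

lemma sat_conjs [simp]: "sat M e (conjs \<phi>s) \<longleftrightarrow> (\<forall>\<phi>\<in>set \<phi>s. sat M e \<phi>)"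
  by (induction \<phi>s) auto

lemma pure_conjs [simp]: "conjs \<phi>s \<in> pure L \<longleftrightarrow> set \<phi>s \<subseteq> pure L"
  by (induction \<phi>s) auto

lemma free_vars_conjs [simp]: "free_vars (conjs \<phi>s) = (\<Union>\<phi>\<in>set \<phi>s. free_vars \<phi>)"
  by (induction \<phi>s) auto

primrec exis :: "nat list \<Rightarrow> ('r, 'a) fm \<Rightarrow> ('r, 'a) fm" where
  "exis [] \<phi> = \<phi>"
| "exis (i # is) \<phi> = Exi i (exis is \<phi>)"

lemma sat_exis:
  "sat M e (exis is \<phi>) \<longleftrightarrow> (\<exists>e'. (\<forall>i. i \<notin> set is \<longrightarrow> e' i = e i) \<and> sat M e' \<phi>)"
proof (induction "is" arbitrary: e)
  case Nil
  have "(\<forall>i. e' i = e i) \<longleftrightarrow> e' = e" for e' by auto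
  then show ?case by simp
next
  case (Cons i "is")
  have "(\<exists>a. \<exists>e'. (\<forall>k. k \<notin> set is \<longrightarrow> e' k = (e(i := a)) k) \<and> sat M e' \<phi>) \<longleftrightarrow>
        (\<exists>e'. (\<forall>k. k \<notin> set (i # is) \<longrightarrow> e' k = e k) \<and> sat M e' \<phi>)" (is "?l \<longleftrightarrow> ?r")
  proof
    assume ?l
    then show ?r by (metis fun_upd_other list.set_intros(1,2))
  next
    assume ?r
    then obtain e' where "\<forall>k. k \<notin> set (i # is) \<longrightarrow> e' k = e k" "sat M e' \<phi>" by blast
    then show ?l by (intro exI[of _ "e' i"] exI[of _ e']) auto
  qed
  then show ?case by (simp only: exis.simps sat.simps Cons)
qed

lemma pure_exis [simp]: "exis is \<phi> \<in> pure L \<longleftrightarrow> \<phi> \<in> pure L"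
  by (induction "is") auto

lemma free_vars_exis [simp]: "free_vars (exis is \<phi>) = free_vars \<phi> - set is"
  by (induction "is") auto

text \<open>\<open>theory_of\<close> contains only sentences, so validity of a formula with free
  variables is transferred through its universal closure.\<close>

lemma models_valid:
  fixes M N :: "('r, 'a) struct"
  assumes N: "models N (theory_of L M)" and \<phi>: "\<phi> \<in> pure L" and valid: "\<And>e. sat M e \<phi>"
  shows "sat N e \<phi>"
proof -
  obtain vs where vs: "set vs = free_vars \<phi>"
    using finite_list[OF finite_free_vars] by blast
  let ?\<chi> = "Neg (exis vs (Neg \<phi>))"
  have "?\<chi> \<in> pure L" using \<phi> by simp
  moreover have "free_vars ?\<chi> = {}" using vs by simp
  moreover have "sat M e ?\<chi>" for e using valid by (simp add: sat_exis)
  ultimately have "?\<chi> \<in> theory_of L M"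
    unfolding theory_of_def is_sentence_def pure_def by blast
  then have "sat N e ?\<chi>" using N by (auto simp: models_def)
  then show ?thesis by (auto simp: sat_exis)
qed

lemma sat_nth_snoc:
  assumes "free_vars \<phi> \<subseteq> {..<Suc (length xs)}"
  shows "sat M ((!) (xs @ [a])) \<phi> \<longleftrightarrow> sat M (((!) xs)(length xs := a)) \<phi>"
  by (rule sat_cong) (use assms in \<open>force simp: nth_append less_Suc_eq\<close>)

text \<open>\<open>P\<close> need not be closed under sublists. The last conclusion, that every
  finite set is covered by a list related to its image, is what later shows that \<open>f\<close>
  preserves relations.\<close>

lemma back_and_forth:
  fixes P :: "'a :: countable list \<Rightarrow> 'b :: countable list \<Rightarrow> bool"
  assumes start: "P xs0 ys0"
    and forth: "\<And>xs ys a. P xs ys \<Longrightarrow> \<exists>b. P (xs @ [a]) (ys @ [b])"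
    and backward: "\<And>xs ys b. P xs ys \<Longrightarrow> \<exists>a. P (xs @ [a]) (ys @ [b])"
    and len: "\<And>xs ys. P xs ys \<Longrightarrow> length xs = length ys"
    and eq: "\<And>xs ys i j. P xs ys \<Longrightarrow> i < length xs \<Longrightarrow> j < length xs \<Longrightarrow>
      xs ! i = xs ! j \<longleftrightarrow> ys ! i = ys ! j"
  obtains f where "bij f" "map f xs0 = ys0"
    "\<And>A. finite A \<Longrightarrow> \<exists>zs. A \<subseteq> set zs \<and> P zs (map f zs)"
proof -
  have "\<exists>xs' ys'. P (xs @ xs') (ys @ ys') \<and> a \<in> set xs' \<and> b \<in> set ys'"
    if P: "P xs ys" for xs ys a b
  proof -
    obtain b' where "P (xs @ [a]) (ys @ [b'])" using forth[OF P] by blast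
    from backward[OF this] obtain a' where "P ((xs @ [a]) @ [a']) ((ys @ [b']) @ [b])" by blast
    then show ?thesis by (intro exI[of _ "[a, a']"] exI[of _ "[b', b]"]) auto
  qed
  note step = this
  \<comment> \<open>Stage \<open>n\<close> puts the \<open>n\<close>-th element of either type into
    the list on its side, so both types are exhausted.\<close>
  define Q where "Q n p q \<longleftrightarrow> (\<exists>xs' ys'. q = (fst p @ xs', snd p @ ys') \<and>
      from_nat n \<in> set xs' \<and> from_nat n \<in> set ys')" for n and p q :: "'a list \<times> 'b list"
  have "\<exists>s. \<forall>n. (P (fst (s n)) (snd (s n)) \<and> (n = 0 \<longrightarrow> s n = (xs0, ys0))) \<and> Q n (s n) (s (Suc n))"
  proof (rule dependent_nat_choice)
    show "\<exists>p. P (fst p) (snd p) \<and> (0 = 0 \<longrightarrow> p = (xs0, ys0))"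
      using start by simp
    fix p and n :: nat
    assume p: "P (fst p) (snd p) \<and> (n = 0 \<longrightarrow> p = (xs0, ys0))"
    obtain xs' ys' where "P (fst p @ xs') (snd p @ ys')" "from_nat n \<in> set xs'" "from_nat n \<in> set ys'"
      using step[of "fst p" "snd p" "from_nat n" "from_nat n"] p by blast
    then show "\<exists>q. (P (fst q) (snd q) \<and> (Suc n = 0 \<longrightarrow> q = (xs0, ys0))) \<and> Q n p q"
      unfolding Q_def by (intro exI[of _ "(fst p @ xs', snd p @ ys')"]) auto
  qed
  then obtain s where P: "\<And>n. P (fst (s n)) (snd (s n))" and s0: "s 0 = (xs0, ys0)"
    and sS: "\<And>n. \<exists>xs' ys'. s (Suc n) = (fst (s n) @ xs', snd (s n) @ ys') \<and>
      from_nat n \<in> set xs' \<and> from_nat n \<in> set ys'"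
    unfolding Q_def by blast
  have ext: "\<exists>xs' ys'. fst (s m) = fst (s n) @ xs' \<and> snd (s m) = snd (s n) @ ys'" if "n \<le> m" for n m
    using that
  proof (induction m rule: dec_induct)
    case (step k)
    then show ?case using sS[of k] by auto
  qed auto
  define F where "F = {(a, b). \<exists>n. (a, b) \<in> set (zip (fst (s n)) (snd (s n)))}"
  have mono: "set (zip (fst (s n)) (snd (s n))) \<subseteq> set (zip (fst (s m)) (snd (s m)))" if "n \<le> m" for n m
  proof -
    obtain xs' ys' where "fst (s m) = fst (s n) @ xs'" "snd (s m) = snd (s n) @ ys'"
      using ext[OF \<open>n \<le> m\<close>] by blast
    then show ?thesis using len[OF P[of n]] by (simp add: zip_append)
  qed
  have inF: "a = a' \<longleftrightarrow> b = b'" if F12: "(a, b) \<in> F" "(a', b') \<in> F" for a b a' b'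
  proof -
    obtain n n' where "(a, b) \<in> set (zip (fst (s n)) (snd (s n)))"
      "(a', b') \<in> set (zip (fst (s n')) (snd (s n')))"
      using F12 unfolding F_def by blast
    then have "(a, b) \<in> set (zip (fst (s (max n n'))) (snd (s (max n n'))))"
      "(a', b') \<in> set (zip (fst (s (max n n'))) (snd (s (max n n'))))"
      using mono by (meson max.cobounded1 max.cobounded2 subsetD)+
    then show ?thesis using eq[OF P[of "max n n'"]] by (auto simp: in_set_zip)
  qed
  have nthF: "(fst (s n) ! i, snd (s n) ! i) \<in> F" if "i < length (fst (s n))" for n i
  proof -
    have "(fst (s n) ! i, snd (s n) ! i) \<in> set (zip (fst (s n)) (snd (s n)))"
      using that len[OF P[of n]] unfolding in_set_zip by (intro exI[of _ i]) simp
    then show ?thesis unfolding F_def by blast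
  qed
  have dom: "\<exists>b. (a, b) \<in> F" for a
  proof -
    have "a \<in> set (fst (s (Suc (to_nat a))))" using sS[of "to_nat a"] by auto
    then show ?thesis using nthF by (metis in_set_conv_nth)
  qed
  have ran: "\<exists>a. (a, b) \<in> F" for b
  proof -
    have "b \<in> set (snd (s (Suc (to_nat b))))" using sS[of "to_nat b"] by auto
    then show ?thesis using nthF len[OF P] by (metis in_set_conv_nth)
  qed
  define f where "f a = (SOME b. (a, b) \<in> F)" for a
  have f: "(a, f a) \<in> F" for a
    unfolding f_def using someI_ex[OF dom] .
  have fs: "map f (fst (s n)) = snd (s n)" for n
  proof (rule nth_equalityI)
    show "length (map f (fst (s n))) = length (snd (s n))" using len[OF P] by simp
    fix i assume i: "i < length (map f (fst (s n)))"
    then have "(fst (s n) ! i, snd (s n) ! i) \<in> F" using nthF by simp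
    then show "map f (fst (s n)) ! i = snd (s n) ! i" using f inF i by (metis length_map nth_map)
  qed
  have "bij f"
    unfolding bij_def
  proof
    show "inj f" using f inF by (metis injI)
    show "surj f" using f inF ran by (metis surjI)
  qed
  moreover have "map f xs0 = ys0" using fs[of 0] s0 by simp
  moreover have "\<exists>zs. A \<subseteq> set zs \<and> P zs (map f zs)" if "finite A" for A
    using that
  proof -
    have el: "\<exists>n. a \<in> set (fst (s n))" for a
      using sS[of "to_nat a"] by (intro exI[of _ "Suc (to_nat a)"]) auto
    have mo: "set (fst (s n)) \<subseteq> set (fst (s m))" if "n \<le> m" for n m
      using ext[OF that] by auto
    have "\<exists>n. A \<subseteq> set (fst (s n))" using that
    proof (induction A)
      case (insert a A)
      then obtain n n' where "A \<subseteq> set (fst (s n))" "a \<in> set (fst (s n'))" using el by blast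
      then have "insert a A \<subseteq> set (fst (s (max n n')))"
        using mo[of n "max n n'"] mo[of n' "max n n'"] by auto
      then show ?case by blast
    qed auto
    then show ?thesis using P fs by metis
  qed
  ultimately show thesis by (rule that)
qed


section \<open>Los's theorem along a deciding sequence, and compactness inside an omega-categorical
  structure\<close>

section \<open>Limits of Henkin assignments\<close>

text \<open>Diagonalisation over the countable index type. It is used twice: to build countable
  models and to build a complete type coding an orientation.\<close>

lemma deciding_subsequence:
  fixes Q :: "'c :: countable \<Rightarrow> nat \<Rightarrow> bool"
  obtains s :: "nat \<Rightarrow> nat" where "strict_mono s"
    "\<And>c. (\<forall>\<^sub>F k in sequentially. Q c (s k)) \<or> (\<forall>\<^sub>F k in sequentially. \<not> Q c (s k))"
proof -
  define D where "D n s \<longleftrightarrow> (\<forall>k. Q (from_nat n) (s k)) \<or> (\<forall>k. \<not> Q (from_nat n) (s k))"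
    for n and s :: "nat \<Rightarrow> nat"
  interpret subseqs D
  proof
    fix n and s :: "nat \<Rightarrow> nat"
    let ?S = "{k. Q (from_nat n) (s k)}"
    have "infinite ?S \<or> infinite (- ?S)"
      by (metis Compl_eq_Diff_UNIV finite_Diff2 infinite_UNIV_nat)
    then obtain T where T: "infinite T" "T = ?S \<or> T = - ?S" by blast
    then have "strict_mono (enumerate T)" "\<forall>k. enumerate T k \<in> T"
      by (auto simp: strict_mono_enumerate enumerate_in_set)
    then show "\<exists>r. strict_mono r \<and> D n (s \<circ> r)"
      using T(2) by (intro exI[of _ "enumerate T"]) (auto simp: D_def)
  qed
  \<comment> \<open>Only the tail of the diagonal sequence is a subsequence of the
    \<open>n\<close>-th one, so the decision holds eventually and not everywhere.\<close>
  have "D n (diagseq \<circ> ((+) (Suc n)))" for n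
    by (rule diagseq_holds) (auto simp: D_def)
  moreover have "diagseq \<circ> ((+) (Suc n)) = (\<lambda>k. diagseq (k + Suc n))" for n
    by (auto simp: add.commute)
  ultimately have D: "D n (\<lambda>k. diagseq (k + Suc n))" for n
    by metis
  have "(\<forall>\<^sub>F k in sequentially. Q c (diagseq k)) \<or> (\<forall>\<^sub>F k in sequentially. \<not> Q c (diagseq k))" for c
    using D[of "to_nat c"] eventually_sequentially_seg[of "Q c \<circ> diagseq" "Suc (to_nat c)"]
      eventually_sequentially_seg[of "Not \<circ> Q c \<circ> diagseq" "Suc (to_nat c)"]
    by (auto simp: D_def comp_def)
  then show thesis using subseq_diagseq that by blast
qed

text \<open>The index \<open>w \<phi> i\<close> does not depend on the assignment. All assignments
  of a sequence then name a witness at the same index, which is the witness in the limit.\<close>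

definition henkin_witness ::
  "'r language \<Rightarrow> ('r, 'a) struct \<Rightarrow> (('r, 'a) fm \<Rightarrow> nat \<Rightarrow> nat) \<Rightarrow> (nat \<Rightarrow> 'a) \<Rightarrow> bool" where
  "henkin_witness L M w e \<longleftrightarrow>
     (\<forall>\<phi>\<in>pure L. \<forall>i. sat M e (Exi i \<phi>) \<longrightarrow> sat M (e(i := e (w \<phi> i))) \<phi>)"

text \<open>The quantifier step of Los's theorem needs witnesses after a substitution
  \<open>v\<close>. Renaming with a fresh bound variable reduces this to the plain property, and the
  index found is again independent of \<open>e\<close>.\<close>

lemma henkin_rename:
  fixes \<phi> :: "('r, 'a) fm"
  assumes "\<phi> \<in> pure L"
  shows "\<exists>j. \<forall>e. henkin_witness L M w e \<longrightarrow> sat M (e \<circ> v) (Exi i \<phi>) \<longrightarrow>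
    sat M (e \<circ> v(i := j)) \<phi>"
proof -
  obtain m where m: "m \<notin> v ` free_vars \<phi>"
    using finite_free_vars[of \<phi>] by (meson ex_new_if_finite finite_imageI infinite_UNIV_nat)
  obtain \<psi> where \<psi>: "\<psi> \<in> pure L"
    "\<And>M :: ('r, 'a) struct. \<And>e. sat M e \<psi> \<longleftrightarrow> sat M (e \<circ> v(i := m)) \<phi>"
    using rename_formula[OF assms, of "v(i := m)"] by blast
  have upd: "sat M (e(m := a)) \<psi> \<longleftrightarrow> sat M ((e \<circ> v)(i := a)) \<phi>" for e a
    unfolding \<psi>(2) by (rule sat_cong) (use m in auto)
  have "sat M (e \<circ> v(i := w \<psi> m)) \<phi>"
    if e: "henkin_witness L M w e" and ex: "sat M (e \<circ> v) (Exi i \<phi>)" for e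
  proof -
    have "sat M e (Exi m \<psi>)" using ex by (simp add: upd)
    then have "sat M (e(m := e (w \<psi> m))) \<psi>"
      using e \<psi>(1) unfolding henkin_witness_def by blast
    moreover have "(e \<circ> v)(i := e (w \<psi> m)) = e \<circ> v(i := w \<psi> m)" by auto
    ultimately show ?thesis by (simp only: upd)
  qed
  then show ?thesis by blast
qed

text \<open>Eventual truth along a sequence of assignments that decides every formula plays the role of an
  ultraproduct: it defines a countable model of the theory, which \<open>\<omega>\<close>-categoricity identifies with
  \<open>M\<close> itself.\<close>

lemma omega_categorical_limit:
  fixes M :: "('r, 'a) struct" and e :: "nat \<Rightarrow> nat \<Rightarrow> 'a"
  assumes oc: "omega_categorical L M"
    and hw: "\<And>k. henkin_witness L M w (e k)"
    and dec: "\<And>\<phi>. \<phi> \<in> pure L \<Longrightarrow>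
      (\<forall>\<^sub>F k in sequentially. sat M (e k) \<phi>) \<or> (\<forall>\<^sub>F k in sequentially. \<not> sat M (e k) \<phi>)"
  obtains \<rho> where "surj \<rho>"
    "\<And>\<phi> v. \<phi> \<in> pure L \<Longrightarrow> sat M (\<rho> \<circ> v) \<phi> \<longleftrightarrow> (\<forall>\<^sub>F k in sequentially. sat M (e k \<circ> v) \<phi>)"
proof -
  have dec': "(\<forall>\<^sub>F k in sequentially. sat M (e k \<circ> v) \<phi>) \<or>
      (\<forall>\<^sub>F k in sequentially. \<not> sat M (e k \<circ> v) \<phi>)" if \<phi>: "\<phi> \<in> pure L" for \<phi> v
  proof -
    obtain \<psi> where "\<psi> \<in> pure L"
      "\<And>e. sat M e \<psi> \<longleftrightarrow> sat M (e \<circ> v) \<phi>"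
      using rename_formula[OF \<phi>, of v] by blast
    then show ?thesis using dec[of \<psi>] by simp
  qed
  \<comment> \<open>The limit has the indices as elements, identified when the assignments
    eventually agree on them.\<close>
  define R where "R = {(i, j). \<forall>\<^sub>F k in sequentially. e k i = e k j}"
  have equivR: "equiv UNIV R"
    by (rule equivI) (auto simp: R_def refl_on_def sym_def trans_def eq_commute elim: eventually_elim2)
  \<comment> \<open>The witness index of "differs from all variables in \<open>J\<close>" lies in a
    new class; so there are infinitely many classes.\<close>
  have fresh: "\<exists>j. \<forall>i\<in>J. (i, j) \<notin> R" if "finite J" for J
  proof -
    obtain js where js: "set js = J" using finite_list[OF \<open>finite J\<close>] by blast
    obtain m where m: "m \<notin> J" using \<open>finite J\<close> by (meson ex_new_if_finite infinite_UNIV_nat)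
    define \<phi> :: "('r, 'a) fm" where "\<phi> = conjs (map (\<lambda>i. Neg (Equal (Var i) (Var m))) js)"
    have \<phi>: "\<phi> \<in> pure L" by (auto simp: \<phi>_def)
    have "sat M (e k) (Exi m \<phi>)" for k
    proof -
      obtain a where "a \<notin> e k ` J"
        using oc \<open>finite J\<close> unfolding omega_categorical_def by (meson ex_new_if_finite finite_imageI)
      then have "sat M ((e k)(m := a)) \<phi>" using m js by (auto simp: \<phi>_def)
      then show ?thesis unfolding sat.simps by blast
    qed
    then have W: "sat M ((e k)(m := e k (w \<phi> m))) \<phi>" for k
      using hw[of k] \<phi> unfolding henkin_witness_def by blast
    have "e k i \<noteq> e k (w \<phi> m)" if "i \<in> J" for i k
    proof -
      have "sat M f \<phi> \<longleftrightarrow> (\<forall>i\<in>J. f i \<noteq> f m)" for f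
        using js by (auto simp: \<phi>_def)
      then show ?thesis using W[of k] m that by (metis fun_upd_apply)
    qed
    then show ?thesis by (intro exI[of _ "w \<phi> m"]) (simp add: R_def)
  qed
  have infQ: "infinite (UNIV // R)"
  proof
    assume fin: "finite (UNIV // R)"
    have "\<exists>J. finite J \<and> UNIV // R = (\<lambda>i. R `` {i}) ` J"
      using finite_subset_image[OF fin, of "\<lambda>i. R `` {i}" UNIV] by (auto simp: quotient_def)
    then obtain J where J: "finite J" "UNIV // R = (\<lambda>i. R `` {i}) ` J" by blast
    obtain j where j: "\<forall>i\<in>J. (i, j) \<notin> R" using fresh[OF J(1)] by blast
    have "R `` {j} \<in> UNIV // R" by (simp add: quotientI)
    then obtain i where "i \<in> J" "R `` {j} = R `` {i}" using J(2) by auto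
    then have "(i, j) \<in> R" using eq_equiv_class_iff[OF equivR, of i j] by simp
    then show False using j \<open>i \<in> J\<close> by blast
  qed
  have cntQ: "countable (UNIV // R)"
    unfolding quotient_def by (rule countable_UN) simp_all
  have cntA: "countable (UNIV :: 'a set)" and infA: "infinite (UNIV :: 'a set)"
    using oc unfolding omega_categorical_def by simp_all
  obtain h1 :: "nat set \<Rightarrow> nat" where h1: "bij_betw h1 (UNIV // R) UNIV"
    by (rule countableE_infinite[OF cntQ infQ])
  obtain h2 :: "'a \<Rightarrow> nat" where h2: "bij_betw h2 UNIV UNIV"
    by (rule countableE_infinite[OF cntA infA])
  \<comment> \<open>The quotient is transported to the type of \<open>M\<close>, since
    \<open>omega_categorical\<close> speaks only about models with that universe.\<close>
  define \<pi> where "\<pi> i = inv h2 (h1 (R `` {i}))" for i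
  have b: "bij_betw (inv h2 \<circ> h1) (UNIV // R) UNIV"
    using h1 bij_betw_inv_into[OF h2] by (rule bij_betw_trans)
  have \<pi>_eq: "\<pi> i = \<pi> j \<longleftrightarrow> (\<forall>\<^sub>F k in sequentially. e k i = e k j)" for i j
  proof -
    have "\<pi> i = \<pi> j \<longleftrightarrow> R `` {i} = R `` {j}"
      using inj_on_eq_iff[OF bij_betw_imp_inj_on[OF b], of "R `` {i}" "R `` {j}"]
      by (simp add: \<pi>_def quotientI)
    also have "\<dots> \<longleftrightarrow> (i, j) \<in> R" using eq_equiv_class_iff[OF equivR] by simp
    finally show ?thesis by (simp add: R_def)
  qed
  have \<pi>_surj: "\<exists>i. a = \<pi> i" for a
  proof -
    have "a \<in> (inv h2 \<circ> h1) ` (UNIV // R)" using b by (simp add: bij_betw_def)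
    then show ?thesis by (auto simp: \<pi>_def quotient_def)
  qed
  define N where "N r xs \<longleftrightarrow>
      (\<exists>is. xs = map \<pi> is \<and> (\<forall>\<^sub>F k in sequentially. M r (map (e k) is)))" for r xs
  have N: "N r (map \<pi> is) \<longleftrightarrow> (\<forall>\<^sub>F k in sequentially. M r (map (e k) is))" for r "is"
  proof
    assume "N r (map \<pi> is)"
    then obtain js where js: "map \<pi> is = map \<pi> js" "\<forall>\<^sub>F k in sequentially. M r (map (e k) js)"
      by (auto simp: N_def)
    have len: "length is = length js" using js(1) map_eq_imp_length_eq by blast
    have "\<forall>n\<in>{..<length is}. \<forall>\<^sub>F k in sequentially. e k (is ! n) = e k (js ! n)"
      using js(1) len \<pi>_eq by (metis lessThan_iff nth_map)
    then have "\<forall>\<^sub>F k in sequentially. \<forall>n\<in>{..<length is}. e k (is ! n) = e k (js ! n)"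
      by (simp add: eventually_ball_finite)
    with js(2) show "\<forall>\<^sub>F k in sequentially. M r (map (e k) is)"
    proof eventually_elim
      case (elim k)
      then have "map (e k) is = map (e k) js"
        using len by (intro nth_equalityI) auto
      then show ?case using elim by simp
    qed
  qed (auto simp: N_def)
  \<comment> \<open>Los's theorem: negation uses that the sequence decides all formulas, the
    quantifier uses the uniform witnesses.\<close>
  have los: "sat N (\<pi> \<circ> v) \<phi> \<longleftrightarrow> (\<forall>\<^sub>F k in sequentially. sat M (e k \<circ> v) \<phi>)"
    if "\<phi> \<in> pure L" for \<phi> v
    using that
  proof (induction \<phi> arbitrary: v)
    case (Equal s t)
    then show ?case by (cases s; cases t) (auto simp: \<pi>_eq)
  next
    case (Atom r ts)
    define idx where "idx t = (case t of Var i \<Rightarrow> v i | Par a \<Rightarrow> 0)" for t :: "'a trm"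
    have "trm_val (f \<circ> v) t = f (idx t)" if "t \<in> set ts" for f :: "nat \<Rightarrow> 'a" and t
      using Atom that by (cases t) (auto simp: idx_def)
    then have "map (trm_val (f \<circ> v)) ts = map f (map idx ts)" for f :: "nat \<Rightarrow> 'a" by simp
    then show ?case by (simp only: sat.simps N)
  next
    case (Neg \<phi>)
    then have "sat N (\<pi> \<circ> v) \<phi> \<longleftrightarrow> (\<forall>\<^sub>F k in sequentially. sat M (e k \<circ> v) \<phi>)" by (simp only: pure_simps)
    moreover have "\<not> ((\<forall>\<^sub>F k in sequentially. sat M (e k \<circ> v) \<phi>) \<and>
        (\<forall>\<^sub>F k in sequentially. \<not> sat M (e k \<circ> v) \<phi>))"
      using eventually_conj[of "\<lambda>k. sat M (e k \<circ> v) \<phi>" sequentially "\<lambda>k. \<not> sat M (e k \<circ> v) \<phi>"] by auto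
    ultimately show ?case using dec'[of \<phi> v] Neg.prems
      by (simp only: sat.simps pure_simps) blast
  next
    case (Conj \<phi> \<psi>)
    then show ?case by (simp only: sat.simps pure_simps eventually_conj_iff)
  next
    case (Exi i \<phi>)
    have \<phi>: "\<phi> \<in> pure L" using Exi by simp
    have upd: "(f \<circ> v)(i := f j) = f \<circ> v(i := j)" for f :: "nat \<Rightarrow> 'a" and j by auto
    have "sat N (\<pi> \<circ> v) (Exi i \<phi>) \<longleftrightarrow> (\<exists>j. sat N ((\<pi> \<circ> v)(i := \<pi> j)) \<phi>)"
      using \<pi>_surj by (metis sat.simps(5))
    also have "\<dots> \<longleftrightarrow> (\<exists>j. \<forall>\<^sub>F k in sequentially. sat M (e k \<circ> v(i := j)) \<phi>)"
      using Exi by (simp only: upd pure_simps)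
    also have "\<dots> \<longleftrightarrow> (\<forall>\<^sub>F k in sequentially. sat M (e k \<circ> v) (Exi i \<phi>))"
    proof
      assume "\<exists>j. \<forall>\<^sub>F k in sequentially. sat M (e k \<circ> v(i := j)) \<phi>"
      then show "\<forall>\<^sub>F k in sequentially. sat M (e k \<circ> v) (Exi i \<phi>)"
        by (elim exE eventually_mono) (simp only: sat.simps upd[symmetric], blast)
    next
      assume "\<forall>\<^sub>F k in sequentially. sat M (e k \<circ> v) (Exi i \<phi>)"
      then show "\<exists>j. \<forall>\<^sub>F k in sequentially. sat M (e k \<circ> v(i := j)) \<phi>"
        using henkin_rename[OF \<phi>, of M w v i] hw by (meson eventually_mono)
    qed
    finally show ?case .
  qed
  have "models N (theory_of L M)"
    unfolding models_def
  proof (intro ballI allI)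
    fix \<phi> and f :: "nat \<Rightarrow> 'a"
    assume \<phi>: "\<phi> \<in> theory_of L M"
    have "\<forall>i. \<exists>j. f i = \<pi> j" using \<pi>_surj by blast
    then obtain v where "f = \<pi> \<circ> v" by (metis comp_apply ext)
    moreover have "\<phi> \<in> pure L" using \<phi> by (auto simp: theory_of_def is_sentence_def pure_def)
    ultimately show "sat N f \<phi>" using \<phi> los by (auto simp: theory_of_def)
  qed
  \<comment> \<open>The isomorphism turns the enumeration \<open>\<pi>\<close> of the limit into an
    enumeration of \<open>M\<close> itself.\<close>
  then obtain f where f: "is_isomorphism L M N f"
    using oc unfolding omega_categorical_def isomorphic_def by blast
  then have bf: "bij f" by (simp add: is_isomorphism_def)
  show thesis
  proof
    show "surj (inv f \<circ> \<pi>)"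
      using \<pi>_surj bf by (metis bij_imp_bij_inv bij_is_surj comp_surj surjI surj_def)
    fix \<phi> :: "('r, 'a) fm" and v
    assume "\<phi> \<in> pure L"
    then have "sat M (inv f \<circ> \<pi> \<circ> v) \<phi> \<longleftrightarrow> sat N (f \<circ> (inv f \<circ> \<pi> \<circ> v)) \<phi>"
      by (rule sat_isomorphism[OF f, symmetric])
    also have "f \<circ> (inv f \<circ> \<pi> \<circ> v) = \<pi> \<circ> v"
      using bf by (auto simp: bij_is_surj surj_f_inv_f)
    finally show "sat M (inv f \<circ> \<pi> \<circ> v) \<phi> \<longleftrightarrow> (\<forall>\<^sub>F k in sequentially. sat M (e k \<circ> v) \<phi>)"
      by (simp only: los[OF \<open>\<phi> \<in> pure L\<close>])
  qed
qed

text \<open>A schedule: the second component of the decoded pair is ignored, so every task returns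
  at arbitrarily late times and can wait until its data have appeared.\<close>

definition task :: "nat \<Rightarrow> 'c :: countable" where
  "task j = from_nat (fst (prod_decode j))"

lemma task_recurs: "\<exists>j\<ge>n. task j = c"
  by (intro exI[of _ "prod_encode (to_nat c, n)"]) (simp add: task_def le_prod_encode_2)

text \<open>\<open>w\<close> is fixed before \<open>u\<close>: the witness for
  \<open>(\<phi>, i)\<close> sits at an index that is scheduled for it, lies beyond the relevant
  free variables, and is at least \<open>n\<close>, so that the prescribed values survive. Then
  \<open>e\<close> is built by recursion on the index.\<close>

lemma henkin_extension:
  fixes M :: "('r :: countable, 'a :: countable) struct"
  shows "\<exists>w. \<forall>u. \<exists>e. (\<forall>i<n. e i = u i) \<and> henkin_witness L M w e"
proof -
  define w :: "('r, 'a) fm \<Rightarrow> nat \<Rightarrow> nat" where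
    "w \<phi> i = (SOME j. n \<le> j \<and> free_vars \<phi> - {i} \<subseteq> {..<j} \<and> task j = (\<phi>, i))" for \<phi> i
  have w: "n \<le> w \<phi> i \<and> free_vars \<phi> - {i} \<subseteq> {..<w \<phi> i} \<and> task (w \<phi> i) = (\<phi>, i)" for \<phi> i
  proof -
    obtain m where "free_vars \<phi> \<subseteq> {..<m}"
      using finite_free_vars[of \<phi>] finite_nat_iff_bounded by blast
    moreover obtain j where "max n m \<le> j" "task j = (\<phi>, i)" using task_recurs by blast
    ultimately have "\<exists>j. n \<le> j \<and> free_vars \<phi> - {i} \<subseteq> {..<j} \<and> task j = (\<phi>, i)"
      by (intro exI[of _ j]) auto
    then show ?thesis unfolding w_def by (rule someI_ex)
  qed
  have "\<exists>e. (\<forall>i<n. e i = u i) \<and> henkin_witness L M w e" for u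
  proof -
    have "\<exists>e. \<forall>j. if j < n then e j = u j else
        (\<forall>\<phi> i. task j = (\<phi>, i) \<longrightarrow> free_vars \<phi> - {i} \<subseteq> {..<j} \<longrightarrow>
          sat M e (Exi i \<phi>) \<longrightarrow> sat M (e(i := e j)) \<phi>)"
    proof (rule dependent_wf_choice[OF wf])
      fix f g :: "nat \<Rightarrow> 'a" and j a
      assume fg: "\<And>z. (z, j) \<in> {(x, y). x < y} \<Longrightarrow> f z = g z"
      \<comment> \<open>The requirement at \<open>j\<close> depends only on the values before
        \<open>j\<close>, as the recursion demands.\<close>
      have "sat M (f(i := a)) \<phi> = sat M (g(i := a)) \<phi>"
        if "free_vars \<phi> - {i} \<subseteq> {..<j}" for i a \<phi>
        by (rule sat_cong) (use that fg in auto)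
      then show "(if j < n then a = u j else
        (\<forall>\<phi> i. task j = (\<phi>, i) \<longrightarrow> free_vars \<phi> - {i} \<subseteq> {..<j} \<longrightarrow>
          sat M f (Exi i \<phi>) \<longrightarrow> sat M (f(i := a)) \<phi>)) =
        (if j < n then a = u j else
        (\<forall>\<phi> i. task j = (\<phi>, i) \<longrightarrow> free_vars \<phi> - {i} \<subseteq> {..<j} \<longrightarrow>
          sat M g (Exi i \<phi>) \<longrightarrow> sat M (g(i := a)) \<phi>))"
        by (simp cong: imp_cong)
    next
      fix j and f :: "nat \<Rightarrow> 'a"
      show "\<exists>a. if j < n then a = u j else
        (\<forall>\<phi> i. task j = (\<phi>, i) \<longrightarrow> free_vars \<phi> - {i} \<subseteq> {..<j} \<longrightarrow>
          sat M f (Exi i \<phi>) \<longrightarrow> sat M (f(i := a)) \<phi>)"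
        by (cases "task j :: ('r, 'a) fm \<times> nat") auto
    qed
    then obtain e where e: "\<And>j. if j < n then e j = u j else
        (\<forall>\<phi> i. task j = (\<phi>, i) \<longrightarrow> free_vars \<phi> - {i} \<subseteq> {..<j} \<longrightarrow>
          sat M e (Exi i \<phi>) \<longrightarrow> sat M (e(i := e j)) \<phi>)"
      by blast
    have "e i = u i" if "i < n" for i using e[of i] that by simp
    moreover have "henkin_witness L M w e"
      unfolding henkin_witness_def
    proof (intro ballI allI impI)
      fix \<phi> i
      assume "sat M e (Exi i \<phi>)"
      then show "sat M (e(i := e (w \<phi> i))) \<phi>"
        using e[of "w \<phi> i"] w[of \<phi> i] by auto
    qed
    ultimately show ?thesis by blast
  qed
  then show ?thesis by blast
qed

text \<open>Compactness without leaving \<open>M\<close>: assignments for growing finite parts of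
  \<open>\<Sigma>\<close> are given Henkin witnesses beyond the first \<open>n\<close> variables,
  thinned to a deciding sequence, and the limit is read back in \<open>M\<close>.\<close>

lemma omega_categorical_realizes:
  fixes M :: "('r :: countable, 'a :: countable) struct"
  assumes oc: "omega_categorical L M"
    and \<Sigma>: "\<Sigma> \<subseteq> pure_upto L n"
    and fs: "\<And>F. finite F \<Longrightarrow> F \<subseteq> \<Sigma> \<Longrightarrow> \<exists>e. \<forall>\<phi>\<in>F. sat M e \<phi>"
  shows "\<exists>e. \<forall>\<phi>\<in>\<Sigma>. sat M e \<phi>"
proof -
  obtain w where w: "\<And>u. \<exists>e. (\<forall>i<n. e i = u i) \<and> henkin_witness L M w e"
    using henkin_extension[of n L M] by blast
  have "\<exists>e. henkin_witness L M w e \<and> (\<forall>\<phi>\<in>\<Sigma>. to_nat \<phi> < k \<longrightarrow> sat M e \<phi>)" for k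
  proof -
    have "finite {\<phi> \<in> \<Sigma>. to_nat \<phi> < k}"
      by (rule finite_subset[of _ "to_nat -` {..<k}"]) (auto intro: finite_vimageI)
    then obtain u where u: "\<forall>\<phi>\<in>{\<phi> \<in> \<Sigma>. to_nat \<phi> < k}. sat M u \<phi>"
      using fs[of "{\<phi> \<in> \<Sigma>. to_nat \<phi> < k}"] by blast
    obtain e where e: "\<And>i. i < n \<Longrightarrow> e i = u i" "henkin_witness L M w e" using w[of u] by blast
    have "sat M e \<phi> \<longleftrightarrow> sat M u \<phi>" if "\<phi> \<in> \<Sigma>" for \<phi>
      by (rule sat_cong) (use \<Sigma> that e(1) in \<open>auto simp: pure_upto_def\<close>)
    then show ?thesis using u e(2) by blast
  qed
  then have "\<exists>e. \<forall>k. henkin_witness L M w (e k) \<and> (\<forall>\<phi>\<in>\<Sigma>. to_nat \<phi> < k \<longrightarrow> sat M (e k) \<phi>)"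
    by (intro choice allI)
  then obtain e where hw: "\<And>k. henkin_witness L M w (e k)"
    and e: "\<And>k \<phi>. \<phi> \<in> \<Sigma> \<Longrightarrow> to_nat \<phi> < k \<Longrightarrow> sat M (e k) \<phi>"
    by blast
  obtain s :: "nat \<Rightarrow> nat" where s: "strict_mono s"
    "\<And>\<phi>. (\<forall>\<^sub>F k in sequentially. sat M (e (s k)) \<phi>) \<or> (\<forall>\<^sub>F k in sequentially. \<not> sat M (e (s k)) \<phi>)"
    by (rule deciding_subsequence[of "\<lambda>\<phi> k. sat M (e k) \<phi>"]) blast
  obtain \<rho> where \<rho>: "\<And>\<phi> v. \<phi> \<in> pure L \<Longrightarrow>
      sat M (\<rho> \<circ> v) \<phi> \<longleftrightarrow> (\<forall>\<^sub>F k in sequentially. sat M (e (s k) \<circ> v) \<phi>)"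
    by (rule omega_categorical_limit[OF oc, of w "\<lambda>k. e (s k)"]) (use hw s(2) in blast)+
  have "sat M \<rho> \<phi>" if "\<phi> \<in> \<Sigma>" for \<phi>
  proof -
    have "\<forall>\<^sub>F k in sequentially. sat M (e (s k)) \<phi>"
      unfolding eventually_sequentially
      using e[OF that] seq_suble[OF s(1)] by (meson Suc_le_lessD order_trans)
    then show ?thesis using \<rho>[of \<phi> id] \<Sigma> that by (auto simp: pure_upto_def)
  qed
  then show ?thesis by blast
qed


section \<open>Ryll-Nardzewski: from uniqueness of the countable model to finitely many
  orbits\<close>

section \<open>Isolated types and the automorphism group\<close>

text \<open>Isolation in semantic form: any two realisations in \<open>M\<close> satisfy the same
  formulas. An unsatisfiable formula qualifies too, so a realisation is always requested
  separately.\<close>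

definition isolates :: "'r language \<Rightarrow> ('r, 'a) struct \<Rightarrow> nat \<Rightarrow> ('r, 'a) fm \<Rightarrow> bool" where
  "isolates L M n \<theta> \<longleftrightarrow> \<theta> \<in> pure_upto L n \<and>
     (\<forall>e e'. sat M e \<theta> \<longrightarrow> sat M e' \<theta> \<longrightarrow> (\<forall>\<psi>\<in>pure_upto L n. sat M e \<psi> \<longleftrightarrow> sat M e' \<psi>))"

lemma isolatesD:
  "isolates L M n \<theta> \<Longrightarrow> sat M e \<theta> \<Longrightarrow> sat M e' \<theta> \<Longrightarrow> \<psi> \<in> pure_upto L n \<Longrightarrow>
    sat M e \<psi> \<longleftrightarrow> sat M e' \<psi>"
  unfolding isolates_def by blast

lemma sat_cong_upto:
  assumes "\<phi> \<in> pure_upto L n" "\<And>i. i < n \<Longrightarrow> e i = e' i"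
  shows "sat M e \<phi> \<longleftrightarrow> sat M e' \<phi>"
  by (rule sat_cong) (use assms in \<open>auto simp: pure_upto_def\<close>)

text \<open>Were \<open>\<eta>\<close> not implied by an isolating formula, one could strengthen it step by step so
  as to exclude every tuple of the countable structure, against the realization of types.\<close>

lemma isolating_dense:
  fixes M :: "('r :: countable, 'a :: countable) struct"
  assumes oc: "omega_categorical L M" and \<eta>: "\<eta> \<in> pure_upto L n" and sat: "sat M e0 \<eta>"
  shows "\<exists>\<theta> e. isolates L M n \<theta> \<and> sat M e \<theta> \<and> (\<forall>e. sat M e \<theta> \<longrightarrow> sat M e \<eta>)"
proof (rule ccontr)
  assume no: "\<not> ?thesis"
  \<comment> \<open>Decoded lists serve as assignments, so \<open>t\<close> runs through all finite
    tuples of the countable universe.\<close>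
  define t :: "nat \<Rightarrow> nat \<Rightarrow> 'a" where "t k = (!) (from_nat k)" for k
  define good where "good \<theta> \<longleftrightarrow> \<theta> \<in> pure_upto L n \<and> (\<exists>e. sat M e \<theta>) \<and>
      (\<forall>e. sat M e \<theta> \<longrightarrow> sat M e \<eta>)" for \<theta>
  have "\<exists>\<theta>. \<forall>k. good (\<theta> k) \<and>
      ((\<forall>e. sat M e (\<theta> (Suc k)) \<longrightarrow> sat M e (\<theta> k)) \<and> \<not> sat M (t k) (\<theta> (Suc k)))"
  proof (rule dependent_nat_choice)
    show "\<exists>\<theta>. good \<theta>" using \<eta> sat by (auto simp: good_def)
    fix \<theta> k
    assume \<theta>: "good \<theta>"
    then have "\<not> isolates L M n \<theta>" using no unfolding good_def by blast
    then obtain e e' \<psi> where e: "sat M e \<theta>" "sat M e' \<theta>" "\<psi> \<in> pure_upto L n"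
      "sat M e \<psi>" "\<not> sat M e' \<psi>"
      using \<theta> unfolding isolates_def good_def by blast
    then have 1: "good (Conj \<theta> \<psi>)" "good (Conj \<theta> (Neg \<psi>))"
      using \<theta> unfolding good_def pure_upto_def by auto
    \<comment> \<open>Both strengthenings are satisfiable because \<open>\<theta>\<close> does not
      isolate; the one that fails at \<open>t k\<close> is taken.\<close>
    show "\<exists>\<theta>'. good \<theta>' \<and> ((\<forall>e. sat M e \<theta>' \<longrightarrow> sat M e \<theta>) \<and> \<not> sat M (t k) \<theta>')"
    proof (cases "sat M (t k) \<psi>")
      case True
      then show ?thesis using 1 by (intro exI[of _ "Conj \<theta> (Neg \<psi>)"]) simp
    next
      case False
      then show ?thesis using 1 by (intro exI[of _ "Conj \<theta> \<psi>"]) simp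
    qed
  qed
  then obtain \<theta> where good: "\<And>k. good (\<theta> k)"
    and \<theta>_step: "\<And>k e. sat M e (\<theta> (Suc k)) \<Longrightarrow> sat M e (\<theta> k)"
    and avoid: "\<And>k. \<not> sat M (t k) (\<theta> (Suc k))"
    by blast
  have anti: "sat M e (\<theta> l) \<Longrightarrow> sat M e (\<theta> k)" if "k \<le> l" for e k l
    using that
  proof (induction l rule: dec_induct)
    case (step l)
    then show ?case using \<theta>_step by blast
  qed
  have mem: "\<theta> k \<in> pure_upto L n" for k using good[of k] by (simp add: good_def)
  have "\<exists>e. \<forall>\<phi>\<in>range \<theta>. sat M e \<phi>"
  proof (rule omega_categorical_realizes[OF oc])
    show "range \<theta> \<subseteq> pure_upto L n" using mem by blast
    fix F
    assume F: "finite F" "F \<subseteq> range \<theta>"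
    then obtain K where K: "finite K" "F = \<theta> ` K" by (meson finite_subset_image)
    then obtain m where m: "\<forall>k\<in>K. k \<le> m" using finite_nat_set_iff_bounded_le by blast
    obtain e where "sat M e (\<theta> m)" using good[of m] by (auto simp: good_def)
    then have "\<forall>k\<in>K. sat M e (\<theta> k)" using anti m by blast
    then show "\<exists>e. \<forall>\<phi>\<in>F. sat M e \<phi>" using K(2) by blast
  qed
  then obtain e where e: "\<And>k. sat M e (\<theta> k)" by blast
  define k where "k = to_nat (map e [0..<n])"
  have "sat M (t k) (\<theta> (Suc k)) \<longleftrightarrow> sat M e (\<theta> (Suc k))"
    by (rule sat_cong_upto[of _ L n]) (use mem in \<open>auto simp: t_def k_def\<close>)
  then show False using avoid e by blast
qed

text \<open>\<open>Exi n \<theta>\<close> concerns only the first \<open>n\<close> variables, so it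
  is part of the isolated type and passes from \<open>e1\<close> to \<open>e\<close>.\<close>

lemma sat_Exi_last:
  assumes "isolates L M n \<theta>0" "sat M e \<theta>0" "sat M e1 \<theta>0"
    and "\<theta> \<in> pure_upto L (Suc n)" "sat M e1 \<theta>"
  shows "\<exists>a. sat M (e(n := a)) \<theta>"
proof -
  have "sat M (e1(n := e1 n)) \<theta>" using assms(5) by simp
  then have "sat M e1 (Exi n \<theta>)" unfolding sat.simps by blast
  moreover have "Exi n \<theta> \<in> pure_upto L n" using assms(4) by (auto simp: pure_upto_def)
  ultimately have "sat M e (Exi n \<theta>)" using isolatesD[OF assms(1-3)] by blast
  then show ?thesis by simp
qed

text \<open>Isolating formulas are dense below \<open>Conj \<theta>0 \<eta>\<close>; a realisation
  of one is moved over the given isolated tuple by \<open>sat_Exi_last\<close>.\<close>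

lemma isolated_tuple_extend:
  fixes M :: "('r :: countable, 'a :: countable) struct"
  assumes oc: "omega_categorical L M"
    and \<theta>0: "isolates L M n \<theta>0" "sat M e \<theta>0"
    and \<eta>: "\<eta> \<in> pure_upto L (Suc n)" "sat M (e(n := a)) \<eta>"
  shows "\<exists>b \<theta>. isolates L M (Suc n) \<theta> \<and> sat M (e(n := b)) \<theta> \<and> sat M (e(n := b)) \<eta>"
proof -
  have p0: "\<theta>0 \<in> pure_upto L n" using \<theta>0(1) by (simp add: isolates_def)
  have "sat M (e(n := a)) \<theta>0 \<longleftrightarrow> sat M e \<theta>0" by (rule sat_cong_upto[OF p0]) simp
  then have "sat M (e(n := a)) (Conj \<theta>0 \<eta>)" using \<theta>0(2) \<eta>(2) by simp
  moreover have "Conj \<theta>0 \<eta> \<in> pure_upto L (Suc n)"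
    using p0 \<eta>(1) by (auto simp: pure_upto_def less_Suc_eq)
  ultimately obtain \<theta> e1 where \<theta>: "isolates L M (Suc n) \<theta>" "sat M e1 \<theta>"
    "\<And>e. sat M e \<theta> \<Longrightarrow> sat M e (Conj \<theta>0 \<eta>)"
    using isolating_dense[OF oc] by blast
  have "\<theta> \<in> pure_upto L (Suc n)" using \<theta>(1) by (simp add: isolates_def)
  moreover have "sat M e1 \<theta>0" using \<theta>(2,3) by simp
  ultimately obtain b where b: "sat M (e(n := b)) \<theta>" using sat_Exi_last[OF \<theta>0] \<theta>(2) by blast
  moreover have "sat M (e(n := b)) \<eta>" using \<theta>(3)[OF b] by simp
  ultimately show ?thesis using \<theta>(1) by blast
qed

text \<open>The universe is exhausted by an assignment all of whose initial segments are isolated: such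
  an assignment can be chosen with Henkin witnesses, and then \<open>\<omega>\<close>-categoricity turns the
  elementary substructure that it enumerates into the whole structure.\<close>

lemma isolated_enumeration:
  fixes M :: "('r :: countable, 'a :: countable) struct"
  assumes oc: "omega_categorical L M"
  obtains \<rho> where "surj \<rho>" "\<And>n. \<exists>\<theta>. isolates L M n \<theta> \<and> sat M \<rho> \<theta>"
proof -
  define w :: "('r, 'a) fm \<Rightarrow> nat \<Rightarrow> nat" where
    "w \<phi> i = (SOME j. free_vars \<phi> - {i} \<subseteq> {..<j} \<and> task j = (\<phi>, i))" for \<phi> i
  have w: "free_vars \<phi> - {i} \<subseteq> {..<w \<phi> i} \<and> task (w \<phi> i) = (\<phi>, i)" for \<phi> i
  proof -
    obtain m where "free_vars \<phi> \<subseteq> {..<m}"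
      using finite_free_vars[of \<phi>] finite_nat_iff_bounded by blast
    moreover obtain j where "m \<le> j" "task j = (\<phi>, i)" using task_recurs by blast
    ultimately have "\<exists>j. free_vars \<phi> - {i} \<subseteq> {..<j} \<and> task j = (\<phi>, i)"
      by (intro exI[of _ j]) auto
    then show ?thesis unfolding w_def by (rule someI_ex)
  qed
  \<comment> \<open>Each new value has two duties: to keep the initial segment isolated, and to be a
    witness if the scheduled formula asks for one.\<close>
  define ok where "ok e j a \<longleftrightarrow>
      (\<exists>\<theta>. isolates L M (Suc j) \<theta> \<and> sat M (e(j := a)) \<theta>) \<and>
      (\<forall>\<phi> i. task j = (\<phi>, i) \<longrightarrow> \<phi> \<in> pure L \<longrightarrow> free_vars \<phi> - {i} \<subseteq> {..<j} \<longrightarrow>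
          sat M e (Exi i \<phi>) \<longrightarrow> sat M (e(i := a)) \<phi>)" for e j and a :: 'a
  have "\<exists>e. \<forall>j. ok e j (e j)"
  proof (rule dependent_wf_choice[OF wf])
    fix f g :: "nat \<Rightarrow> 'a" and j a
    assume fg: "\<And>z. (z, j) \<in> {(x, y). x < y} \<Longrightarrow> f z = g z"
    have "sat M (f(i := a)) \<phi> = sat M (g(i := a)) \<phi>"
      if "free_vars \<phi> - {i} \<subseteq> {..<j}" for i a and \<phi> :: "('r, 'a) fm"
      by (rule sat_cong) (use that fg in auto)
    moreover have "sat M (f(j := a)) \<theta> = sat M (g(j := a)) \<theta>" if "isolates L M (Suc j) \<theta>" for \<theta>
      by (rule sat_cong_upto[of _ L "Suc j"]) (use that fg in \<open>auto simp: isolates_def\<close>)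
    moreover have "sat M f (Exi i \<phi>) = sat M g (Exi i \<phi>)"
      if "free_vars \<phi> - {i} \<subseteq> {..<j}" for i and \<phi> :: "('r, 'a) fm"
      by (rule sat_cong) (use that fg in auto)
    ultimately show "ok f j a = ok g j a"
      unfolding ok_def by blast
  next
    fix j and f :: "nat \<Rightarrow> 'a"
    assume IH: "\<And>i. (i, j) \<in> {(x, y). x < y} \<Longrightarrow> ok f i (f i)"
    have "\<exists>\<theta>0. isolates L M j \<theta>0 \<and> sat M f \<theta>0"
    proof (cases j)
      case 0
      have "isolates L M 0 (conjs [])"
        using sat_cong_upto[of _ L 0] unfolding isolates_def by (auto simp: pure_upto_def)
      then show ?thesis using 0 by (intro exI[of _ "conjs []"]) simp
    next
      case (Suc i)
      then have "ok f i (f i)" by (intro IH) simp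
      then show ?thesis unfolding ok_def fun_upd_triv Suc by blast
    qed
    then obtain \<theta>0 where \<theta>0: "isolates L M j \<theta>0" "sat M f \<theta>0" by blast
    obtain \<phi> :: "('r, 'a) fm" and i :: nat where task: "task j = (\<phi>, i)" by fastforce
    \<comment> \<open>The request for a witness becomes a condition \<open>\<eta>\<close> on
      coordinate \<open>j\<close> by renaming \<open>i\<close> to \<open>j\<close>; if there is no
      request, \<open>\<eta>\<close> is a tautology.\<close>
    have "\<exists>\<eta> a. \<eta> \<in> pure_upto L (Suc j) \<and> sat M (f(j := a)) \<eta> \<and>
        (\<phi> \<in> pure L \<longrightarrow> free_vars \<phi> - {i} \<subseteq> {..<j} \<longrightarrow> sat M f (Exi i \<phi>) \<longrightarrow>
          (\<forall>b. sat M (f(j := b)) \<eta> \<longrightarrow> sat M (f(i := b)) \<phi>))"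
    proof (cases "\<phi> \<in> pure L \<and> free_vars \<phi> - {i} \<subseteq> {..<j} \<and> sat M f (Exi i \<phi>)")
      case True
      then obtain \<eta> where \<eta>: "\<eta> \<in> pure L" "free_vars \<eta> \<subseteq> id(i := j) ` free_vars \<phi>"
        "\<And>e. sat M e \<eta> \<longleftrightarrow> sat M (e \<circ> id(i := j)) \<phi>"
        using rename_formula[of \<phi> L "id(i := j)"] by blast
      have "sat M (f(j := b)) \<eta> \<longleftrightarrow> sat M (f(i := b)) \<phi>" for b
        unfolding \<eta>(3) by (rule sat_cong) (use True in auto)
      moreover have "\<eta> \<in> pure_upto L (Suc j)"
        using \<eta>(1,2) True by (fastforce simp: pure_upto_def)
      ultimately show ?thesis using True by auto
    next
      case False
      then show ?thesis by (intro exI[of _ "conjs []"]) (auto simp: pure_upto_def)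
    qed
    then obtain \<eta> a where \<eta>: "\<eta> \<in> pure_upto L (Suc j)" "sat M (f(j := a)) \<eta>"
      and \<eta>\<phi>: "\<phi> \<in> pure L \<Longrightarrow> free_vars \<phi> - {i} \<subseteq> {..<j} \<Longrightarrow> sat M f (Exi i \<phi>) \<Longrightarrow>
          (\<forall>b. sat M (f(j := b)) \<eta> \<longrightarrow> sat M (f(i := b)) \<phi>)"
      by blast
    obtain b \<theta> where b: "isolates L M (Suc j) \<theta>" "sat M (f(j := b)) \<theta>" "sat M (f(j := b)) \<eta>"
      using isolated_tuple_extend[OF oc \<theta>0 \<eta>] by blast
    have "ok f j b"
      unfolding ok_def
    proof (intro conjI allI impI)
      show "\<exists>\<theta>. isolates L M (Suc j) \<theta> \<and> sat M (f(j := b)) \<theta>" using b by blast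
      fix \<phi>' :: "('r, 'a) fm" and i'
      assume *: "task j = (\<phi>', i')" "\<phi>' \<in> pure L" "free_vars \<phi>' - {i'} \<subseteq> {..<j}" "sat M f (Exi i' \<phi>')"
      have "\<phi>' = \<phi>" "i' = i" using task *(1) by simp_all
      then show "sat M (f(i' := b)) \<phi>'" using \<eta>\<phi> *(2-4) b(3) by blast
    qed
    then show "\<exists>a. ok f j a" by blast
  qed
  then obtain e where e: "\<And>j. ok e j (e j)" by blast
  have hw: "henkin_witness L M w e"
    unfolding henkin_witness_def
  proof (intro ballI allI impI)
    fix \<phi> i
    assume "\<phi> \<in> pure L" "sat M e (Exi i \<phi>)"
    then show "sat M (e(i := e (w \<phi> i))) \<phi>"
      using e[of "w \<phi> i", unfolded ok_def, THEN conjunct2, rule_format, of \<phi> i] w[of \<phi> i] by blast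
  qed
  \<comment> \<open>The limit of a constant sequence: eventual truth is truth under
    \<open>e\<close>, so \<open>\<rho>\<close> satisfies the same formulas as \<open>e\<close> but
    exhausts the universe.\<close>
  obtain \<rho> where \<rho>: "surj \<rho>" "\<And>\<phi> v. \<phi> \<in> pure L \<Longrightarrow> sat M (\<rho> \<circ> v) \<phi> \<longleftrightarrow> sat M (e \<circ> v) \<phi>"
    by (rule omega_categorical_limit[OF oc, of w "\<lambda>_. e"]) (use hw in auto)
  have "\<exists>\<theta>. isolates L M n \<theta> \<and> sat M e \<theta>" for n
  proof (cases n)
    case 0
    have "isolates L M 0 (conjs [])"
      using sat_cong_upto[of _ L 0] unfolding isolates_def by (auto simp: pure_upto_def)
    then show ?thesis using 0 by (intro exI[of _ "conjs []"]) simp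
  next
    case (Suc j)
    then show ?thesis using e[of j] unfolding ok_def fun_upd_triv by blast
  qed
  note iso_e = this
  have "\<exists>\<theta>. isolates L M n \<theta> \<and> sat M \<rho> \<theta>" for n
  proof -
    obtain \<theta> where \<theta>: "isolates L M n \<theta>" "sat M e \<theta>" using iso_e[of n] by blast
    then have "\<theta> \<in> pure L" by (simp add: isolates_def pure_upto_def)
    from \<rho>(2)[OF this, of id] have "sat M \<rho> \<theta>" using \<theta>(2) by (simp only: comp_id)
    then show ?thesis using \<theta>(1) by blast
  qed
  then show thesis by (rule that[OF \<rho>(1)])
qed

text \<open>Any tuple is made of entries of an isolated initial segment of \<open>\<rho>\<close>;
  quantifying that segment existentially isolates the tuple.\<close>

lemma omega_categorical_atomic:
  fixes M :: "('r :: countable, 'a :: countable) struct"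
  assumes oc: "omega_categorical L M"
  shows "\<exists>\<theta>. isolates L M n \<theta> \<and> sat M e \<theta>"
proof -
  obtain \<rho> where \<rho>: "surj \<rho>" "\<And>n. \<exists>\<theta>. isolates L M n \<theta> \<and> sat M \<rho> \<theta>"
    using isolated_enumeration[OF oc] by blast
  define v where "v i = inv \<rho> (e i)" for i
  have v: "e i = \<rho> (v i)" for i unfolding v_def by (simp add: surj_f_inv_f[OF \<rho>(1)])
  obtain m where m: "\<And>i. i < n \<Longrightarrow> v i < m"
    using finite_nat_set_iff_bounded[of "v ` {..<n}"] by auto
  obtain \<theta> where \<theta>: "isolates L M m \<theta>" "sat M \<rho> \<theta>" using \<rho>(2) by blast
  then have \<theta>p: "\<theta> \<in> pure L" "free_vars \<theta> \<subseteq> {..<m}" by (auto simp: isolates_def pure_upto_def)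
  \<comment> \<open>The shift by \<open>n\<close> frees the variables below \<open>n\<close> for the
    tuple; \<open>\<theta>2\<close> says that some realisation of \<open>\<theta>\<close> has it at
    the positions \<open>v\<close>.\<close>
  obtain \<theta>1 where \<theta>1: "\<theta>1 \<in> pure L" "free_vars \<theta>1 \<subseteq> (\<lambda>i. n + i) ` free_vars \<theta>"
    "\<And>e. sat M e \<theta>1 \<longleftrightarrow> sat M (e \<circ> (\<lambda>i. n + i)) \<theta>"
    using rename_formula[OF \<theta>p(1), of "\<lambda>i. n + i"] by blast
  define \<theta>2 where "\<theta>2 = exis [n..<n + m]
      (Conj \<theta>1 (conjs (map (\<lambda>i. Equal (Var i) (Var (n + v i))) [0..<n])))"
  have p2: "\<theta>2 \<in> pure_upto L n"
    using \<theta>1(1,2) \<theta>p(2) m by (force simp: \<theta>2_def pure_upto_def)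
  have sat2: "sat M f \<theta>2 \<longleftrightarrow> (\<exists>y. sat M y \<theta> \<and> (\<forall>i<n. f i = y (v i)))" for f
  proof
    assume "sat M f \<theta>2"
    then obtain f' where f': "\<forall>i. i \<notin> set [n..<n + m] \<longrightarrow> f' i = f i"
      "sat M (f' \<circ> (\<lambda>i. n + i)) \<theta>" "\<forall>i<n. f' i = f' (n + v i)"
      unfolding \<theta>2_def sat_exis sat.simps \<theta>1(3) by auto
    then show "\<exists>y. sat M y \<theta> \<and> (\<forall>i<n. f i = y (v i))"
      by (intro exI[of _ "f' \<circ> (\<lambda>i. n + i)"]) auto
  next
    assume "\<exists>y. sat M y \<theta> \<and> (\<forall>i<n. f i = y (v i))"
    then obtain y where y: "sat M y \<theta>" "\<And>i. i < n \<Longrightarrow> f i = y (v i)" by blast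
    define f' where "f' i = (if n \<le> i \<and> i < n + m then y (i - n) else f i)" for i
    have "sat M (f' \<circ> (\<lambda>i. n + i)) \<theta> \<longleftrightarrow> sat M y \<theta>"
      by (rule sat_cong) (use \<theta>p(2) in \<open>auto simp: f'_def\<close>)
    then show "sat M f \<theta>2"
      unfolding \<theta>2_def sat_exis
      by (intro exI[of _ f']) (use y m in \<open>auto simp: \<theta>1(3) f'_def\<close>)
  qed
  have "isolates L M n \<theta>2"
    unfolding isolates_def
  proof (intro conjI allI impI ballI)
    show "\<theta>2 \<in> pure_upto L n" by (fact p2)
    fix f f' :: "nat \<Rightarrow> 'a" and \<psi> :: "('r, 'a) fm"
    assume f: "sat M f \<theta>2" "sat M f' \<theta>2" and \<psi>: "\<psi> \<in> pure_upto L n"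
    obtain y where y: "sat M y \<theta>" "\<forall>i<n. f i = y (v i)" using f(1) sat2 by blast
    obtain y' where y': "sat M y' \<theta>" "\<forall>i<n. f' i = y' (v i)" using f(2) sat2 by blast
    obtain \<psi>' where \<psi>': "\<psi>' \<in> pure L" "free_vars \<psi>' \<subseteq> v ` free_vars \<psi>"
      "\<And>e. sat M e \<psi>' \<longleftrightarrow> sat M (e \<circ> v) \<psi>"
      using rename_formula[OF pure_uptoD(1)[OF \<psi>], of v] by blast
    have "\<psi>' \<in> pure_upto L m"
      using \<psi>' m pure_uptoD(2)[OF \<psi>] by (fastforce simp: pure_upto_def)
    then have "sat M y \<psi>' \<longleftrightarrow> sat M y' \<psi>'" using isolatesD[OF \<theta>(1) y(1) y'(1)] by blast
    moreover have "sat M f \<psi> \<longleftrightarrow> sat M (y \<circ> v) \<psi>"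
      by (rule sat_cong_upto[OF \<psi>]) (use y(2) in simp)
    moreover have "sat M f' \<psi> \<longleftrightarrow> sat M (y' \<circ> v) \<psi>"
      by (rule sat_cong_upto[OF \<psi>]) (use y'(2) in simp)
    ultimately show "sat M f \<psi> \<longleftrightarrow> sat M f' \<psi>" by (simp add: \<psi>'(3))
  qed
  moreover have "sat M e \<theta>2" using \<theta>(2) v sat2 by blast
  ultimately show ?thesis by blast
qed

text \<open>Back-and-forth in an atomic countable structure: the isolating formula of the longer
  tuple is a single formula to be realised over the other tuple.\<close>

lemma omega_categorical_homogeneous:
  fixes M :: "('r :: countable, 'a :: countable) struct"
  assumes oc: "omega_categorical L M"
    and len: "length xs = length ys"
    and same: "\<And>\<psi>. \<psi> \<in> pure_upto L (length xs) \<Longrightarrow> sat M ((!) xs) \<psi> \<longleftrightarrow> sat M ((!) ys) \<psi>"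
  shows "\<exists>g\<in>Aut L M. map g xs = ys"
proof -
  define P where "P xs ys \<longleftrightarrow> length xs = length ys \<and>
      (\<forall>\<psi>\<in>pure_upto L (length xs). sat M ((!) xs) \<psi> \<longleftrightarrow> sat M ((!) ys) \<psi>)" for xs ys
  have sym: "P xs ys \<Longrightarrow> P ys xs" for xs ys by (auto simp: P_def)
  have forth: "\<exists>b. P (xs @ [a]) (ys @ [b])" if P: "P xs ys" for xs ys a
  proof -
    let ?n = "length xs"
    obtain \<theta>0 where \<theta>0: "isolates L M ?n \<theta>0" "sat M ((!) xs) \<theta>0"
      using omega_categorical_atomic[OF oc] by blast
    obtain \<theta> where \<theta>: "isolates L M (Suc ?n) \<theta>" "sat M ((!) (xs @ [a])) \<theta>"
      using omega_categorical_atomic[OF oc] by blast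
    have \<theta>p: "\<theta> \<in> pure_upto L (Suc ?n)" "\<theta>0 \<in> pure_upto L ?n"
      using \<theta>(1) \<theta>0(1) by (auto simp: isolates_def)
    have "sat M ((!) ys) \<theta>0" using P \<theta>0(2) \<theta>p(2) by (auto simp: P_def)
    moreover have "sat M ((!) (xs @ [a])) \<theta>0 \<longleftrightarrow> sat M ((!) xs) \<theta>0"
      by (rule sat_cong_upto[OF \<theta>p(2)]) (simp add: nth_append)
    ultimately obtain b where b: "sat M (((!) ys)(?n := b)) \<theta>"
      using sat_Exi_last[OF \<theta>0(1) _ _ \<theta>p(1) \<theta>(2)] \<theta>0(2) by blast
    have "sat M ((!) (ys @ [b])) \<theta>"
      using b sat_nth_snoc[of \<theta> ys M b] pure_uptoD(2)[OF \<theta>p(1)] P by (simp add: P_def)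
    then have "P (xs @ [a]) (ys @ [b])"
      using P isolatesD[OF \<theta>(1,2)] by (simp add: P_def)
    then show ?thesis by blast
  qed
  have "\<exists>g. bij g \<and> map g xs = ys \<and> (\<forall>A. finite A \<longrightarrow> (\<exists>zs. A \<subseteq> set zs \<and> P zs (map g zs)))"
  proof (rule back_and_forth[of P xs ys])
    show "P xs ys" using len same by (simp add: P_def)
    show "\<exists>b. P (xs @ [a]) (ys @ [b])" if "P xs ys" for xs ys a by (rule forth[OF that])
    show "\<exists>a. P (xs @ [a]) (ys @ [b])" if "P xs ys" for xs ys b
      using forth[OF sym[OF that]] sym by blast
    show "length xs = length ys" if "P xs ys" for xs ys using that by (simp add: P_def)
    show "xs ! i = xs ! j \<longleftrightarrow> ys ! i = ys ! j"
      if "P xs ys" "i < length xs" "j < length xs" for xs ys i j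
    proof -
      have "Equal (Var i) (Var j) \<in> pure_upto L (length xs)" using that by (simp add: pure_upto_def)
      then have "sat M ((!) xs) (Equal (Var i) (Var j)) \<longleftrightarrow> sat M ((!) ys) (Equal (Var i) (Var j))"
        using that(1) unfolding P_def by blast
      then show ?thesis by simp
    qed
  qed blast
  then obtain g where g: "bij g" "map g xs = ys"
    "\<And>A. finite A \<Longrightarrow> \<exists>zs. A \<subseteq> set zs \<and> P zs (map g zs)" by blast
  have "M r ws = M r (map g ws)" if r: "r \<in> symbols L" and ws: "length ws = arity L r" for r ws
  proof -
    obtain zs where zs: "set ws \<subseteq> set zs" "P zs (map g zs)" using g(3)[of "set ws"] by blast
    then have "\<forall>w\<in>set ws. \<exists>i. i < length zs \<and> zs ! i = w"
      unfolding in_set_conv_nth[symmetric] by blast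
    then obtain ix where ix: "\<And>w. w \<in> set ws \<Longrightarrow> ix w < length zs \<and> zs ! ix w = w"
      unfolding bchoice_iff by blast
    let ?\<psi> = "Atom r (map (\<lambda>w. Var (ix w)) ws)"
    have "?\<psi> \<in> pure_upto L (length zs)" using r ws ix by (auto simp: pure_upto_def)
    then have "sat M ((!) zs) ?\<psi> \<longleftrightarrow> sat M ((!) (map g zs)) ?\<psi>"
      using zs(2) unfolding P_def by blast
    moreover have "map (trm_val ((!) zs)) (map (\<lambda>w. Var (ix w)) ws) = ws"
      using ix by (simp add: map_idI)
    moreover have "map (trm_val ((!) (map g zs))) (map (\<lambda>w. Var (ix w)) ws) = map g ws"
      using ix by simp
    ultimately show ?thesis by (simp only: sat.simps)
  qed
  then have "g \<in> Aut L M" using g(1) unfolding Aut_def is_isomorphism_def by blast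
  then show ?thesis using g(2) by blast
qed

definition oligomorphic :: "('a \<Rightarrow> 'a) set \<Rightarrow> bool" where
  "oligomorphic G \<longleftrightarrow>
     (\<forall>n. \<exists>X. finite X \<and> (\<forall>xs. length xs = n \<longrightarrow> (\<exists>ys\<in>X. \<exists>g\<in>G. map g ys = xs)))"

text \<open>If no finite set of isolating formulas covered all \<open>n\<close>-tuples, their
  negations would be realised together, by a tuple whose type is not isolated. By homogeneity each
  isolating formula defines at most one orbit.\<close>

theorem omega_categorical_imp_oligomorphic:
  fixes M :: "('r :: countable, 'a :: countable) struct"
  assumes oc: "omega_categorical L M"
  shows "oligomorphic (Aut L M)"
  unfolding oligomorphic_def
proof
  fix n
  define \<Sigma> where "\<Sigma> = {Neg \<theta> | \<theta>. isolates L M n \<theta>}"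
  have \<Sigma>: "\<Sigma> \<subseteq> pure_upto L n"
    unfolding \<Sigma>_def isolates_def pure_upto_def by auto
  have "\<not> (\<exists>e. \<forall>\<phi>\<in>\<Sigma>. sat M e \<phi>)"
  proof
    assume "\<exists>e. \<forall>\<phi>\<in>\<Sigma>. sat M e \<phi>"
    then obtain e where e: "\<forall>\<phi>\<in>\<Sigma>. sat M e \<phi>" by blast
    obtain \<theta> where \<theta>: "isolates L M n \<theta>" "sat M e \<theta>"
      using omega_categorical_atomic[OF oc] by blast
    then have "Neg \<theta> \<in> \<Sigma>" unfolding \<Sigma>_def by blast
    then have "sat M e (Neg \<theta>)" using e by blast
    then show False using \<theta>(2) by simp
  qed
  then have "\<exists>F. finite F \<and> F \<subseteq> \<Sigma> \<and> \<not> (\<exists>e. \<forall>\<phi>\<in>F. sat M e \<phi>)"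
    by (rule contrapos_np) (rule omega_categorical_realizes[OF oc \<Sigma>], simp)
  then obtain F where F: "finite F" "F \<subseteq> \<Sigma>" and "\<not> (\<exists>e. \<forall>\<phi>\<in>F. sat M e \<phi>)"
    by (elim exE conjE)
  then have F3: "\<exists>\<phi>\<in>F. \<not> sat M e \<phi>" for e by blast
  \<comment> \<open>For \<open>\<phi> = Neg \<theta>\<close> a failing assignment satisfies
    \<open>\<theta>\<close>; its first \<open>n\<close> values represent the orbit.\<close>
  define rep where "rep \<phi> = map (SOME e. \<not> sat M e \<phi>) [0..<n]" for \<phi>
  have "\<exists>ys\<in>rep ` F. \<exists>g\<in>Aut L M. map g ys = xs" if n: "length xs = n" for xs
  proof -
    obtain \<phi> where \<phi>: "\<phi> \<in> F" "\<not> sat M ((!) xs) \<phi>" using F3[of "(!) xs"] by blast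
    then obtain \<theta> where \<theta>: "\<phi> = Neg \<theta>" "isolates L M n \<theta>" using F(2) by (auto simp: \<Sigma>_def)
    define e where "e = (SOME e. \<not> sat M e \<phi>)"
    have "\<not> sat M e \<phi>"
      unfolding e_def by (rule someI[of "\<lambda>e. \<not> sat M e \<phi>", OF \<phi>(2)])
    then have "sat M e \<theta>" using \<theta>(1) by simp
    moreover have "sat M ((!) (rep \<phi>)) \<theta> \<longleftrightarrow> sat M e \<theta>"
      by (rule sat_cong_upto[of _ L n]) (use \<theta>(2) in \<open>auto simp: isolates_def rep_def e_def\<close>)
    ultimately have "sat M ((!) (rep \<phi>)) \<theta>" "sat M ((!) xs) \<theta>" using \<phi>(2) \<theta>(1) by auto
    note same = isolatesD[OF \<theta>(2) this]
    have "length (rep \<phi>) = n" by (simp add: rep_def)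
    then have "\<exists>g\<in>Aut L M. map g (rep \<phi>) = xs"
      by (intro omega_categorical_homogeneous[OF oc] same) (simp_all add: n)
    then show ?thesis using \<phi>(1) by blast
  qed
  then show "\<exists>X. finite X \<and> (\<forall>xs. length xs = n \<longrightarrow> (\<exists>ys\<in>X. \<exists>g\<in>Aut L M. map g ys = xs))"
    using F(1) by (intro exI[of _ "rep ` F"]) blast
qed


section \<open>The converse direction, for structures with a symbol for every orbit of
  tuples\<close>

section \<open>Structures named by orbits\<close>

locale permutation_group =
  fixes G :: "('a \<Rightarrow> 'a) set"
  assumes bij: "g \<in> G \<Longrightarrow> bij g"
    and id_mem: "id \<in> G"
    and comp_mem: "g \<in> G \<Longrightarrow> h \<in> G \<Longrightarrow> g \<circ> h \<in> G"
    and inv_mem: "g \<in> G \<Longrightarrow> inv g \<in> G"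
begin

definition orb :: "'a list \<Rightarrow> 'a list \<Rightarrow> bool" where
  "orb xs ys \<longleftrightarrow> (\<exists>g\<in>G. map g xs = ys)"

lemma orb_refl: "orb xs xs"
  unfolding orb_def by (metis id_mem list.map_id)

lemma orb_sym: "orb xs ys \<Longrightarrow> orb ys xs"
proof -
  assume "orb xs ys"
  then obtain g where g: "g \<in> G" "ys = map g xs" by (auto simp: orb_def)
  have "map (inv g) ys = xs" using bij[OF g(1)] by (simp add: g(2) bij_is_inj map_idI)
  then show ?thesis using inv_mem[OF g(1)] by (auto simp: orb_def)
qed

lemma orb_trans: "orb xs ys \<Longrightarrow> orb ys zs \<Longrightarrow> orb xs zs"
  unfolding orb_def by (metis comp_mem map_map)

lemma orb_extend: "orb xs ys \<Longrightarrow> \<exists>b. orb (xs @ [a]) (ys @ [b])"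
  unfolding orb_def by auto

end

text \<open>Back-and-forth between \<open>M\<close> and a model \<open>N\<close>, with the invariant
  that \<open>N\<close> places \<open>ys\<close> under the orbit symbol of \<open>xs\<close>. The
  forth step transfers a single existential statement; the back step needs a disjunction over all
  orbits extending that of \<open>xs\<close>, which oligomorphy makes finite.\<close>

theorem oligomorphic_imp_omega_categorical:
  fixes M :: "('r, 'a :: countable) struct"
  assumes G: "permutation_group G" and olig: "oligomorphic G" and inf: "infinite (UNIV :: 'a set)"
    and inv: "\<And>r xs g. r \<in> symbols L \<Longrightarrow> length xs = arity L r \<Longrightarrow> g \<in> G \<Longrightarrow> M r (map g xs) = M r xs"
    and names: "\<And>xs. \<exists>r\<in>symbols L. arity L r = length xs \<and>
      (\<forall>ys. length ys = length xs \<longrightarrow> (M r ys \<longleftrightarrow> permutation_group.orb G xs ys))"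
  shows "omega_categorical L M"
proof -
  interpret permutation_group G by (rule G)
  obtain c where c: "\<And>xs. c xs \<in> symbols L" "\<And>xs. arity L (c xs) = length xs"
    "\<And>xs ys. length ys = length xs \<Longrightarrow> M (c xs) ys \<longleftrightarrow> orb xs ys"
    using names by metis
  have "isomorphic L M N" if N: "models N (theory_of L M)" for N :: "('r, 'a) struct"
  proof -
    define P where "P xs ys \<longleftrightarrow> length xs = length ys \<and> N (c xs) ys" for xs ys
    \<comment> \<open>What holds in \<open>M\<close> on the whole orbit of \<open>xs\<close> is an
      implication from the orbit atom, valid in \<open>M\<close> and hence in
      \<open>N\<close>.\<close>
    have transfer: "sat N e \<psi>"
      if \<psi>: "\<psi> \<in> pure L" and val: "\<And>e. orb xs (map e [0..<length xs]) \<Longrightarrow> sat M e \<psi>"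
        and e: "N (c xs) (map e [0..<length xs])" for xs \<psi> e
    proof -
      let ?A = "Atom (c xs) (map Var [0..<length xs])"
      have A: "sat K f ?A \<longleftrightarrow> K (c xs) (map f [0..<length xs])" for K :: "('r, 'a) struct" and f
        by (simp add: comp_def)
      have "sat M f (Neg (Conj ?A (Neg \<psi>)))" for f
        using val[of f] c(3)[of "map f [0..<length xs]" xs] A[of M f] by auto
      then have "sat N e (Neg (Conj ?A (Neg \<psi>)))"
        using c(1,2) \<psi> by (intro models_valid[OF N]) auto
      then show ?thesis using e A[of N e] by auto
    qed
    have nth_map: "map ((!) ys) [0..<length xs] = ys" if "length xs = length ys" for xs ys :: "'a list"
      using that by (simp add: map_nth)
    have snoc: "map (((!) ys)(length ys := b)) [0..<Suc (length ys)] = ys @ [b]" for ys and b :: 'a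
      by (rule nth_equalityI) (auto simp: nth_append less_Suc_eq)
    have snoc_atom: "sat K (((!) ys)(length ys := b)) (Atom r (map Var [0..<Suc (length ys)])) \<longleftrightarrow> K r (ys @ [b])"
      for K :: "('r, 'a) struct" and ys b r
      unfolding sat.simps map_map comp_def trm_val.simps using snoc by metis
    have "\<exists>f. bij f \<and> map f [] = [] \<and> (\<forall>A. finite A \<longrightarrow> (\<exists>zs. A \<subseteq> set zs \<and> P zs (map f zs)))"
    proof (rule back_and_forth[of P "[]" "[]"])
      have "sat N undefined (Atom (c []) [])"
        by (rule models_valid[OF N]) (use c orb_refl in auto)
      then show "P [] []" by (simp add: P_def)
    next
      fix xs ys a
      assume P: "P xs ys"
      then have len: "length xs = length ys" by (simp add: P_def)
      let ?\<psi> = "Exi (length ys) (Atom (c (xs @ [a])) (map Var [0..<Suc (length ys)]))"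
      have "sat N ((!) ys) ?\<psi>"
      proof (rule transfer[of _ xs])
        show "?\<psi> \<in> pure L" using c len by auto
        show "N (c xs) (map ((!) ys) [0..<length xs])" using P nth_map by (simp add: P_def)
        fix e
        assume "orb xs (map e [0..<length xs])"
        then obtain b where "orb (xs @ [a]) (map e [0..<length xs] @ [b])" using orb_extend by blast
        then have b: "M (c (xs @ [a])) (map e [0..<length xs] @ [b])" using c(3) by simp
        have "map (e(length ys := b)) [0..<Suc (length ys)] = map e [0..<length xs] @ [b]"
          by (simp add: len)
        with b have "M (c (xs @ [a])) (map (e(length ys := b)) [0..<Suc (length ys)])"
          by (simp only:)
        then have "sat M (e(length ys := b)) (Atom (c (xs @ [a])) (map Var [0..<Suc (length ys)]))"
          unfolding sat.simps map_map comp_def trm_val.simps .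
        then show "sat M e ?\<psi>" unfolding sat.simps(5) by blast
      qed
      then obtain b where "N (c (xs @ [a])) (ys @ [b])"
        unfolding sat.simps(5) snoc_atom by blast
      then show "\<exists>b. P (xs @ [a]) (ys @ [b])" using len by (auto simp: P_def)
    next
      fix xs ys b
      assume P: "P xs ys"
      then have len: "length xs = length ys" by (simp add: P_def)
      have "\<exists>X. finite X \<and> (\<forall>zs. length zs = Suc (length xs) \<longrightarrow> (\<exists>z\<in>X. orb z zs))"
        using olig unfolding oligomorphic_def orb_def by (rule spec)
      then obtain X where X: "finite X" "\<forall>zs. length zs = Suc (length xs) \<longrightarrow> (\<exists>z\<in>X. orb z zs)"
        by blast
      \<comment> \<open>One \<open>a\<close> for each orbit of extensions. For \<open>z\<close> in
        \<open>X\<close> that extend no member of the orbit of \<open>xs\<close> the value is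
        arbitrary and merely adds a harmless disjunct.\<close>
      define pick where "pick z = (SOME a. orb (xs @ [a]) z)" for z
      obtain as where as: "set as = pick ` X" using finite_list[OF finite_imageI[OF X(1)], of pick] ..
      let ?\<psi> = "\<lambda>a. Atom (c (xs @ [a])) (map Var [0..<Suc (length ys)])"
      have "sat N (((!) ys)(length ys := b)) (Neg (conjs (map (\<lambda>a. Neg (?\<psi> a)) as)))"
      proof (rule transfer[of _ xs])
        show "Neg (conjs (map (\<lambda>a. Neg (?\<psi> a)) as)) \<in> pure L" using c len by auto
        have "map (((!) ys)(length ys := b)) [0..<length xs] = map ((!) ys) [0..<length xs]"
          using len by simp
        then show "N (c xs) (map (((!) ys)(length ys := b)) [0..<length xs])"
          using P nth_map by (simp add: P_def)
        fix e
        assume "orb xs (map e [0..<length xs])"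
        then obtain a where a: "orb (map e [0..<length xs] @ [e (length xs)]) (xs @ [a])"
          using orb_extend orb_sym by blast
        obtain z where z: "z \<in> X" "orb z (map e [0..<length xs] @ [e (length xs)])"
          using X(2)[rule_format, of "map e [0..<length xs] @ [e (length xs)]"] by auto
        have "orb (xs @ [pick z]) z"
          unfolding pick_def by (rule someI[of _ a]) (use a z(2) orb_trans orb_sym in blast)
        then have "orb (xs @ [pick z]) (map e [0..<Suc (length ys)])"
          using z(2) orb_trans len by simp
        then have "sat M e (?\<psi> (pick z))"
          unfolding sat.simps map_map comp_def trm_val.simps
          using c(3)[of "map e [0..<Suc (length ys)]" "xs @ [pick z]"] len by simp
        moreover have "pick z \<in> set as" using as z(1) by blast
        ultimately show "sat M e (Neg (conjs (map (\<lambda>a. Neg (?\<psi> a)) as)))"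
          unfolding sat.simps(3) sat_conjs by force
      qed
      then obtain a where "sat N (((!) ys)(length ys := b)) (?\<psi> a)"
        unfolding sat.simps(3) sat_conjs by force
      then have "N (c (xs @ [a])) (ys @ [b])" unfolding snoc_atom .
      then show "\<exists>a. P (xs @ [a]) (ys @ [b])" using len by (auto simp: P_def)
    next
      fix xs ys
      assume P: "P xs ys"
      then show len: "length xs = length ys" by (simp add: P_def)
      fix i j
      assume ij: "i < length xs" "j < length xs"
      have "orb xs (map e [0..<length xs]) \<Longrightarrow> e i = e j \<longleftrightarrow> xs ! i = xs ! j" for e :: "nat \<Rightarrow> 'a"
      proof -
        assume "orb xs (map e [0..<length xs])"
        then obtain g where g: "g \<in> G" "map g xs = map e [0..<length xs]" by (auto simp: orb_def)
        have "e k = g (xs ! k)" if "k < length xs" for k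
          using arg_cong[OF g(2), of "\<lambda>l. l ! k"] that by simp
        then show ?thesis using ij bij[OF g(1)] by (simp add: bij_is_inj inj_eq)
      qed
      then have "sat N ((!) ys) (if xs ! i = xs ! j then Equal (Var i) (Var j) else Neg (Equal (Var i) (Var j)))"
        using P nth_map[OF len] by (intro transfer[of _ xs]) (auto simp: P_def)
      then show "xs ! i = xs ! j \<longleftrightarrow> ys ! i = ys ! j" by (auto split: if_splits)
    qed blast
    then obtain f where f: "bij f" "\<And>A. finite A \<Longrightarrow> \<exists>zs. A \<subseteq> set zs \<and> P zs (map f zs)" by blast
    have "M r ws = N r (map f ws)" if r: "r \<in> symbols L" and ws: "length ws = arity L r" for r ws
    proof -
      obtain zs where zs: "set ws \<subseteq> set zs" "P zs (map f zs)" using f(2)[of "set ws"] by blast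
      then have "\<forall>w\<in>set ws. \<exists>i. i < length zs \<and> zs ! i = w"
        unfolding in_set_conv_nth[symmetric] by blast
      then obtain ix where ix: "\<And>w. w \<in> set ws \<Longrightarrow> ix w < length zs \<and> zs ! ix w = w"
        unfolding bchoice_iff by blast
      let ?A = "Atom r (map (\<lambda>w. Var (ix w)) ws)"
      have A: "sat K e ?A \<longleftrightarrow> K r (map (\<lambda>w. e (ix w)) ws)" for K :: "('r, 'a) struct" and e
        by (simp add: comp_def)
      have "sat M e ?A \<longleftrightarrow> M r ws" if e: "orb zs (map e [0..<length zs])" for e
      proof -
        obtain g where g: "g \<in> G" "map g zs = map e [0..<length zs]"
          using e by (auto simp: orb_def)
        have "e k = g (zs ! k)" if "k < length zs" for k
          using arg_cong[OF g(2), of "\<lambda>l. l ! k"] that by simp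
        then have "map (\<lambda>w. e (ix w)) ws = map g ws" using ix by simp
        then show ?thesis unfolding A using inv[OF r ws g(1)] by (simp only:)
      qed
      then have "sat N ((!) (map f zs)) (if M r ws then ?A else Neg ?A)"
        using zs(2) nth_map[of zs "map f zs"] r ws
        by (intro transfer[of _ zs]) (auto simp: P_def)
      then have "sat N ((!) (map f zs)) ?A \<longleftrightarrow> M r ws" by (auto split: if_splits)
      moreover have "map (\<lambda>w. map f zs ! ix w) ws = map f ws" using ix by simp
      ultimately show ?thesis unfolding A by simp
    qed
    then show ?thesis using f(1) unfolding isomorphic_def is_isomorphism_def by blast
  qed
  then show ?thesis using inf unfolding omega_categorical_def by simp
qed


section \<open>Predimension calculus: submodularity and free amalgamation over strong sets\<close>

section \<open>Sparse digraphs\<close>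

text \<open>\<open>delta\<close> is Hrushovski's predimension and \<open>strong\<close> the corresponding notion of a
  self-sufficient (closed) set.\<close>

definition delta :: "('v \<times> 'v) set \<Rightarrow> 'v set \<Rightarrow> int" where
  "delta E X = 2 * int (card X) - int (card (E \<inter> X \<times> X))"

text \<open>Hrushovski's control function is the logarithm to base 2. Real powers are used because
  \<open>delta\<close> may a priori be negative.\<close>

definition sparse :: "('v \<times> 'v) set \<Rightarrow> 'v set \<Rightarrow> bool" where
  "sparse E V \<longleftrightarrow> (\<forall>X. finite X \<and> X \<subseteq> V \<longrightarrow> real (card X) \<le> 2 powr real_of_int (delta E X))"

definition strong :: "('v \<times> 'v) set \<Rightarrow> 'v set \<Rightarrow> 'v set \<Rightarrow> bool" where
  "strong E V A \<longleftrightarrow> finite A \<and> A \<subseteq> V \<and> (\<forall>B. finite B \<and> A \<subset> B \<and> B \<subseteq> V \<longrightarrow> delta E A < delta E B)"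

lemma sparseD: "sparse E V \<Longrightarrow> finite X \<Longrightarrow> X \<subseteq> V \<Longrightarrow> real (card X) \<le> 2 powr real_of_int (delta E X)"
  by (simp add: sparse_def)

lemma strongD: "strong E V A \<Longrightarrow> finite B \<Longrightarrow> A \<subset> B \<Longrightarrow> B \<subseteq> V \<Longrightarrow> delta E A < delta E B"
  by (simp add: strong_def)

lemma strong_finite: "strong E V A \<Longrightarrow> finite A"
  and strong_subset: "strong E V A \<Longrightarrow> A \<subseteq> V"
  by (simp_all add: strong_def)

lemma delta_cong:
  assumes "E \<inter> V \<times> V = E' \<inter> V \<times> V" "X \<subseteq> V"
  shows "delta E X = delta E' X"
proof -
  have "E \<inter> X \<times> X = E' \<inter> X \<times> X" using assms by blast
  then show ?thesis by (simp add: delta_def)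
qed

lemma sparse_cong:
  assumes "E \<inter> V \<times> V = E' \<inter> V \<times> V"
  shows "sparse E V \<longleftrightarrow> sparse E' V"
  using delta_cong[OF assms] by (simp add: sparse_def)

lemma strong_cong:
  assumes "E \<inter> V \<times> V = E' \<inter> V \<times> V"
  shows "strong E V A \<longleftrightarrow> strong E' V A"
  using delta_cong[OF assms] by (auto simp: strong_def)

lemma sparse_mono: "sparse E V \<Longrightarrow> W \<subseteq> V \<Longrightarrow> sparse E W"
  unfolding sparse_def by (meson subset_trans)

lemma strong_mono: "strong E V A \<Longrightarrow> A \<subseteq> W \<Longrightarrow> W \<subseteq> V \<Longrightarrow> strong E W A"
  unfolding strong_def by (meson subset_trans)

lemma strong_refl: "finite V \<Longrightarrow> strong E V V"
  by (auto simp: strong_def)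

lemma finite_edges: "finite X \<Longrightarrow> finite (E \<inter> X \<times> X)"
  by (simp add: finite_Int)

text \<open>The defect is the number of edges between \<open>X - Y\<close> and \<open>Y - X\<close>,
  which only the union sees; without such edges equality holds, as \<open>delta_free\<close>
  records.\<close>

lemma delta_submodular:
  assumes "finite X" "finite Y"
  shows "delta E (X \<union> Y) + delta E (X \<inter> Y) \<le> delta E X + delta E Y"
proof -
  have "card (E \<inter> X \<times> X) + card (E \<inter> Y \<times> Y) =
      card (E \<inter> X \<times> X \<union> E \<inter> Y \<times> Y) + card ((E \<inter> X \<times> X) \<inter> (E \<inter> Y \<times> Y))"
    using assms by (intro card_Un_Int finite_edges)
  also have "(E \<inter> X \<times> X) \<inter> (E \<inter> Y \<times> Y) = E \<inter> (X \<inter> Y) \<times> (X \<inter> Y)" by blast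
  also have "card (E \<inter> X \<times> X \<union> E \<inter> Y \<times> Y) \<le> card (E \<inter> (X \<union> Y) \<times> (X \<union> Y))"
    using assms by (intro card_mono finite_edges) auto
  finally show ?thesis
    using card_Un_Int[OF assms] by (simp add: delta_def)
qed

lemma delta_free:
  assumes "finite X" "finite Y" "E \<inter> (X \<union> Y) \<times> (X \<union> Y) \<subseteq> X \<times> X \<union> Y \<times> Y"
  shows "delta E (X \<union> Y) + delta E (X \<inter> Y) = delta E X + delta E Y"
proof -
  have "card (E \<inter> X \<times> X) + card (E \<inter> Y \<times> Y) =
      card (E \<inter> X \<times> X \<union> E \<inter> Y \<times> Y) + card ((E \<inter> X \<times> X) \<inter> (E \<inter> Y \<times> Y))"
    using assms by (intro card_Un_Int finite_edges)
  also have "(E \<inter> X \<times> X) \<inter> (E \<inter> Y \<times> Y) = E \<inter> (X \<inter> Y) \<times> (X \<inter> Y)" by blast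
  also have "E \<inter> X \<times> X \<union> E \<inter> Y \<times> Y = E \<inter> (X \<union> Y) \<times> (X \<union> Y)"
    using assms(3) by blast
  finally show ?thesis
    using card_Un_Int[OF assms(1,2)] by (simp add: delta_def)
qed

text \<open>Adding \<open>B\<close> to \<open>A\<close> raises \<open>delta\<close>; by
  submodularity it already rises from \<open>A \<inter> B\<close> to \<open>B\<close>.\<close>

lemma strong_Int:
  assumes A: "strong E V A" and X: "finite X" "X \<subseteq> V"
  shows "strong E X (A \<inter> X)"
  unfolding strong_def
proof (intro conjI allI impI)
  fix B
  assume B: "finite B \<and> A \<inter> X \<subset> B \<and> B \<subseteq> X"
  have "delta E A < delta E (A \<union> B)"
    by (rule strongD[OF A]) (use B X strong_finite[OF A] strong_subset[OF A] in auto)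
  moreover have "A \<inter> B = A \<inter> X" using B by blast
  ultimately show "delta E (A \<inter> X) < delta E B"
    using delta_submodular[of A B E] strong_finite[OF A] B by simp
qed (use X in auto)

text \<open>Passing from \<open>A\<close> to \<open>W \<inter> B\<close> uses strength of
  \<open>A\<close> in \<open>W\<close>, and from there to \<open>B\<close> strength of
  \<open>W\<close> through \<open>strong_Int\<close>.\<close>

lemma strong_trans:
  assumes A: "strong E W A" and W: "strong E V W"
  shows "strong E V A"
  unfolding strong_def
proof (intro conjI allI impI)
  fix B
  assume B: "finite B \<and> A \<subset> B \<and> B \<subseteq> V"
  have s: "strong E B (W \<inter> B)" using strong_Int[OF W] B by blast
  show "delta E A < delta E B"
  proof (cases "B \<subseteq> W")
    case True
    then show ?thesis using strongD[OF A] B by blast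
  next
    case False
    then have "delta E (W \<inter> B) < delta E B" using B by (intro strongD[OF s]) auto
    moreover have "delta E A \<le> delta E (W \<inter> B)"
    proof (cases "A = W \<inter> B")
      case False
      then have "delta E A < delta E (W \<inter> B)"
        using B strong_subset[OF A] by (intro strongD[OF A]) auto
      then show ?thesis by simp
    qed simp
    ultimately show ?thesis by simp
  qed
qed (use A W in \<open>auto simp: strong_def\<close>)

text \<open>For two or more points the exponential bound forces positive \<open>delta\<close>. For
  one point it gives only nonnegativity, but a vertex carries at most one loop.\<close>

lemma strong_empty:
  assumes "sparse E V"
  shows "strong E V {}"
  unfolding strong_def
proof (intro conjI allI impI)
  fix B
  assume B: "finite B \<and> {} \<subset> B \<and> B \<subseteq> V"
  show "delta E {} < delta E B"
  proof (cases "card B \<le> 1")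
    case True
    moreover have "card B \<noteq> 0" using B by auto
    ultimately have "card B = 1" by linarith
    then obtain b where "B = {b}" by (rule card_1_singletonE)
    moreover have "card (E \<inter> {b} \<times> {b}) \<le> card {(b, b)}" by (rule card_mono) auto
    ultimately show ?thesis by (simp add: delta_def)
  next
    case False
    have "2 powr 0 < real (card B)" using False by simp
    also have "\<dots> \<le> 2 powr real_of_int (delta E B)" using sparseD[OF assms] B by blast
    finally have "0 < real_of_int (delta E B)" by (subst (asm) powr_less_cancel_iff) auto
    then show ?thesis by (simp add: delta_def)
  qed
qed auto

text \<open>A set \<open>X\<close> not contained in its larger half has at most twice as many points
  as that half, while strength of the common part raises \<open>delta\<close> by at least 1; so the
  bound doubles too.\<close>

lemma free_amalgam_sparse:
  assumes E: "E \<inter> (V1 \<union> V2) \<times> (V1 \<union> V2) \<subseteq> V1 \<times> V1 \<union> V2 \<times> V2"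
    and sp: "sparse E V1" "sparse E V2"
    and st: "strong E V1 (V1 \<inter> V2)" "strong E V2 (V1 \<inter> V2)"
  shows "sparse E (V1 \<union> V2)"
proof -
  have bound: "real (card X) \<le> 2 powr real_of_int (delta E X)"
    if X: "finite X" "X \<subseteq> W1 \<union> W2" and E: "E \<inter> (W1 \<union> W2) \<times> (W1 \<union> W2) \<subseteq> W1 \<times> W1 \<union> W2 \<times> W2"
      and sp: "sparse E W1" "sparse E W2" and st: "strong E W2 (W1 \<inter> W2)"
      and le: "card (X \<inter> W2) \<le> card (X \<inter> W1)" for X W1 W2
  proof (cases "X \<subseteq> W1")
    case True
    then show ?thesis using sparseD[OF sp(1) X(1)] by blast
  next
    case False
    have un: "(X \<inter> W1) \<union> (X \<inter> W2) = X" using X(2) by blast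
    have "delta E ((X \<inter> W1) \<union> (X \<inter> W2)) + delta E ((X \<inter> W1) \<inter> (X \<inter> W2)) =
        delta E (X \<inter> W1) + delta E (X \<inter> W2)"
      by (rule delta_free) (use X E in auto)
    moreover have "delta E ((W1 \<inter> W2) \<inter> (X \<inter> W2)) < delta E (X \<inter> W2)"
      by (rule strongD[OF strong_Int[OF st, of "X \<inter> W2"]]) (use X False in auto)
    moreover have "(W1 \<inter> W2) \<inter> (X \<inter> W2) = (X \<inter> W1) \<inter> (X \<inter> W2)" by blast
    ultimately have d: "delta E (X \<inter> W1) + 1 \<le> delta E X" by (simp add: un)
    have "card X \<le> card (X \<inter> W1) + card (X \<inter> W2)"
      using card_Un_le[of "X \<inter> W1" "X \<inter> W2"] by (simp add: un)
    then have "real (card X) \<le> 2 * real (card (X \<inter> W1))" using le by linarith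
    also have "\<dots> \<le> 2 * 2 powr real_of_int (delta E (X \<inter> W1))"
      using sparseD[OF sp(1), of "X \<inter> W1"] X by simp
    also have "\<dots> = 2 powr (real_of_int (delta E (X \<inter> W1)) + 1)" by (simp add: powr_add)
    also have "\<dots> \<le> 2 powr real_of_int (delta E X)" using d by (intro powr_mono) linarith+
    finally show ?thesis .
  qed
  show ?thesis
    unfolding sparse_def
  proof (intro allI impI)
    fix X
    assume X: "finite X \<and> X \<subseteq> V1 \<union> V2"
    show "real (card X) \<le> 2 powr real_of_int (delta E X)"
    proof (cases "card (X \<inter> V2) \<le> card (X \<inter> V1)")
      case True
      then show ?thesis using bound[OF _ _ E sp st(2)] X by blast
    next
      case False
      show ?thesis
        by (rule bound[of X V2 V1]) (use X E sp st(1) False in \<open>auto simp: Un_commute Int_commute\<close>)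
    qed
  qed
qed

text \<open>By \<open>delta_free\<close> the gain from \<open>V1\<close> to \<open>B\<close> equals
  the gain from \<open>V1 \<inter> V2\<close> to \<open>B \<inter> V2\<close>.\<close>

lemma free_amalgam_strong:
  assumes E: "E \<inter> (V1 \<union> V2) \<times> (V1 \<union> V2) \<subseteq> V1 \<times> V1 \<union> V2 \<times> V2"
    and fin: "finite V1" and st: "strong E V2 (V1 \<inter> V2)"
  shows "strong E (V1 \<union> V2) V1"
  unfolding strong_def
proof (intro conjI allI impI)
  fix B
  assume B: "finite B \<and> V1 \<subset> B \<and> B \<subseteq> V1 \<union> V2"
  have un: "V1 \<union> (B \<inter> V2) = B" using B by blast
  have "delta E (V1 \<union> (B \<inter> V2)) + delta E (V1 \<inter> (B \<inter> V2)) = delta E V1 + delta E (B \<inter> V2)"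
    by (rule delta_free) (use B fin E in auto)
  moreover have "V1 \<inter> (B \<inter> V2) = V1 \<inter> V2" using B by blast
  moreover have "delta E (V1 \<inter> V2) < delta E (B \<inter> V2)"
    by (rule strongD[OF st]) (use B in auto)
  ultimately show "delta E V1 < delta E B" by (simp add: un)
qed (use fin in auto)

section \<open>Embeddings of structures with a binary and a ternary relation\<close>

definition iso_on ::
  "('v \<times> 'v) set \<Rightarrow> ('v \<times> 'v \<times> 'v) set \<Rightarrow> ('w \<times> 'w) set \<Rightarrow> ('w \<times> 'w \<times> 'w) set \<Rightarrow>
    'v set \<Rightarrow> ('v \<Rightarrow> 'w) \<Rightarrow> bool" where
  "iso_on F Q E R U h \<longleftrightarrow> inj_on h U \<and>
     (\<forall>x\<in>U. \<forall>y\<in>U. (x, y) \<in> F \<longleftrightarrow> (h x, h y) \<in> E) \<and>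
     (\<forall>x\<in>U. \<forall>y\<in>U. \<forall>z\<in>U. (x, y, z) \<in> Q \<longleftrightarrow> (h x, h y, h z) \<in> R)"

lemma iso_on_subset: "iso_on F Q E R U h \<Longrightarrow> W \<subseteq> U \<Longrightarrow> iso_on F Q E R W h"
  unfolding iso_on_def by (meson inj_on_subset subsetD)

lemma iso_on_cong:
  assumes "\<And>x. x \<in> U \<Longrightarrow> h x = h' x"
    and "F \<inter> U \<times> U = F' \<inter> U \<times> U" "Q \<inter> U \<times> U \<times> U = Q' \<inter> U \<times> U \<times> U"
    and "h ` U \<subseteq> W" "E \<inter> W \<times> W = E' \<inter> W \<times> W" "R \<inter> W \<times> W \<times> W = R' \<inter> W \<times> W \<times> W"
  shows "iso_on F Q E R U h \<longleftrightarrow> iso_on F' Q' E' R' U h'"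
proof -
  have "(x, y) \<in> F \<longleftrightarrow> (x, y) \<in> F'" "(h x, h y) \<in> E \<longleftrightarrow> (h x, h y) \<in> E'" if "x \<in> U" "y \<in> U" for x y
    using assms(2,4,5) that by blast+
  moreover have "(x, y, z) \<in> Q \<longleftrightarrow> (x, y, z) \<in> Q'" "(h x, h y, h z) \<in> R \<longleftrightarrow> (h x, h y, h z) \<in> R'"
    if "x \<in> U" "y \<in> U" "z \<in> U" for x y z
    using assms(3,4,6) that by blast+
  moreover have "inj_on h U \<longleftrightarrow> inj_on h' U" using assms(1) by (rule inj_on_cong)
  ultimately show ?thesis using assms(1) unfolding iso_on_def by simp
qed

lemma delta_image:
  assumes "iso_on F Q E R X h"
  shows "delta E (h ` X) = delta F X"
proof -
  have inj: "inj_on h X" using assms by (simp add: iso_on_def)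
  have "E \<inter> h ` X \<times> h ` X = map_prod h h ` (F \<inter> X \<times> X)"
  proof
    show "E \<inter> h ` X \<times> h ` X \<subseteq> map_prod h h ` (F \<inter> X \<times> X)"
    proof
      fix p assume "p \<in> E \<inter> h ` X \<times> h ` X"
      then obtain x y where "x \<in> X" "y \<in> X" "p = (h x, h y)" "(h x, h y) \<in> E" by blast
      moreover from this have "(x, y) \<in> F" using assms by (simp add: iso_on_def)
      ultimately show "p \<in> map_prod h h ` (F \<inter> X \<times> X)" by (intro image_eqI[of _ _ "(x, y)"]) auto
    qed
  qed (use assms in \<open>auto simp: iso_on_def\<close>)
  moreover have "inj_on (map_prod h h) (F \<inter> X \<times> X)"
    using map_prod_inj_on[OF inj inj] by (rule inj_on_subset) blast
  ultimately show ?thesis using inj by (simp add: delta_def card_image)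
qed

lemma sparse_image:
  assumes "iso_on F Q E R V h" "sparse F V"
  shows "sparse E (h ` V)"
  unfolding sparse_def
proof (intro allI impI)
  fix X assume "finite X \<and> X \<subseteq> h ` V"
  then obtain Y where Y: "Y \<subseteq> V" "finite Y" "X = h ` Y" by (meson finite_subset_image)
  have "inj_on h Y" using iso_on_subset[OF assms(1) Y(1)] by (simp add: iso_on_def)
  then show "real (card X) \<le> 2 powr real_of_int (delta E X)"
    using sparseD[OF assms(2) Y(2,1)] delta_image[OF iso_on_subset[OF assms(1) Y(1)]]
    by (simp add: Y(3) card_image)
qed

lemma strong_image:
  assumes iso: "iso_on F Q E R V h" and U: "strong F V U"
  shows "strong E (h ` V) (h ` U)"
  unfolding strong_def
proof (intro conjI allI impI)
  fix B assume B: "finite B \<and> h ` U \<subset> B \<and> B \<subseteq> h ` V"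
  then obtain Y where Y: "Y \<subseteq> V" "finite Y" "B = h ` Y" by (meson finite_subset_image)
  have inj: "inj_on h V" using iso by (simp add: iso_on_def)
  have "U \<subset> Y"
    using B Y inj strong_subset[OF U] by (metis inj_on_image_subset_iff psubsetE psubsetI image_mono)
  then have "delta F U < delta F Y" using strongD[OF U] Y by blast
  then show "delta E (h ` U) < delta E B"
    using delta_image[OF iso_on_subset[OF iso Y(1)]]
      delta_image[OF iso_on_subset[OF iso strong_subset[OF U]]] Y(3) by simp
qed (use U in \<open>auto simp: strong_def\<close>)


section \<open>A Fraisse-type limit along strong embeddings\<close>

section \<open>The generic structure\<close>

text \<open>A finite structure on an initial segment of the naturals, so that the union of a growing
  chain lives on all of \<open>nat\<close>.\<close>

type_synonym stage = "nat \<times> (nat \<times> nat) set \<times> (nat \<times> nat \<times> nat) set"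

definition is_stage :: "stage \<Rightarrow> bool" where
  "is_stage s \<longleftrightarrow> (case s of (m, E, R) \<Rightarrow>
     E \<subseteq> {..<m} \<times> {..<m} \<and> R \<subseteq> {..<m} \<times> {..<m} \<times> {..<m} \<and> sparse E {..<m})"

definition stage_le :: "stage \<Rightarrow> stage \<Rightarrow> bool" where
  "stage_le s t \<longleftrightarrow> (case s of (m, E, R) \<Rightarrow> case t of (m', E', R') \<Rightarrow>
     m \<le> m' \<and> E' \<inter> {..<m} \<times> {..<m} = E \<and> R' \<inter> {..<m} \<times> {..<m} \<times> {..<m} = R \<and>
     strong E' {..<m'} {..<m})"

text \<open>An extension problem \<open>(V, F, Q, U, h)\<close>: a finite structure on
  \<open>V\<close>, a strong subset \<open>U\<close> and an embedding \<open>h\<close> of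
  \<open>U\<close> into the current stage.\<close>

type_synonym problem = "nat set \<times> (nat \<times> nat) set \<times> (nat \<times> nat \<times> nat) set \<times> nat set \<times> (nat \<Rightarrow> nat)"

definition solvable :: "stage \<Rightarrow> problem \<Rightarrow> bool" where
  "solvable s p \<longleftrightarrow> (case s of (m, E, R) \<Rightarrow> case p of (V, F, Q, U, h) \<Rightarrow>
     finite V \<and> sparse F V \<and> strong F V U \<and> iso_on F Q E R U h \<and> strong E {..<m} (h ` U))"

text \<open>Points outside \<open>U\<close> must receive new numbers. This is free amalgamation, and
  it also forces the stages to grow.\<close>

definition solved :: "stage \<Rightarrow> stage \<Rightarrow> problem \<Rightarrow> bool" where
  "solved s t p \<longleftrightarrow> (case s of (m, E, R) \<Rightarrow> case t of (m', E', R') \<Rightarrow> case p of (V, F, Q, U, h) \<Rightarrow>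
     (\<exists>h'. (\<forall>x\<in>U. h' x = h x) \<and> h' ` (V - U) \<subseteq> {m..<m'} \<and> iso_on F Q E' R' V h' \<and>
        strong E' {..<m'} (h' ` V)))"

text \<open>The next stage is the free amalgam of the old stage and \<open>V\<close> over
  \<open>U\<close>, with \<open>V - U\<close> renumbered from \<open>m\<close> on; the two
  amalgamation lemmas supply sparseness and the two strong embeddings.\<close>

lemma solvable_imp_solved:
  assumes s: "is_stage s" and p: "solvable s p"
  shows "\<exists>t. is_stage t \<and> stage_le s t \<and> solved s t p"
proof -
  obtain m E R where s_eq: "s = (m, E, R)" by (cases s)
  obtain V F Q U h where p_eq: "p = (V, F, Q, U, h)" by (cases p)
  have E: "E \<subseteq> {..<m} \<times> {..<m}" and R: "R \<subseteq> {..<m} \<times> {..<m} \<times> {..<m}" and spE: "sparse E {..<m}"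
    using s by (auto simp: is_stage_def s_eq)
  have fin: "finite V" and spF: "sparse F V" and U: "strong F V U"
    and iso: "iso_on F Q E R U h" and hU: "strong E {..<m} (h ` U)"
    using p by (auto simp: solvable_def s_eq p_eq)
  have UV: "U \<subseteq> V" and hUm: "h ` U \<subseteq> {..<m}" using U hU by (auto simp: strong_def)
  define m' where "m' = m + card (V - U)"
  have "\<exists>b. bij_betw b (V - U) {m..<m'}"
    by (rule finite_same_card_bij) (use fin in \<open>auto simp: m'_def\<close>)
  then obtain b where b: "bij_betw b (V - U) {m..<m'}" by blast
  define h' where "h' x = (if x \<in> U then h x else b x)" for x
  define E' where "E' = E \<union> (\<lambda>(x, y). (h' x, h' y)) ` (F \<inter> V \<times> V)"
  define R' where "R' = R \<union> (\<lambda>(x, y, z). (h' x, h' y, h' z)) ` (Q \<inter> V \<times> V \<times> V)"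
  have old: "h' x = h x" "h' x < m" if "x \<in> U" for x
    using that hUm by (auto simp: h'_def)
  have new: "h' x \<in> {m..<m'}" if "x \<in> V - U" for x
    using bij_betw_apply[OF b that] that by (simp add: h'_def)
  have small: "x \<in> U" if "x \<in> V" "h' x < m" for x
    using new[of x] that by fastforce
  have h'V: "h' x < m'" if "x \<in> V" for x
    using old[of x] new[of x] that by (fastforce simp: m'_def)
  have inj: "inj_on h' V"
  proof (rule inj_onI)
    fix x y assume xy: "x \<in> V" "y \<in> V" "h' x = h' y"
    show "x = y"
    proof (cases "x \<in> U")
      case True
      then have "y \<in> U" using small[of y] old[OF True] xy by simp
      then show ?thesis using iso True xy(3) old by (auto simp: iso_on_def inj_on_def)
    next
      case False
      then have "y \<notin> U" using small[of x] old[of y] xy by auto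
      then have "b x = b y" using False xy by (simp add: h'_def)
      then show ?thesis using b False \<open>y \<notin> U\<close> xy by (auto simp: bij_betw_def inj_on_def)
    qed
  qed
  have isoV: "iso_on F Q E' R' V h'"
    unfolding iso_on_def
  proof (intro conjI ballI iffI)
    show "inj_on h' V" by (fact inj)
    show "(h' x, h' y) \<in> E'" if "x \<in> V" "y \<in> V" "(x, y) \<in> F" for x y
      using that by (force simp: E'_def)
    show "(h' x, h' y, h' z) \<in> R'" if "x \<in> V" "y \<in> V" "z \<in> V" "(x, y, z) \<in> Q" for x y z
      using that by (force simp: R'_def)
    show "(x, y) \<in> F" if xy: "x \<in> V" "y \<in> V" and e: "(h' x, h' y) \<in> E'" for x y
    proof (cases "(h' x, h' y) \<in> E")
      case True
      then have "x \<in> U" "y \<in> U" using E small xy by auto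
      then show ?thesis using iso True old by (simp add: iso_on_def)
    next
      case False
      then obtain x' y' where "(x', y') \<in> F" "x' \<in> V" "y' \<in> V" "h' x = h' x'" "h' y = h' y'"
        using e by (auto simp: E'_def)
      then show ?thesis using inj xy by (metis inj_onD)
    qed
    show "(x, y, z) \<in> Q" if xyz: "x \<in> V" "y \<in> V" "z \<in> V" and e: "(h' x, h' y, h' z) \<in> R'" for x y z
    proof (cases "(h' x, h' y, h' z) \<in> R")
      case True
      then have "x \<in> U" "y \<in> U" "z \<in> U" using R small xyz by auto
      then show ?thesis using iso True old by (simp add: iso_on_def)
    next
      case False
      then obtain x' y' z' where "(x', y', z') \<in> Q" "x' \<in> V" "y' \<in> V" "z' \<in> V"
        "h' x = h' x'" "h' y = h' y'" "h' z = h' z'"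
        using e by (auto simp: R'_def)
      then show ?thesis using inj xyz by (metis inj_onD)
    qed
  qed
  have E'm: "E' \<inter> {..<m} \<times> {..<m} = E"
  proof
    show "E' \<inter> {..<m} \<times> {..<m} \<subseteq> E"
    proof
      fix e assume e: "e \<in> E' \<inter> {..<m} \<times> {..<m}"
      show "e \<in> E"
      proof (rule ccontr)
        assume "e \<notin> E"
        then obtain x y where "(x, y) \<in> F" "x \<in> V" "y \<in> V" "e = (h' x, h' y)"
          using e by (auto simp: E'_def)
        moreover from this have "x \<in> U" "y \<in> U" using small e by auto
        ultimately have "e \<in> E" using iso old by (simp add: iso_on_def)
        then show False using \<open>e \<notin> E\<close> by simp
      qed
    qed
  qed (use E in \<open>auto simp: E'_def\<close>)
  have R'm: "R' \<inter> {..<m} \<times> {..<m} \<times> {..<m} = R"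
  proof
    show "R' \<inter> {..<m} \<times> {..<m} \<times> {..<m} \<subseteq> R"
    proof
      fix e assume e: "e \<in> R' \<inter> {..<m} \<times> {..<m} \<times> {..<m}"
      show "e \<in> R"
      proof (rule ccontr)
        assume "e \<notin> R"
        then obtain x y z where "(x, y, z) \<in> Q" "x \<in> V" "y \<in> V" "z \<in> V" "e = (h' x, h' y, h' z)"
          using e by (auto simp: R'_def)
        moreover from this have "x \<in> U" "y \<in> U" "z \<in> U" using small e by auto
        ultimately have "e \<in> R" using iso old by (simp add: iso_on_def)
        then show False using \<open>e \<notin> R\<close> by simp
      qed
    qed
  qed (use R in \<open>auto simp: R'_def\<close>)
  have un: "{..<m} \<union> h' ` V = {..<m'}"
  proof
    show "{..<m} \<union> h' ` V \<subseteq> {..<m'}" using h'V by (auto simp: m'_def)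
    show "{..<m'} \<subseteq> {..<m} \<union> h' ` V"
    proof
      fix k assume "k \<in> {..<m'}"
      then consider "k < m" | "k \<in> {m..<m'}" by force
      then show "k \<in> {..<m} \<union> h' ` V"
      proof cases
        case 2
        then have "k \<in> b ` (V - U)" using b by (simp add: bij_betw_def)
        then obtain x where "x \<in> V - U" "k = b x" by blast
        then show ?thesis by (auto simp: h'_def)
      qed simp
    qed
  qed
  have int: "{..<m} \<inter> h' ` V = h' ` U"
  proof
    show "{..<m} \<inter> h' ` V \<subseteq> h' ` U" using small by auto
    show "h' ` U \<subseteq> {..<m} \<inter> h' ` V" using old(2) UV by auto
  qed
  have h'U: "h' ` U = h ` U" using old by auto
  \<comment> \<open>Freeness: every edge of \<open>E'\<close> is old or the image of an edge inside
    \<open>V\<close>.\<close>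
  have cross: "E' \<inter> ({..<m} \<union> h' ` V) \<times> ({..<m} \<union> h' ` V) \<subseteq> {..<m} \<times> {..<m} \<union> h' ` V \<times> h' ` V"
    using E by (auto simp: E'_def)
  have cross': "E' \<inter> (h' ` V \<union> {..<m}) \<times> (h' ` V \<union> {..<m}) \<subseteq> h' ` V \<times> h' ` V \<union> {..<m} \<times> {..<m}"
    using cross by blast
  have EE': "E' \<inter> {..<m} \<times> {..<m} = E \<inter> {..<m} \<times> {..<m}" using E'm E by blast
  have spE': "sparse E' {..<m}" using spE sparse_cong[OF EE'] by simp
  have st1: "strong E' {..<m} ({..<m} \<inter> h' ` V)"
    using hU strong_cong[OF EE'] by (simp add: int h'U)
  have st2: "strong E' (h' ` V) ({..<m} \<inter> h' ` V)"
    using strong_image[OF isoV U] by (simp add: int)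
  have sp: "sparse E' {..<m'}"
    using free_amalgam_sparse[OF cross spE' sparse_image[OF isoV spF] st1 st2] by (simp add: un)
  have stm: "strong E' {..<m'} {..<m}"
    using free_amalgam_strong[OF cross _ st2] by (simp add: un)
  have stV: "strong E' {..<m'} (h' ` V)"
    using free_amalgam_strong[OF cross'] fin st1 un by (simp add: Un_commute Int_commute)
  have "is_stage (m', E', R')"
    using E R sp h'V by (auto simp: is_stage_def E'_def R'_def m'_def)
  moreover have "stage_le s (m', E', R')"
    using E'm R'm stm by (simp add: stage_le_def s_eq m'_def)
  moreover have "solved s (m', E', R') p"
    unfolding solved_def s_eq p_eq prod.case
    using old(1) new isoV stV by (intro exI[of _ h']) auto
  ultimately show ?thesis by blast
qed

lemma stage_le_trans:
  assumes "stage_le s t" "stage_le t u"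
  shows "stage_le s u"
proof -
  obtain m E R where s: "s = (m, E, R)" by (cases s)
  obtain m' E' R' where t: "t = (m', E', R')" by (cases t)
  obtain m'' E'' R'' where u: "u = (m'', E'', R'')" by (cases u)
  have 1: "m \<le> m'" "E' \<inter> {..<m} \<times> {..<m} = E" "R' \<inter> {..<m} \<times> {..<m} \<times> {..<m} = R"
     "strong E' {..<m'} {..<m}"
    using assms(1) by (auto simp: stage_le_def s t)
  have 2: "m' \<le> m''" "E'' \<inter> {..<m'} \<times> {..<m'} = E'" "R'' \<inter> {..<m'} \<times> {..<m'} \<times> {..<m'} = R'"
     "strong E'' {..<m''} {..<m'}"
    using assms(2) by (auto simp: stage_le_def t u)
  have "E'' \<inter> {..<m'} \<times> {..<m'} = E' \<inter> {..<m'} \<times> {..<m'}" using 2(2) by blast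
  then have "strong E'' {..<m'} {..<m}" using 1(4) strong_cong by blast
  then have "strong E'' {..<m''} {..<m}" using 2(4) by (rule strong_trans)
  moreover have "E'' \<inter> {..<m} \<times> {..<m} = (E'' \<inter> {..<m'} \<times> {..<m'}) \<inter> {..<m} \<times> {..<m}"
    using 1(1) by auto
  then have "E'' \<inter> {..<m} \<times> {..<m} = E" by (simp only: 1(2) 2(2))
  moreover have "R'' \<inter> {..<m} \<times> {..<m} \<times> {..<m} =
      (R'' \<inter> {..<m'} \<times> {..<m'} \<times> {..<m'}) \<inter> {..<m} \<times> {..<m} \<times> {..<m}"
    using 1(1) by auto
  then have "R'' \<inter> {..<m} \<times> {..<m} \<times> {..<m} = R" by (simp only: 1(3) 2(3))
  ultimately show ?thesis using 1(1) 2(1) by (simp add: stage_le_def s u)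
qed

lemma stage_le_refl: "is_stage s \<Longrightarrow> stage_le s s"
  by (cases s) (auto simp: stage_le_def is_stage_def intro: strong_refl)

text \<open>Problems are coded by lists, also the embedding, to make them countable and hence
  schedulable by \<open>task\<close>.\<close>

definition task_problem ::
  "nat list \<times> (nat \<times> nat) list \<times> (nat \<times> nat \<times> nat) list \<times> nat list \<times> nat list \<Rightarrow> problem" where
  "task_problem c = (case c of (vs, fs, qs, us, hs) \<Rightarrow> (set vs, set fs, set qs, set us, (!) hs))"

lemma stage_chain:
  obtains s where "\<And>k. is_stage (s k)" "\<And>k l. k \<le> l \<Longrightarrow> stage_le (s k) (s l)"
    "\<And>k. solvable (s k) (task_problem (task k)) \<Longrightarrow> solved (s k) (s (Suc k)) (task_problem (task k))"
proof -
  have "\<exists>s. \<forall>k. is_stage (s k) \<and> (stage_le (s k) (s (Suc k)) \<and>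
      (solvable (s k) (task_problem (task k)) \<longrightarrow> solved (s k) (s (Suc k)) (task_problem (task k))))"
  proof (rule dependent_nat_choice)
    have "is_stage (0, {}, {})" by (simp add: is_stage_def sparse_def delta_def)
    then show "\<exists>s. is_stage s" by blast
    show "\<exists>t. is_stage t \<and> (stage_le s t \<and>
        (solvable s (task_problem (task k)) \<longrightarrow> solved s t (task_problem (task k))))"
      if "is_stage s" for s k
      using solvable_imp_solved[OF that] stage_le_refl[OF that] that by blast
  qed
  then obtain s where s: "\<And>k. is_stage (s k)" "\<And>k. stage_le (s k) (s (Suc k))"
    "\<And>k. solvable (s k) (task_problem (task k)) \<Longrightarrow> solved (s k) (s (Suc k)) (task_problem (task k))"
    by blast
  have "stage_le (s k) (s l)" if "k \<le> l" for k l
    using that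
  proof (induction l rule: dec_induct)
    case base
    show ?case using s(1) by (rule stage_le_refl)
  next
    case (step l)
    then show ?case using stage_le_trans s(2) by blast
  qed
  then show thesis using that s(1,3) by blast
qed

text \<open>The union of a chain of stages in which every problem recurs. A given problem is
  answered at a stage late enough to contain the image of \<open>U\<close>, and its solution remains
  strong because every stage is strong in the union.\<close>

theorem generic_structure:
  obtains E :: "(nat \<times> nat) set" and R :: "(nat \<times> nat \<times> nat) set"
  where "sparse E UNIV"
    "\<And>(V :: nat set) F Q U (h :: nat \<Rightarrow> nat). finite V \<Longrightarrow> sparse F V \<Longrightarrow> strong F V U \<Longrightarrow>
      iso_on F Q E R U h \<Longrightarrow> strong E UNIV (h ` U) \<Longrightarrow>
      \<exists>h'. (\<forall>x\<in>U. h' x = h x) \<and> iso_on F Q E R V h' \<and> strong E UNIV (h' ` V)"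
proof -
  obtain s where s: "\<And>k. is_stage (s k)" "\<And>k l. k \<le> l \<Longrightarrow> stage_le (s k) (s l)"
    "\<And>k. solvable (s k) (task_problem (task k)) \<Longrightarrow> solved (s k) (s (Suc k)) (task_problem (task k))"
    using stage_chain by blast
  define m where "m k = fst (s k)" for k
  define Es where "Es k = fst (snd (s k))" for k
  define Rs where "Rs k = snd (snd (s k))" for k
  have s_eq: "s k = (m k, Es k, Rs k)" for k by (simp add: m_def Es_def Rs_def)
  have st: "Es k \<subseteq> {..<m k} \<times> {..<m k}" "Rs k \<subseteq> {..<m k} \<times> {..<m k} \<times> {..<m k}" "sparse (Es k) {..<m k}" for k
    using s(1)[of k] by (auto simp: is_stage_def s_eq)
  have le: "m k \<le> m l" "Es l \<inter> {..<m k} \<times> {..<m k} = Es k"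
    "Rs l \<inter> {..<m k} \<times> {..<m k} \<times> {..<m k} = Rs k" "strong (Es l) {..<m l} {..<m k}" if "k \<le> l" for k l
    using s(2)[OF that] by (auto simp: stage_le_def s_eq)
  define E where "E = (\<Union>k. Es k)"
  define R where "R = (\<Union>k. Rs k)"
  have Ek: "E \<inter> {..<m k} \<times> {..<m k} = Es k" for k
  proof
    show "E \<inter> {..<m k} \<times> {..<m k} \<subseteq> Es k"
    proof
      fix e assume e: "e \<in> E \<inter> {..<m k} \<times> {..<m k}"
      then obtain l where "e \<in> Es l" by (auto simp: E_def)
      then have "e \<in> Es (max k l)" using le(2)[of l "max k l"] by auto
      then show "e \<in> Es k" using le(2)[of k "max k l"] e by auto
    qed
    show "Es k \<subseteq> E \<inter> {..<m k} \<times> {..<m k}" using st(1)[of k] by (auto simp: E_def)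
  qed
  have Rk: "R \<inter> {..<m k} \<times> {..<m k} \<times> {..<m k} = Rs k" for k
  proof
    show "R \<inter> {..<m k} \<times> {..<m k} \<times> {..<m k} \<subseteq> Rs k"
    proof
      fix e assume e: "e \<in> R \<inter> {..<m k} \<times> {..<m k} \<times> {..<m k}"
      then obtain l where "e \<in> Rs l" by (auto simp: R_def)
      then have "e \<in> Rs (max k l)" using le(3)[of l "max k l"] by auto
      then show "e \<in> Rs k" using le(3)[of k "max k l"] e by auto
    qed
    show "Rs k \<subseteq> R \<inter> {..<m k} \<times> {..<m k} \<times> {..<m k}" using st(2)[of k] by (auto simp: R_def)
  qed
  have EEs: "E \<inter> {..<m k} \<times> {..<m k} = Es k \<inter> {..<m k} \<times> {..<m k}" for k
    using Ek st(1) by blast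
  have RRs: "R \<inter> {..<m k} \<times> {..<m k} \<times> {..<m k} = Rs k \<inter> {..<m k} \<times> {..<m k} \<times> {..<m k}" for k
    using Rk st(2) by blast
  \<comment> \<open>The one-point problem over the empty set is always solvable and requires a new
    point.\<close>
  have grow: "\<exists>l\<ge>k. m k < m l" for k
  proof -
    obtain j where j: "k \<le> j" "task j = ([0 :: nat], [] :: (nat \<times> nat) list,
        [] :: (nat \<times> nat \<times> nat) list, [] :: nat list, [] :: nat list)"
      using task_recurs by blast
    have "sparse {} {0 :: nat}"
    proof (unfold sparse_def, intro allI impI)
      fix X :: "nat set" assume "finite X \<and> X \<subseteq> {0}"
      then have "X = {} \<or> X = {0}" by blast
      then show "real (card X) \<le> 2 powr real_of_int (delta {} X)" by (auto simp: delta_def)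
    qed
    then have "solvable (s j) (task_problem (task j))"
      using st(3)[of j] by (simp add: j(2) task_problem_def solvable_def s_eq strong_empty iso_on_def)
    then have "solved (s j) (s (Suc j)) (task_problem (task j))" by (rule s(3))
    then have "m j < m (Suc j)" by (auto simp: j(2) task_problem_def solved_def s_eq)
    then show ?thesis using j(1) le(1)[OF j(1)] by (intro exI[of _ "Suc j"]) auto
  qed
  have "\<exists>k. n \<le> m k" for n
  proof (induction n)
    case (Suc n)
    then obtain k where "n \<le> m k" by blast
    moreover obtain l where "m k < m l" using grow by blast
    ultimately show ?case by (intro exI[of _ l]) simp
  qed simp
  then have cover: "\<exists>k. X \<subseteq> {..<m k}" if "finite X" for X
    using that finite_nat_iff_bounded[of X] by (meson lessThan_subset_iff subset_trans)
  have strongE: "strong E UNIV {..<m k}" for k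
    unfolding strong_def
  proof (intro conjI allI impI)
    fix B assume B: "finite B \<and> {..<m k} \<subset> B \<and> B \<subseteq> UNIV"
    obtain l where l: "B \<subseteq> {..<m l}" using cover B by blast
    then have B': "B \<subseteq> {..<m (max k l)}" using le(1)[of l "max k l"] by force
    have "strong E {..<m (max k l)} {..<m k}"
      using le(4)[of k "max k l"] strong_cong[OF EEs] by simp
    then show "delta E {..<m k} < delta E B" using B B' strongD by blast
  qed auto
  have "sparse E UNIV"
    unfolding sparse_def
  proof (intro allI impI)
    fix X :: "nat set" assume X: "finite X \<and> X \<subseteq> UNIV"
    then obtain k where "X \<subseteq> {..<m k}" using cover by blast
    moreover have "sparse E {..<m k}" using st(3) sparse_cong[OF EEs] by simp
    ultimately show "real (card X) \<le> 2 powr real_of_int (delta E X)" using X by (simp add: sparse_def)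
  qed
  moreover have "\<exists>h'. (\<forall>x\<in>U. h' x = h x) \<and> iso_on F Q E R V h' \<and> strong E UNIV (h' ` V)"
    if V: "finite V" "sparse F V" "strong F V U" and iso: "iso_on F Q E R U h" and hU: "strong E UNIV (h ` U)"
    for V U :: "nat set" and F Q h
  proof -
    have finU: "finite U" and UV: "U \<subseteq> V" using V(3) by (auto simp: strong_def)
    obtain k where k: "h ` U \<subseteq> {..<m k}" using cover[of "h ` U"] finU by blast
    obtain vs where vs: "set vs = V" using finite_list[OF V(1)] by blast
    obtain us where us: "set us = U" using finite_list[OF finU] by blast
    obtain fs where fs: "set fs = F \<inter> V \<times> V"
      using finite_list[of "F \<inter> V \<times> V"] V(1) by auto
    obtain qs where qs: "set qs = Q \<inter> V \<times> V \<times> V"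
      using finite_list[of "Q \<inter> V \<times> V \<times> V"] V(1) by auto
    obtain b where b: "U \<subseteq> {..<b}" using finU finite_nat_iff_bounded by blast
    define hs where "hs = map h [0..<b]"
    have hs: "hs ! x = h x" if "x \<in> U" for x using that b by (auto simp: hs_def)
    \<comment> \<open>Waiting until \<open>j\<close> is at least \<open>k\<close> ensures that the
      image of \<open>U\<close> already lies in the stage.\<close>
    obtain j where j: "k \<le> j" "task j = (vs, fs, qs, us, hs)" using task_recurs by blast
    have tp: "task_problem (task j) = (V, set fs, set qs, U, (!) hs)"
      by (simp add: task_problem_def j(2) vs us)
    have kj: "h ` U \<subseteq> {..<m j}" using k le(1)[OF j(1)] by auto
    have FF: "set fs \<inter> V \<times> V = F \<inter> V \<times> V" using fs by blast
    have QQ: "set qs \<inter> V \<times> V \<times> V = Q \<inter> V \<times> V \<times> V" using qs by blast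
    have hsU: "(!) hs ` U = h ` U" using hs by simp
    have "strong E {..<m j} (h ` U)" using strong_mono[OF hU kj] by simp
    then have 1: "strong (Es j) {..<m j} ((!) hs ` U)" using strong_cong[OF EEs] hsU by simp
    have 2: "iso_on (set fs) (set qs) (Es j) (Rs j) U ((!) hs)"
    proof -
      have "iso_on F Q E R U h \<longleftrightarrow> iso_on (set fs) (set qs) (Es j) (Rs j) U ((!) hs)"
        by (rule iso_on_cong[where W = "{..<m j}"])
          (use hs kj EEs RRs fs qs UV in \<open>auto\<close>)
      then show ?thesis using iso by simp
    qed
    have "solvable (s j) (task_problem (task j))"
      using V(1,2,3) 1 2 sparse_cong[OF FF] strong_cong[OF FF] by (simp add: solvable_def tp s_eq)
    then have "solved (s j) (s (Suc j)) (task_problem (task j))" by (rule s(3))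
    then obtain h' where h': "\<And>x. x \<in> U \<Longrightarrow> h' x = hs ! x"
      "iso_on (set fs) (set qs) (Es (Suc j)) (Rs (Suc j)) V h'"
      "strong (Es (Suc j)) {..<m (Suc j)} (h' ` V)"
      by (auto simp: solved_def tp s_eq)
    have "iso_on (set fs) (set qs) (Es (Suc j)) (Rs (Suc j)) V h' \<longleftrightarrow> iso_on F Q E R V h'"
      by (rule iso_on_cong[where W = "{..<m (Suc j)}"])
        (use FF QQ EEs RRs strong_subset[OF h'(3)] in auto)
    then have "iso_on F Q E R V h'" using h'(2) by simp
    moreover have "strong E UNIV (h' ` V)"
      using strong_trans[OF _ strongE] h'(3) strong_cong[OF EEs] by blast
    ultimately show ?thesis using h'(1) hs by auto
  qed
  ultimately show thesis by (rule that)
qed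


section \<open>Homogeneity, oligomorphy and one-point extensions of the generic structure\<close>

locale generic =
  fixes E :: "(nat \<times> nat) set" and R :: "(nat \<times> nat \<times> nat) set"
  assumes sparse: "sparse E UNIV"
    and extension: "\<And>(V :: nat set) F Q U (h :: nat \<Rightarrow> nat). finite V \<Longrightarrow> sparse F V \<Longrightarrow> strong F V U \<Longrightarrow>
      iso_on F Q E R U h \<Longrightarrow> strong E UNIV (h ` U) \<Longrightarrow>
      \<exists>h'. (\<forall>x\<in>U. h' x = h x) \<and> iso_on F Q E R V h' \<and> strong E UNIV (h' ` V)"
begin

definition G :: "(nat \<Rightarrow> nat) set" where
  "G = {g. surj g \<and> iso_on E R E R UNIV g}"

lemma G_bij: "g \<in> G \<Longrightarrow> bij g"
  by (simp add: G_def iso_on_def bij_def)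

lemma permutation_group_G: "permutation_group G"
proof
  show "bij g" if "g \<in> G" for g using that by (rule G_bij)
  show "id \<in> G" by (simp add: G_def iso_on_def)
  show "g \<circ> h \<in> G" if "g \<in> G" "h \<in> G" for g h
    using that bij_comp[OF G_bij G_bij, OF that(2,1)] unfolding G_def iso_on_def bij_def by simp
  show "inv g \<in> G" if g: "g \<in> G" for g
  proof -
    have gi: "g (inv g x) = x" for x using G_bij[OF g] by (simp add: bij_is_surj surj_f_inv_f)
    have gE: "(u, w) \<in> E \<longleftrightarrow> (g u, g w) \<in> E" and gR: "(u, w, t) \<in> R \<longleftrightarrow> (g u, g w, g t) \<in> R" for u w t
      using g by (simp_all add: G_def iso_on_def)
    have "(inv g x, inv g y) \<in> E \<longleftrightarrow> (x, y) \<in> E"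
      "(inv g x, inv g y, inv g z) \<in> R \<longleftrightarrow> (x, y, z) \<in> R" for x y z
      unfolding gE[of "inv g x"] gR[of "inv g x"] gi by simp_all
    moreover have "bij (inv g)" using G_bij[OF g] by (rule bij_imp_bij_inv)
    ultimately show ?thesis by (simp add: G_def iso_on_def bij_def)
  qed
qed

text \<open>Among the finite supersets of \<open>X\<close> with \<open>delta\<close> at most that of
  \<open>X\<close>, one of greatest size is strong. Sparseness bounds these sizes by
  \<open>2 ^ (2 * card X)\<close>, which is the stated power of 4.\<close>

lemma strong_cover:
  assumes "finite X"
  shows "\<exists>B. X \<subseteq> B \<and> strong E UNIV B \<and> card B \<le> 4 ^ card X"
proof -
  define P where "P B \<longleftrightarrow> finite B \<and> X \<subseteq> B \<and> delta E B \<le> delta E X" for B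
  have bound: "card B \<le> 4 ^ card X" if "P B" for B
  proof -
    have "real (card B) \<le> 2 powr real_of_int (delta E B)"
      using sparseD[OF sparse] that by (simp add: P_def)
    also have "real_of_int (delta E B) \<le> real (2 * card X)"
      using that by (simp add: P_def delta_def)
    then have "2 powr real_of_int (delta E B) \<le> 2 powr real (2 * card X)" by (intro powr_mono) auto
    also have "\<dots> = 4 ^ card X" by (simp only: powr_realpow power_mult) simp
    finally show ?thesis by (metis of_nat_le_iff of_nat_numeral of_nat_power)
  qed
  have "P X" using assms by (simp add: P_def)
  then obtain B where B: "P B" "\<And>C. P C \<Longrightarrow> card C \<le> card B"
    using ex_has_greatest_nat[of P X card "Suc (4 ^ card X)"] bound by (metis le_imp_less_Suc)
  have "strong E UNIV B"
    unfolding strong_def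
  proof (intro conjI allI impI)
    show "finite B" using B(1) by (simp add: P_def)
    fix C assume C: "finite C \<and> B \<subset> C \<and> C \<subseteq> UNIV"
    then have "card B < card C" by (simp add: psubset_card_mono)
    then have "\<not> P C" using B(2) by (metis leD)
    then show "delta E B < delta E C" using B(1) C by (auto simp: P_def)
  qed simp
  then show ?thesis using B(1) bound by (auto simp: P_def)
qed

text \<open>Back-and-forth through partial isomorphisms between strong sets; the extension property
  gives one direction and symmetry the other.\<close>

lemma homogeneous:
  assumes A: "strong E UNIV A" and f: "iso_on E R E R A f" and fA: "strong E UNIV (f ` A)"
  shows "\<exists>g\<in>G. \<forall>x\<in>A. g x = f x"
proof -
  define P where "P xs ys \<longleftrightarrow> (\<exists>A f. strong E UNIV A \<and> iso_on E R E R A f \<and> strong E UNIV (f ` A) \<and>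
      set xs \<subseteq> A \<and> ys = map f xs)" for xs ys
  have sym: "P ys xs" if "P xs ys" for xs ys
  proof -
    obtain A f where Af: "strong E UNIV A" "iso_on E R E R A f" "strong E UNIV (f ` A)"
      "set xs \<subseteq> A" "ys = map f xs"
      using \<open>P xs ys\<close> by (auto simp: P_def)
    have inj: "inj_on f A" using Af(2) by (simp add: iso_on_def)
    have "iso_on E R E R (f ` A) (inv_into A f)"
      using Af(2) inj unfolding iso_on_def by (auto simp: inj_on_inv_into)
    moreover have "inv_into A f ` f ` A = A" using inj by simp
    moreover have "map (inv_into A f) ys = xs"
      using Af(4,5) inj by (auto intro!: map_idI)
    moreover have "set ys \<subseteq> f ` A" using Af(4,5) by auto
    ultimately show ?thesis
      unfolding P_def using Af(1,3) by (intro exI[of _ "f ` A"] exI[of _ "inv_into A f"]) auto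
  qed
  have forth: "\<exists>b. P (xs @ [a]) (ys @ [b])" if "P xs ys" for xs ys a
  proof -
    obtain A f where Af: "strong E UNIV A" "iso_on E R E R A f" "strong E UNIV (f ` A)"
      "set xs \<subseteq> A" "ys = map f xs"
      using \<open>P xs ys\<close> by (auto simp: P_def)
    \<comment> \<open>\<open>insert a A\<close> need not be strong, so a whole strong set around it
      is added at once.\<close>
    obtain B where B: "insert a A \<subseteq> B" "strong E UNIV B"
      using strong_cover[of "insert a A"] strong_finite[OF Af(1)] by auto
    have "\<exists>h'. (\<forall>x\<in>A. h' x = f x) \<and> iso_on E R E R B h' \<and> strong E UNIV (h' ` B)"
      using B strong_mono[OF Af(1), of B] sparse_mono[OF sparse, of B] strong_finite[OF B(2)]
      by (intro extension Af) auto
    then obtain h where h: "\<And>x. x \<in> A \<Longrightarrow> h x = f x" "iso_on E R E R B h" "strong E UNIV (h ` B)"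
      by blast
    have "ys @ [h a] = map h (xs @ [a])" using h(1) Af(4,5) by auto
    then have "P (xs @ [a]) (ys @ [h a])"
      unfolding P_def using h B Af(4) by (intro exI[of _ B] exI[of _ h]) auto
    then show ?thesis by blast
  qed
  obtain as where as: "set as = A" using finite_list[OF strong_finite[OF A]] by blast
  have "\<exists>g. bij g \<and> map g as = map f as \<and> (\<forall>X. finite X \<longrightarrow> (\<exists>zs. X \<subseteq> set zs \<and> P zs (map g zs)))"
  proof (rule back_and_forth[of P as "map f as"])
    show "P as (map f as)" using A f fA as by (auto simp: P_def)
    show "\<exists>b. P (xs @ [a]) (ys @ [b])" if "P xs ys" for xs ys a using that by (rule forth)
    show "\<exists>a. P (xs @ [a]) (ys @ [b])" if "P xs ys" for xs ys b
      using forth[OF sym[OF that]] sym by blast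
    show "length xs = length ys" if "P xs ys" for xs ys using that by (auto simp: P_def)
    show "xs ! i = xs ! j \<longleftrightarrow> ys ! i = ys ! j"
      if P: "P xs ys" and ij: "i < length xs" "j < length xs" for xs ys i j
    proof -
      obtain A f where "iso_on E R E R A f" "set xs \<subseteq> A" "ys = map f xs"
        using P by (auto simp: P_def)
      then show ?thesis using ij unfolding iso_on_def
        by (metis inj_on_eq_iff nth_map nth_mem subsetD)
    qed
  qed blast
  then obtain g where g: "bij g" "map g as = map f as"
    "\<And>X. finite X \<Longrightarrow> \<exists>zs. X \<subseteq> set zs \<and> P zs (map g zs)" by blast
  have "iso_on E R E R X g" if fin: "finite X" for X
  proof -
    obtain zs where zs: "X \<subseteq> set zs" "P zs (map g zs)" using g(3)[OF fin] by blast
    then obtain A f where "iso_on E R E R A f" "set zs \<subseteq> A" "map g zs = map f zs"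
      by (auto simp: P_def)
    then have "iso_on E R E R X f" "\<And>x. x \<in> X \<Longrightarrow> f x = g x"
      using zs(1) by (auto intro: iso_on_subset)
    then show ?thesis using iso_on_cong[of X f g E E R R UNIV E E R R] by simp
  qed
  then have "iso_on E R E R {x, y, z} g" for x y z by simp
  then have "g \<in> G" using g(1) unfolding G_def iso_on_def bij_def by auto
  moreover have "\<forall>x\<in>A. g x = f x" using g(2) as by (metis map_eq_conv)
  ultimately show ?thesis by blast
qed

text \<open>An \<open>n\<close>-tuple lies in a strong set of at most \<open>4 ^ n\<close> points.
  By homogeneity the isomorphism type of an enumeration of this set and the positions of the tuple
  in it determine the orbit, leaving finitely many possibilities.\<close>

lemma oligomorphic_G: "oligomorphic G"
  unfolding oligomorphic_def
proof
  fix n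
  define N :: nat where "N = 4 ^ n"
  have "\<exists>bs. distinct bs \<and> strong E UNIV (set bs) \<and> set xs \<subseteq> set bs \<and> length bs \<le> N"
    if "length xs = n" for xs
  proof -
    obtain B where B: "set xs \<subseteq> B" "strong E UNIV B" "card B \<le> 4 ^ card (set xs)"
      using strong_cover[of "set xs"] by auto
    obtain bs where bs: "set bs = B" "distinct bs"
      using finite_distinct_list[OF strong_finite[OF B(2)]] by blast
    have "(4 :: nat) ^ card (set xs) \<le> N"
      unfolding N_def using card_length[of xs] that by (intro power_increasing) auto
    then show ?thesis using B bs distinct_card[OF bs(2)] by (intro exI[of _ bs]) auto
  qed
  then obtain bs where bs: "\<And>xs. length xs = n \<Longrightarrow> distinct (bs xs) \<and> strong E UNIV (set (bs xs)) \<and>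
      set xs \<subseteq> set (bs xs) \<and> length (bs xs) \<le> N"
    by metis
  have "\<exists>is. set is \<subseteq> {..<length (bs xs)} \<and> xs = map ((!) (bs xs)) is \<and> length is = n"
    if xs: "length xs = n" for xs
  proof -
    have "\<forall>x\<in>set xs. \<exists>i. i < length (bs xs) \<and> bs xs ! i = x"
      unfolding in_set_conv_nth[symmetric] using bs[OF xs] by blast
    then obtain ix where "\<forall>x\<in>set xs. ix x < length (bs xs) \<and> bs xs ! ix x = x"
      unfolding bchoice_iff by blast
    then show ?thesis using xs by (intro exI[of _ "map ix xs"]) (auto intro!: map_idI[symmetric])
  qed
  then obtain ii where ii: "\<And>xs. length xs = n \<Longrightarrow> set (ii xs) \<subseteq> {..<length (bs xs)} \<and>
      xs = map ((!) (bs xs)) (ii xs) \<and> length (ii xs) = n"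
    by metis
  define code where "code xs = (length (bs xs),
      {(i, j). i < length (bs xs) \<and> j < length (bs xs) \<and> (bs xs ! i, bs xs ! j) \<in> E},
      {(i, j, k). i < length (bs xs) \<and> j < length (bs xs) \<and> k < length (bs xs) \<and>
        (bs xs ! i, bs xs ! j, bs xs ! k) \<in> R}, ii xs)" for xs
  define C where "C = {..N} \<times> Pow ({..<N} \<times> {..<N}) \<times> Pow ({..<N} \<times> {..<N} \<times> {..<N}) \<times>
      {is. set is \<subseteq> {..<N} \<and> length is = n}"
  have finC: "finite C" unfolding C_def by (intro finite_cartesian_product finite_lists_length_eq) auto
  have codeC: "code xs \<in> C" if "length xs = n" for xs
    using bs[OF that] ii[OF that] by (auto simp: code_def C_def)
  have orbit: "\<exists>g\<in>G. map g xs = ys" if xs: "length xs = n" and ys: "length ys = n" and eq: "code xs = code ys"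
    for xs ys
  proof -
    let ?b = "bs xs" and ?c = "bs ys"
    have len: "length ?b = length ?c" and ieq: "ii xs = ii ys" using eq by (auto simp: code_def)
    have Eeq: "(?b ! i, ?b ! j) \<in> E \<longleftrightarrow> (?c ! i, ?c ! j) \<in> E" if "i < length ?b" "j < length ?b" for i j
    proof -
      have "fst (snd (code xs)) = fst (snd (code ys))" using eq by simp
      from eqset_imp_iff[OF this, of "(i, j)"] show ?thesis using that len by (simp add: code_def)
    qed
    have Req: "(?b ! i, ?b ! j, ?b ! k) \<in> R \<longleftrightarrow> (?c ! i, ?c ! j, ?c ! k) \<in> R"
      if "i < length ?b" "j < length ?b" "k < length ?b" for i j k
    proof -
      have "fst (snd (snd (code xs))) = fst (snd (snd (code ys)))" using eq by simp
      from eqset_imp_iff[OF this, of "(i, j, k)"] show ?thesis using that len by (simp add: code_def)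
    qed
    define f where "f x = the (map_of (zip ?b ?c) x)" for x
    have f: "f (?b ! i) = ?c ! i" if "i < length ?b" for i
      using that len bs[OF xs] by (simp add: f_def map_of_zip_nth)
    have mem: "\<exists>i<length ?b. ?b ! i = x" if "x \<in> set ?b" for x
      using that by (metis in_set_conv_nth)
    have "iso_on E R E R (set ?b) f"
      unfolding iso_on_def
    proof (intro conjI ballI)
      show "inj_on f (set ?b)"
      proof (rule inj_onI)
        fix x y assume "x \<in> set ?b" "y \<in> set ?b" "f x = f y"
        then show "x = y" using mem f len bs[OF ys] by (metis nth_eq_iff_index_eq)
      qed
      show "(x, y) \<in> E \<longleftrightarrow> (f x, f y) \<in> E" if "x \<in> set ?b" "y \<in> set ?b" for x y
        using mem[OF that(1)] mem[OF that(2)] f Eeq by auto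
      show "(x, y, z) \<in> R \<longleftrightarrow> (f x, f y, f z) \<in> R" if "x \<in> set ?b" "y \<in> set ?b" "z \<in> set ?b" for x y z
        using mem[OF that(1)] mem[OF that(2)] mem[OF that(3)] f Req by auto
    qed
    moreover have "f ` set ?b = set ?c"
    proof -
      have "map f ?b = ?c" by (rule nth_equalityI) (use f len in auto)
      then show ?thesis by (metis list.set_map)
    qed
    ultimately obtain g where g: "g \<in> G" "\<forall>x\<in>set ?b. g x = f x"
      using homogeneous bs[OF xs] bs[OF ys] by metis
    have "map g xs = map ((!) ?c) (ii xs)"
    proof (rule nth_equalityI)
      show "length (map g xs) = length (map ((!) ?c) (ii xs))" using ii[OF xs] xs by simp
      fix k assume "k < length (map g xs)"
      then have k: "k < length (ii xs)" using ii[OF xs] xs by simp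
      then have i: "ii xs ! k < length ?b" using ii[OF xs] nth_mem by blast
      have "xs ! k = ?b ! (ii xs ! k)" using ii[OF xs] k by (metis nth_map)
      then have "g (xs ! k) = ?c ! (ii xs ! k)" using g(2) f i by simp
      then show "map g xs ! k = map ((!) ?c) (ii xs) ! k" using k ii[OF xs] xs by simp
    qed
    then have "map g xs = ys" using ii[OF ys] ieq by metis
    then show ?thesis using g(1) by blast
  qed
  define rep where "rep c = (SOME xs. length xs = n \<and> code xs = c)" for c
  have "\<exists>ys\<in>rep ` C. \<exists>g\<in>G. map g ys = xs" if xs: "length xs = n" for xs
  proof -
    have "length (rep (code xs)) = n \<and> code (rep (code xs)) = code xs"
      unfolding rep_def by (rule someI[of _ xs]) (simp add: xs)
    then show ?thesis using orbit[of "rep (code xs)" xs] codeC[OF xs] xs by blast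
  qed
  then show "\<exists>X. finite X \<and> (\<forall>xs. length xs = n \<longrightarrow> (\<exists>ys\<in>X. \<exists>g\<in>G. map g ys = xs))"
    using finC by (intro exI[of _ "rep ` C"]) blast
qed

text \<open>A point with at most one edge adds at least 1 to \<open>delta\<close>, so the structure
  stays sparse and \<open>A\<close> stays strong. The ternary relation is unconstrained, hence
  \<open>S\<close> is arbitrary.\<close>

lemma one_point_extension:
  assumes A: "strong E UNIV A" and N: "N \<subseteq> A" "card N \<le> 1"
  shows "\<exists>x. x \<notin> A \<and> (\<forall>a\<in>A. (a, x) \<in> E \<longleftrightarrow> a \<in> N) \<and> (\<forall>a\<in>A. \<forall>b\<in>A. (x, a, b) \<in> R \<longleftrightarrow> (a, b) \<in> S)"
proof -
  have finA: "finite A" using A by (rule strong_finite)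
  obtain v where v: "v \<notin> A" using finA ex_new_if_finite infinite_UNIV_nat by blast
  define F where "F = E \<inter> A \<times> A \<union> N \<times> {v}"
  define Q where "Q = R \<inter> A \<times> A \<times> A \<union> {v} \<times> (S \<inter> A \<times> A)"
  have dF: "delta F X = delta E X" if "X \<subseteq> A" for X
    by (rule delta_cong[of _ A]) (use that v in \<open>auto simp: F_def\<close>)
  have step: "delta E (X - {v}) + 1 \<le> delta F X" if X: "X \<subseteq> insert v A" "v \<in> X" for X
  proof -
    have finX: "finite X" using X(1) finA finite_subset by blast
    have finN: "finite N" using N(1) finA finite_subset by blast
    have "F \<inter> X \<times> X \<subseteq> F \<inter> (X - {v}) \<times> (X - {v}) \<union> N \<times> {v}"
      using v N(1) by (auto simp: F_def)
    then have "card (F \<inter> X \<times> X) \<le> card (F \<inter> (X - {v}) \<times> (X - {v}) \<union> N \<times> {v})"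
      using finX finN by (intro card_mono) auto
    also have "\<dots> \<le> card (F \<inter> (X - {v}) \<times> (X - {v})) + card (N \<times> {v})" by (rule card_Un_le)
    also have "\<dots> \<le> card (F \<inter> (X - {v}) \<times> (X - {v})) + 1" using N(2) by (simp add: card_cartesian_product)
    finally have "delta F (X - {v}) + 1 \<le> delta F X"
      using card_Suc_Diff1[OF finX X(2)] by (simp add: delta_def)
    moreover have "X - {v} \<subseteq> A" using X(1) by blast
    ultimately show ?thesis using dF by simp
  qed
  have "sparse F (insert v A)"
    unfolding sparse_def
  proof (intro allI impI)
    fix X assume X: "finite X \<and> X \<subseteq> insert v A"
    show "real (card X) \<le> 2 powr real_of_int (delta F X)"
    proof (cases "v \<in> X")
      case False
      then have "X \<subseteq> A" using X by blast
      then show ?thesis using X dF[of X] sparseD[OF sparse, of X] by simp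
    next
      case True
      let ?Y = "X - {v}"
      have Y: "real (card ?Y) \<le> 2 powr real_of_int (delta E ?Y)" using sparseD[OF sparse] X by simp
      have d: "delta E ?Y + 1 \<le> delta F X" using step X True by blast
      have cX: "card X = card ?Y + 1" using card_Suc_Diff1[of X v] X True by simp
      \<comment> \<open>Adding one point at most doubles the size only if there was a point before,
        so a single new point is treated apart.\<close>
      show ?thesis
      proof (cases "?Y = {}")
        case True
        then have "delta E ?Y = 0" by (simp only: delta_def) simp
        then have "delta F X \<ge> 1" using d by simp
        then have "(2 :: real) powr 0 \<le> 2 powr real_of_int (delta F X)" by (intro powr_mono) auto
        then show ?thesis using cX True by simp
      next
        case False
        then have "1 \<le> card ?Y" using X by (simp add: Suc_le_eq card_gt_0_iff)
        then have "real (card X) \<le> 2 * real (card ?Y)" using cX by simp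
        also have "\<dots> \<le> 2 * 2 powr real_of_int (delta E ?Y)" using Y by simp
        also have "\<dots> = 2 powr (real_of_int (delta E ?Y) + 1)" by (simp add: powr_add)
        also have "\<dots> \<le> 2 powr real_of_int (delta F X)" using d by (intro powr_mono) linarith+
        finally show ?thesis .
      qed
    qed
  qed
  moreover have "strong F (insert v A) A"
    unfolding strong_def
  proof (intro conjI allI impI)
    fix B assume B: "finite B \<and> A \<subset> B \<and> B \<subseteq> insert v A"
    then have "B = insert v A" by blast
    then show "delta F A < delta F B" using step[of B] v dF[of A] by simp
  qed (use finA in auto)
  moreover have "iso_on F Q E R A id"
    using v by (auto simp: iso_on_def F_def Q_def)
  moreover have "strong E UNIV (id ` A)" using A by simp
  ultimately obtain h where h: "\<forall>x\<in>A. h x = id x" "iso_on F Q E R (insert v A) h"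
    using extension[of "insert v A" F A Q id] finA by blast
  \<comment> \<open>\<open>h\<close> is the identity on \<open>A\<close>, so a value of
    \<open>h\<close> at \<open>v\<close> inside \<open>A\<close> would contradict
    injectivity.\<close>
  have "h v \<notin> A"
  proof
    assume "h v \<in> A"
    then have "h (h v) = h v" using h(1) by simp
    then have "h v = v" using h(2) \<open>h v \<in> A\<close> unfolding iso_on_def inj_on_def by blast
    then show False using v \<open>h v \<in> A\<close> by simp
  qed
  moreover have "(a, h v) \<in> E \<longleftrightarrow> a \<in> N" if "a \<in> A" for a
  proof -
    have "(h a, h v) \<in> E \<longleftrightarrow> (a, v) \<in> F" using h(2) that by (simp add: iso_on_def)
    then show ?thesis using h(1) that v by (auto simp: F_def)
  qed
  moreover have "(h v, a, b) \<in> R \<longleftrightarrow> (a, b) \<in> S" if "a \<in> A" "b \<in> A" for a b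
  proof -
    have "(h v, h a, h b) \<in> R \<longleftrightarrow> (v, a, b) \<in> Q" using h(2) that by (simp add: iso_on_def)
    then show ?thesis using h(1) that v by (auto simp: Q_def)
  qed
  ultimately show ?thesis by blast
qed

text \<open>A finite out-neighbourhood together with \<open>a\<close> lies in a finite strong set,
  and a one-point extension attached to \<open>a\<close> gives an out-neighbour outside it.\<close>

lemma infinite_out: "infinite {b. (a, b) \<in> E}"
proof
  assume fin: "finite {b. (a, b) \<in> E}"
  obtain A where A: "insert a {b. (a, b) \<in> E} \<subseteq> A" "strong E UNIV A"
    using strong_cover[of "insert a {b. (a, b) \<in> E}"] fin by auto
  have "a \<in> A" using A(1) by simp
  then obtain x where "x \<notin> A" "\<forall>a'\<in>A. (a', x) \<in> E \<longleftrightarrow> a' \<in> {a}"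
    using one_point_extension[OF A(2), of "{a}" "{}"] by auto
  then have "x \<notin> A" "(a, x) \<in> E" using \<open>a \<in> A\<close> by auto
  then show False using A(1) by blast
qed

lemma code_relation:
  assumes "finite X"
  shows "\<exists>x. \<forall>a\<in>X. \<forall>b\<in>X. (x, a, b) \<in> R \<longleftrightarrow> (a, b) \<in> S"
proof -
  obtain A where "X \<subseteq> A" "strong E UNIV A" using strong_cover[OF assms] by blast
  then show ?thesis using one_point_extension[of A "{}" S]
    by (simp add: subset_iff) metis
qed

end


section \<open>Bounded orientations of finite subgraphs, and the impossibility of invariant
  ones\<close>

section \<open>Orientations\<close>

text \<open>As in Rado's proof of Hall's theorem, options are removed one at a time: if neither of two
  options of \<open>x\<close> could be removed, submodularity would contradict the counting condition.\<close>

lemma bounded_choice: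
  fixes Opt :: "'d \<Rightarrow> 'v set"
  assumes "finite D" "\<And>d. d \<in> D \<Longrightarrow> finite (Opt d)"
    and "\<And>F. F \<subseteq> D \<Longrightarrow> card F \<le> k * card (\<Union>d\<in>F. Opt d)"
  shows "\<exists>f. (\<forall>d\<in>D. f d \<in> Opt d) \<and> (\<forall>v. card {d \<in> D. f d = v} \<le> k)"
  using assms(2,3)
proof (induction "\<Sum>d\<in>D. card (Opt d)" arbitrary: Opt rule: less_induct)
  case less
  note finO = less.prems(1) and hall = less.prems(2)
  have finU: "finite (\<Union>d\<in>F. Opt d)" if "F \<subseteq> D" for F
    by (rule finite_UN_I) (use that finO finite_subset[OF that \<open>finite D\<close>] in auto)
  have ne: "Opt d \<noteq> {}" if "d \<in> D" for d
    using hall[of "{d}"] that by auto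
  show ?case
  proof (cases "\<exists>x\<in>D. \<exists>a\<in>Opt x. \<exists>b\<in>Opt x. a \<noteq> b")
    case False
    \<comment> \<open>All option sets are singletons here, and the counting condition on each fibre
      of \<open>f\<close> is exactly the bound \<open>k\<close>.\<close>
    define f where "f d = (SOME v. v \<in> Opt d)" for d
    have f: "Opt d = {f d}" if "d \<in> D" for d
    proof -
      have "f d \<in> Opt d" unfolding f_def using ne[OF that] by (simp add: some_in_eq)
      then show ?thesis using False that by blast
    qed
    have "card {d \<in> D. f d = v} \<le> k" for v
    proof -
      have "(\<Union>d\<in>{d \<in> D. f d = v}. Opt d) \<subseteq> {v}" using f by auto
      then have "card (\<Union>d\<in>{d \<in> D. f d = v}. Opt d) \<le> 1"
        by (metis card.empty card_1_singleton_iff card_mono finite.emptyI finite_insert One_nat_def)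
      then have "k * card (\<Union>d\<in>{d \<in> D. f d = v}. Opt d) \<le> k * 1" by (rule mult_le_mono2)
      moreover have "card {d \<in> D. f d = v} \<le> k * card (\<Union>d\<in>{d \<in> D. f d = v}. Opt d)"
        by (rule hall) blast
      ultimately show ?thesis by linarith
    qed
    then show ?thesis using f by (intro exI[of _ f]) auto
  next
    case True
    then obtain x a b where x: "x \<in> D" and ab: "a \<in> Opt x" "b \<in> Opt x" "a \<noteq> b" by blast
    have shrink: ?thesis
      if c: "c \<in> Opt x"
        and hc: "\<And>F. F \<subseteq> D - {x} \<Longrightarrow> card F + 1 \<le> k * card ((\<Union>d\<in>F. Opt d) \<union> (Opt x - {c}))" for c
    proof -
      let ?O = "Opt(x := Opt x - {c})"
      have "(\<Sum>d\<in>D. card (?O d)) < (\<Sum>d\<in>D. card (Opt d))"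
      proof (rule sum_strict_mono_ex1[OF \<open>finite D\<close>])
        show "\<forall>d\<in>D. card (?O d) \<le> card (Opt d)" using finO x by (auto intro: card_mono)
        show "\<exists>d\<in>D. card (?O d) < card (Opt d)"
          using x card_Diff1_less[OF finO[OF x] c] by (intro bexI[of _ x]) (simp_all only: fun_upd_same)
      qed
      moreover have "finite (?O d)" if "d \<in> D" for d using finO[OF that] x finO by auto
      moreover have "card F \<le> k * card (\<Union>d\<in>F. ?O d)" if "F \<subseteq> D" for F
      proof (cases "x \<in> F")
        case True
        have "(\<Union>d\<in>F. ?O d) = (\<Union>d\<in>F - {x}. Opt d) \<union> (Opt x - {c})" using True by auto
        moreover have "card F = card (F - {x}) + 1"
          using card_Suc_Diff1[OF finite_subset[OF that \<open>finite D\<close>] True] by linarith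
        moreover have "card (F - {x}) + 1 \<le> k * card ((\<Union>d\<in>F - {x}. Opt d) \<union> (Opt x - {c}))"
          by (rule hc) (use that in blast)
        ultimately show ?thesis by (simp only:)
      next
        case False
        then have "(\<Union>d\<in>F. ?O d) = (\<Union>d\<in>F. Opt d)" by auto
        then show ?thesis using hall[OF that] by simp
      qed
      ultimately have "\<exists>f. (\<forall>d\<in>D. f d \<in> ?O d) \<and> (\<forall>v. card {d \<in> D. f d = v} \<le> k)"
        by (rule less.hyps)
      then show ?thesis by (auto split: if_splits)
    qed
    show ?thesis
    proof (rule ccontr)
      assume no: "\<not> ?thesis"
      obtain F1 where F1: "F1 \<subseteq> D - {x}" "k * card ((\<Union>d\<in>F1. Opt d) \<union> (Opt x - {a})) < card F1 + 1"
        using shrink[OF ab(1)] no by (meson not_le)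
      obtain F2 where F2: "F2 \<subseteq> D - {x}" "k * card ((\<Union>d\<in>F2. Opt d) \<union> (Opt x - {b})) < card F2 + 1"
        using shrink[OF ab(2)] no by (meson not_le)
      define U1 where "U1 = (\<Union>d\<in>F1. Opt d) \<union> (Opt x - {a})"
      define U2 where "U2 = (\<Union>d\<in>F2. Opt d) \<union> (Opt x - {b})"
      have fin: "finite F1" "finite F2" "finite U1" "finite U2"
        using F1(1) F2(1) \<open>finite D\<close> finO x finU[of F1] finU[of F2]
        by (auto simp: U1_def U2_def intro: finite_subset)
      have "card F1 + card F2 = card (F1 \<union> F2) + card (F1 \<inter> F2)"
        by (rule card_Un_Int[OF fin(1,2)])
      moreover have "card (insert x (F1 \<union> F2)) = card (F1 \<union> F2) + 1"
        using F1(1) F2(1) fin by (subst card_insert_disjoint) auto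
      \<comment> \<open>As \<open>a\<close> and \<open>b\<close> differ,
        \<open>U1 \<union> U2\<close> contains all options of \<open>x\<close>, so \<open>x\<close>
        may be counted as well; this surplus of 1 produces the contradiction.\<close>
      moreover have "card (insert x (F1 \<union> F2)) \<le> k * card (U1 \<union> U2)"
      proof -
        have "(\<Union>d\<in>insert x (F1 \<union> F2). Opt d) = U1 \<union> U2" using ab by (auto simp: U1_def U2_def)
        moreover have "insert x (F1 \<union> F2) \<subseteq> D" using F1(1) F2(1) x by blast
        ultimately show ?thesis using hall[of "insert x (F1 \<union> F2)"] by (simp only:)
      qed
      moreover have "card (F1 \<inter> F2) \<le> k * card (U1 \<inter> U2)"
      proof -
        have "card (F1 \<inter> F2) \<le> k * card (\<Union>d\<in>F1 \<inter> F2. Opt d)" using F1(1) by (intro hall) auto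
        also have "\<dots> \<le> k * card (U1 \<inter> U2)"
          using fin by (intro mult_le_mono2 card_mono) (auto simp: U1_def U2_def)
        finally show ?thesis .
      qed
      moreover have "k * card U1 + k * card U2 = k * card (U1 \<union> U2) + k * card (U1 \<inter> U2)"
        using card_Un_Int[OF fin(3,4)] by (simp flip: distrib_left)
      ultimately show False using F1(2) F2(2) unfolding U1_def[symmetric] U2_def[symmetric] by linarith
    qed
  qed
qed

text \<open>A set \<open>S\<close> of pairs orients the edge relation: an edge belongs to its first endpoint if it is
  in \<open>S\<close>, and to its second endpoint otherwise.\<close>

definition owner :: "('v \<times> 'v) set \<Rightarrow> 'v \<times> 'v \<Rightarrow> 'v" where
  "owner S c = (if c \<in> S then fst c else snd c)"

definition owned :: "('v \<times> 'v) set \<Rightarrow> ('v \<times> 'v) set \<Rightarrow> 'v \<Rightarrow> ('v \<times> 'v) set" where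
  "owned E S a = {c \<in> E. owner S c = a}"

text \<open>A nonempty finite set has nonnegative \<open>delta\<close>, so it spans at most twice as
  many edges as points. This is the counting condition for edges choosing an endpoint, each endpoint
  at most twice.\<close>

lemma sparse_orientation:
  assumes E: "sparse E UNIV" and X: "finite X"
  shows "\<exists>S. \<forall>a. card (owned (E \<inter> X \<times> X) S a) \<le> 2"
proof -
  have "\<exists>f. (\<forall>d\<in>E \<inter> X \<times> X. f d \<in> {fst d, snd d}) \<and> (\<forall>v. card {d \<in> E \<inter> X \<times> X. f d = v} \<le> 2)"
  proof (rule bounded_choice)
    show "finite (E \<inter> X \<times> X)" using X by (rule finite_edges)
    show "finite {fst d, snd d}" for d :: "'a \<times> 'a" by simp
    fix F assume F: "F \<subseteq> E \<inter> X \<times> X"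
    define Y where "Y = (\<Union>d\<in>F. {fst d, snd d})"
    have "finite F" using F X finite_edges finite_subset by metis
    then have Y: "finite Y" by (auto simp: Y_def)
    have sub: "F \<subseteq> E \<inter> Y \<times> Y" using F by (force simp: Y_def)
    have "card F \<le> 2 * card Y"
    proof (cases "Y = {}")
      case True
      then show ?thesis using sub by auto
    next
      case False
      then have "1 \<le> card Y" using Y by (simp add: Suc_le_eq card_gt_0_iff)
      then have "2 powr 0 \<le> real (card Y)" by simp
      also have "\<dots> \<le> 2 powr real_of_int (delta E Y)" using sparseD[OF E Y] by simp
      finally have "0 \<le> delta E Y" by (subst (asm) powr_le_cancel_iff) auto
      then have "card (E \<inter> Y \<times> Y) \<le> 2 * card Y" by (simp add: delta_def)
      then show ?thesis using card_mono[OF finite_edges[OF Y] sub] by linarith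
    qed
    then show "card F \<le> 2 * card (\<Union>d\<in>F. {fst d, snd d})" by (simp add: Y_def)
  qed
  then obtain f where f: "\<And>d. d \<in> E \<inter> X \<times> X \<Longrightarrow> f d \<in> {fst d, snd d}"
    "\<And>v. card {d \<in> E \<inter> X \<times> X. f d = v} \<le> 2" by blast
  have "owned (E \<inter> X \<times> X) {d. f d = fst d} a = {d \<in> E \<inter> X \<times> X. f d = a}" for a
    using f(1) by (fastforce simp: owned_def owner_def)
  then show ?thesis using f(2) by (intro exI[of _ "{d. f d = fst d}"]) simp
qed

lemma no_invariant_orientation:
  assumes H: "oligomorphic H"
    and inv: "\<And>g x y. g \<in> H \<Longrightarrow> (g x, g y) \<in> E \<longleftrightarrow> (x, y) \<in> E"
      "\<And>g x y. g \<in> H \<Longrightarrow> (g x, g y) \<in> S \<longleftrightarrow> (x, y) \<in> S" and bij: "\<And>g. g \<in> H \<Longrightarrow> bij g"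
    and deg: "\<And>a. finite (owned E S a)" and inf: "\<And>a. infinite {b. (a, b) \<in> E}"
  shows False
proof -
  define out where "out a = {b. (a, b) \<in> E \<and> (a, b) \<in> S \<or> (b, a) \<in> E \<and> (b, a) \<notin> S}" for a
  have fin_out: "finite (out a)" for a
  proof (rule finite_subset)
    show "out a \<subseteq> fst ` owned E S a \<union> snd ` owned E S a"
      by (force simp: out_def owned_def owner_def)
    show "finite (fst ` owned E S a \<union> snd ` owned E S a)" using deg by simp
  qed
  \<comment> \<open>The vertices reachable from \<open>a\<close> along at most \<open>k\<close>
    oriented edges.\<close>
  define D where "D k a = ((\<lambda>X. X \<union> (\<Union>x\<in>X. out x)) ^^ k) {a}" for k a
  have D0: "D 0 a = {a}" and DS: "D (Suc k) a = D k a \<union> (\<Union>x\<in>D k a. out x)" for k a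
    by (simp_all add: D_def)
  have fin_D: "finite (D k a)" for k a by (induction k) (auto simp: D0 DS fin_out)
  have out_g: "g b \<in> out (g a) \<longleftrightarrow> b \<in> out a" if "g \<in> H" for g a b
    using inv[OF that] by (simp add: out_def)
  have D_g: "g b \<in> D k (g a) \<longleftrightarrow> b \<in> D k a" if g: "g \<in> H" for g k a b
  proof (induction k arbitrary: b)
    case 0
    show ?case using bij[OF g] by (simp add: D0 bij_is_inj inj_eq)
  next
    case (Suc k)
    have "(\<exists>x\<in>D k (g a). g b \<in> out x) \<longleftrightarrow> (\<exists>y. g y \<in> D k (g a) \<and> g b \<in> out (g y))"
      using bij[OF g] by (metis bij_pointE)
    then show ?case by (simp add: DS Suc out_g[OF g]) blast
  qed
  have mono: "D k a \<subseteq> D l a" if "k \<le> l" for k l a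
    using that by (induction l rule: dec_induct) (auto simp: DS)
  obtain X where X: "finite X" "\<forall>xs. length xs = 2 \<longrightarrow> (\<exists>ys\<in>X. \<exists>g\<in>H. map g ys = xs)"
    using H[unfolded oligomorphic_def, THEN spec, of 2] by (elim exE conjE)
  \<comment> \<open>Among the finitely many representatives of pairs one \<open>k\<close> suffices
    whenever the second entry is reachable; invariance then spreads it to all pairs.\<close>
  have "\<exists>k. \<forall>ys\<in>X. \<forall>a b l. ys = [a, b] \<longrightarrow> b \<in> D l a \<longrightarrow> b \<in> D k a"
    using X(1)
  proof (induction X)
    case (insert ys X)
    then obtain k where k: "\<forall>ys\<in>X. \<forall>a b l. ys = [a, b] \<longrightarrow> b \<in> D l a \<longrightarrow> b \<in> D k a" by blast
    have "\<exists>m. \<forall>a b l. ys = [a, b] \<longrightarrow> b \<in> D l a \<longrightarrow> b \<in> D m a"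
      by (cases "\<exists>a b l. ys = [a, b] \<and> b \<in> D l a") auto
    then obtain m where m: "\<forall>a b l. ys = [a, b] \<longrightarrow> b \<in> D l a \<longrightarrow> b \<in> D m a" by blast
    show ?case
    proof (intro exI[of _ "max k m"] ballI allI impI)
      fix zs a b l
      assume "zs \<in> insert ys X" "zs = [a, b]" "b \<in> D l a"
      then have "b \<in> D k a \<or> b \<in> D m a" using k m by blast
      then show "b \<in> D (max k m) a"
        using mono[of k "max k m" a] mono[of m "max k m" a] by auto
    qed
  qed simp
  then obtain k where k: "\<And>a b l. [a, b] \<in> X \<Longrightarrow> b \<in> D l a \<Longrightarrow> b \<in> D k a" by blast
  have rep: "\<exists>a' b' g. [a', b'] \<in> X \<and> g \<in> H \<and> g a' = a \<and> g b' = b" for a b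
  proof -
    obtain ys g where ys: "ys \<in> X" "g \<in> H" "map g ys = [a, b]" using X(2)[THEN spec, of "[a, b]"] by auto
    then show ?thesis by (auto simp: map_eq_Cons_conv)
  qed
  have stable: "b \<in> D k a" if b: "b \<in> D l a" for a b l
  proof -
    obtain a' b' g where g: "[a', b'] \<in> X" "g \<in> H" "g a' = a" "g b' = b" using rep by blast
    then have "b' \<in> D l a'" using D_g[OF g(2), of b' l a'] b by simp
    then have "b' \<in> D k a'" using k g(1) by blast
    then show ?thesis using D_g[OF g(2), of b' k a'] g by simp
  qed
  have closed: "out x \<subseteq> D k a" if "x \<in> D k a" for x a
    using stable[of _ "Suc k" a] that by (auto simp: DS)
  have self: "a \<in> D k a" for a using mono[of 0 k a] by (simp add: D0)
  have card_g: "card (D k (g a)) = card (D k a)" if g: "g \<in> H" for g a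
  proof -
    have "D k (g a) = g ` D k a"
    proof
      show "D k (g a) \<subseteq> g ` D k a"
      proof
        fix y assume y: "y \<in> D k (g a)"
        obtain b where "y = g b" using bij[OF g] by (metis bij_pointE)
        then show "y \<in> g ` D k a" using y D_g[OF g] by auto
      qed
    qed (use D_g[OF g] in auto)
    then show ?thesis using bij[OF g] by (metis bij_is_inj card_image inj_on_subset subset_UNIV)
  qed
  have "finite (range (\<lambda>a. card (D k a)))"
  proof (rule finite_subset)
    show "range (\<lambda>a. card (D k a)) \<subseteq> (\<lambda>ys. card (D k (hd ys))) ` X"
    proof
      fix n assume "n \<in> range (\<lambda>a. card (D k a))"
      then obtain a where a: "n = card (D k a)" by blast
      obtain a' b' g where "[a', b'] \<in> X" "g \<in> H" "g a' = a" using rep by blast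
      then show "n \<in> (\<lambda>ys. card (D k (hd ys))) ` X"
        using card_g a by (intro image_eqI[of _ _ "[a', b']"]) auto
    qed
  qed (use X(1) in simp)
  \<comment> \<open>The size of \<open>D k a\<close> is constant on orbits, so it takes finitely
    many values and \<open>a\<close> can be chosen with the largest.\<close>
  then have "Max (range (\<lambda>a. card (D k a))) \<in> range (\<lambda>a. card (D k a))"
    and "card (D k b) \<le> Max (range (\<lambda>a. card (D k a)))" for b
    by (auto intro!: Max_in Max_ge)
  then obtain a where a: "\<And>b. card (D k b) \<le> card (D k a)" by force
  have "\<not> {b. (a, b) \<in> E} \<subseteq> D k a" using inf[of a] finite_subset[OF _ fin_D] by blast
  then obtain b where b: "(a, b) \<in> E" "b \<notin> D k a" by blast
  \<comment> \<open>The edge from \<open>a\<close> to the unreachable \<open>b\<close> must be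
    oriented towards \<open>a\<close>; so \<open>b\<close> reaches everything that \<open>a\<close>
    does and also itself, against maximality.\<close>
  have "(a, b) \<notin> S" using b closed[OF self] by (auto simp: out_def)
  then have "a \<in> D k b" using b(1) closed[OF self, of b] by (auto simp: out_def)
  then have "D l a \<subseteq> D k b" for l
    using closed by (induction l) (auto simp: D0 DS)
  then have "D k a \<subset> D k b" using b(2) self by blast
  then have "card (D k a) < card (D k b)" using fin_D by (intro psubset_card_mono)
  then show False using a[of b] by simp
qed


section \<open>A subflow of the space of 1-types of an arbitrary expansion\<close>

section \<open>The types that code orientations\<close>

lemma type_space_Neg:
  assumes p: "p \<in> type_space L M n" and \<phi>: "\<phi> \<in> formulas L n"
  shows "Neg \<phi> \<in> p \<longleftrightarrow> \<phi> \<notin> p"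
proof
  assume neg: "Neg \<phi> \<in> p"
  have fs: "finitely_satisfiable M p" using p by (simp add: type_space_def)
  show "\<phi> \<notin> p"
  proof
    assume "\<phi> \<in> p"
    then obtain e where "\<forall>\<psi>\<in>{\<phi>, Neg \<phi>}. sat M e \<psi>"
      using fs[unfolded finitely_satisfiable_def, THEN spec, of "{\<phi>, Neg \<phi>}"] neg by auto
    then show False by simp
  qed
next
  assume "\<phi> \<notin> p"
  moreover have "\<forall>\<phi>\<in>formulas L n. \<phi> \<in> p \<or> Neg \<phi> \<in> p" using p by (simp add: type_space_def)
  ultimately show "Neg \<phi> \<in> p" using \<phi> by blast
qed

lemma openin_stone:
  assumes "\<phi> \<in> formulas L n"
  shows "openin (stone_topology L M n) {p \<in> type_space L M n. \<phi> \<in> p}"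
  unfolding stone_topology_def
  by (rule topology_generated_by_Basis[OF imageI[OF assms, of "\<lambda>\<phi>. {p \<in> type_space L M n. \<phi> \<in> p}"]])

locale coded_expansion = generic +
  fixes L :: "'r :: countable language" and M :: "('r, nat) struct" and r2 r3 :: 'r
  assumes r2: "r2 \<in> symbols L" "arity L r2 = 2" "\<And>x y. M r2 [x, y] \<longleftrightarrow> (x, y) \<in> E"
    and r3: "r3 \<in> symbols L" "arity L r3 = 3" "\<And>x y z. M r3 [x, y, z] \<longleftrightarrow> (x, y, z) \<in> R"
begin

definition coded :: "nat \<times> nat \<Rightarrow> ('r, nat) fm" where
  "coded c = Atom r3 [Var 0, Par (fst c), Par (snd c)]"

definition code_rel :: "('r, nat) fm set \<Rightarrow> (nat \<times> nat) set" where
  "code_rel p = {c. coded c \<in> p}"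

text \<open>The bound is put on finite subsets because \<open>card\<close> of an infinite set is 0,
  and because each violation then involves finitely many formulas, which makes the set
  closed.\<close>

definition orientation_types :: "('r, nat) fm set set" where
  "orientation_types = {p \<in> type_space L M 1.
     \<forall>a F. finite F \<longrightarrow> F \<subseteq> owned E (code_rel p) a \<longrightarrow> card F \<le> 2}"

lemma coded_formula: "coded c \<in> formulas L 1"
  using r3 by (simp add: coded_def formulas_def)

lemma sat_coded: "sat M e (coded c) \<longleftrightarrow> (e 0, fst c, snd c) \<in> R"
  by (simp add: coded_def r3(3))

lemma Aut_bij: "g \<in> Aut L M \<Longrightarrow> bij g"
  by (simp add: Aut_def is_isomorphism_def)

lemma Aut_edge:
  assumes "g \<in> Aut L M"
  shows "(g x, g y) \<in> E \<longleftrightarrow> (x, y) \<in> E"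
proof -
  have "length [x, y] = arity L r2" by (simp add: r2(2))
  then have "M r2 [x, y] = M r2 (map g [x, y])"
    using assms r2(1) unfolding Aut_def is_isomorphism_def by blast
  then show ?thesis by (simp add: r2(3))
qed

lemma code_rel_type_act:
  assumes "g \<in> Aut L M"
  shows "(g x, g y) \<in> code_rel (type_act g p) \<longleftrightarrow> (x, y) \<in> code_rel p"
proof -
  have "inj (map_fm id g :: ('r, nat) fm \<Rightarrow> _)"
    using Aut_bij[OF assms] by (intro fm.inj_map) (auto simp: bij_is_inj)
  moreover have "coded (g x, g y) = map_fm id g (coded (x, y))" by (simp add: coded_def)
  ultimately show ?thesis by (simp add: code_rel_def type_act_def inj_image_mem_iff)
qed

lemma orientation_types_closed: "closedin (stone_topology L M 1) orientation_types"
  unfolding closedin_def topspace_stone_topology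
proof
  let ?X = "stone_topology L M 1" and ?S = "type_space L M 1"
  show "orientation_types \<subseteq> ?S" by (auto simp: orientation_types_def)
  show "openin ?X (?S - orientation_types)"
  proof (subst openin_subopen, intro ballI)
    fix p assume p: "p \<in> ?S - orientation_types"
    then obtain a F where F: "finite F" "F \<subseteq> owned E (code_rel p) a" "\<not> card F \<le> 2"
      by (auto simp: orientation_types_def)
    \<comment> \<open>The types agreeing with \<open>p\<close> on one coded pair form an open set;
      those agreeing on all of \<open>F\<close> violate the bound just as \<open>p\<close>
      does.\<close>
    define U where "U c = {q \<in> ?S. coded c \<in> q \<longleftrightarrow> coded c \<in> p}" for c
    have "openin ?X (U c)" for c
    proof (cases "coded c \<in> p")
      case True
      then have "U c = {q \<in> ?S. coded c \<in> q}" by (auto simp: U_def)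
      then show ?thesis using openin_stone[OF coded_formula] by simp
    next
      case False
      have "Neg (coded c) \<in> formulas L 1" using coded_formula by (simp add: formulas_def)
      moreover have "Neg (coded c) \<in> q \<longleftrightarrow> coded c \<notin> q" if "q \<in> ?S" for q
        by (rule type_space_Neg[OF that coded_formula])
      then have "U c = {q \<in> ?S. Neg (coded c) \<in> q}"
        unfolding U_def using False by blast
      ultimately show ?thesis using openin_stone by simp
    qed
    then have "openin ?X ((\<Inter>c\<in>F. U c) \<inter> topspace ?X)"
      using F(1) by (intro openin_INT)
    moreover have "p \<in> (\<Inter>c\<in>F. U c) \<inter> topspace ?X"
      using p by (simp add: U_def topspace_stone_topology)
    moreover have "(\<Inter>c\<in>F. U c) \<inter> topspace ?X \<subseteq> ?S - orientation_types"
    proof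
      fix q assume q: "q \<in> (\<Inter>c\<in>F. U c) \<inter> topspace ?X"
      have "F \<subseteq> owned E (code_rel q) a"
      proof
        fix c assume c: "c \<in> F"
        then have "c \<in> code_rel q \<longleftrightarrow> c \<in> code_rel p" using q by (auto simp: U_def code_rel_def)
        then show "c \<in> owned E (code_rel q) a" using F(2) c by (auto simp: owned_def owner_def)
      qed
      then show "q \<in> ?S - orientation_types"
        using q F(1,3) by (auto simp: orientation_types_def topspace_stone_topology)
    qed
    ultimately show "\<exists>T. openin ?X T \<and> p \<in> T \<and> T \<subseteq> ?S - orientation_types" by blast
  qed
qed

lemma orientation_types_invariant:
  assumes g: "g \<in> Aut L M" and p: "p \<in> orientation_types"
  shows "type_act g p \<in> orientation_types"
proof -
  have "card F \<le> 2" if F: "finite F" "F \<subseteq> owned E (code_rel (type_act g p)) a" for F a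
  proof -
    have inj: "inj (map_prod g g)" using Aut_bij[OF g] by (simp add: bij_is_inj prod.inj_map)
    define F' where "F' = map_prod g g -` F"
    obtain a' where a': "a = g a'" using Aut_bij[OF g] by (metis bij_pointE)
    have "surj (map_prod g g)" using Aut_bij[OF g] by (simp add: bij_is_surj map_prod_surj)
    then have F': "F = map_prod g g ` F'" by (simp add: F'_def surj_image_vimage_eq)
    have "F' \<subseteq> owned E (code_rel p) a'"
    proof
      fix c assume "c \<in> F'"
      then obtain x y where c: "c = (x, y)" "(g x, g y) \<in> F" by (cases c) (auto simp: F'_def)
      then have "(g x, g y) \<in> owned E (code_rel (type_act g p)) (g a')" using F(2) a' by blast
      then show "c \<in> owned E (code_rel p) a'"
        using Aut_edge[OF g] code_rel_type_act[OF g] Aut_bij[OF g]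
        by (auto simp: owned_def owner_def c(1) bij_is_inj inj_eq split: if_splits)
    qed
    moreover have "finite F'" using F(1) inj by (simp add: F'_def finite_vimageI)
    ultimately have "card F' \<le> 2" using p by (auto simp: orientation_types_def)
    then show ?thesis using inj by (simp add: F' card_image inj_on_subset)
  qed
  then show ?thesis
    using p type_act_in_type_space[OF g] by (auto simp: orientation_types_def)
qed

text \<open>For each \<open>k\<close> a point \<open>x k\<close> codes a good orientation of the
  edges below \<open>k\<close>; a limit of the types of these points codes one for all
  edges.\<close>

lemma orientation_types_nonempty: "orientation_types \<noteq> {}"
proof -
  have "\<exists>x. \<forall>a F. F \<subseteq> owned E {c. (x, fst c, snd c) \<in> R} a \<longrightarrow> F \<subseteq> {..<k} \<times> {..<k} \<longrightarrow> card F \<le> 2" for k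
  proof -
    obtain S where S: "\<And>a. card (owned (E \<inter> {..<k} \<times> {..<k}) S a) \<le> 2"
      using sparse_orientation[OF sparse, of "{..<k}"] by auto
    obtain x where x: "\<forall>a\<in>{..<k}. \<forall>b\<in>{..<k}. (x, a, b) \<in> R \<longleftrightarrow> (a, b) \<in> S"
      using code_relation[of "{..<k}" S] by auto
    have "card F \<le> 2"
      if F: "F \<subseteq> owned E {c. (x, fst c, snd c) \<in> R} a" "F \<subseteq> {..<k} \<times> {..<k}" for a F
    proof -
      have "F \<subseteq> owned (E \<inter> {..<k} \<times> {..<k}) S a"
      proof
        fix c assume c: "c \<in> F"
        then have "(x, fst c, snd c) \<in> R \<longleftrightarrow> c \<in> S" using x F(2) by (cases c) auto
        then show "c \<in> owned (E \<inter> {..<k} \<times> {..<k}) S a"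
          using c F by (auto simp: owned_def owner_def)
      qed
      moreover have "finite (owned (E \<inter> {..<k} \<times> {..<k}) S a)"
        by (rule finite_subset[of _ "{..<k} \<times> {..<k}"]) (auto simp: owned_def)
      ultimately show ?thesis using S[of a] card_mono le_trans by blast
    qed
    then show ?thesis by blast
  qed
  then have "\<exists>x. \<forall>k. \<forall>a F. F \<subseteq> owned E {c. (x k, fst c, snd c) \<in> R} a \<longrightarrow> F \<subseteq> {..<k} \<times> {..<k} \<longrightarrow> card F \<le> 2"
    by (intro choice allI)
  then obtain x where x: "\<And>k a F. F \<subseteq> owned E {c. (x k, fst c, snd c) \<in> R} a \<Longrightarrow>
      F \<subseteq> {..<k} \<times> {..<k} \<Longrightarrow> card F \<le> 2"
    by blast
  \<comment> \<open>There are countably many formulas, with all parameters and all symbols of the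
    expansion, so one subsequence decides them and yields a complete type.\<close>
  obtain s :: "nat \<Rightarrow> nat" where s: "strict_mono s"
    and dec: "\<And>\<phi>. (\<forall>\<^sub>F k in sequentially. sat M (\<lambda>_. x (s k)) \<phi>) \<or>
      (\<forall>\<^sub>F k in sequentially. \<not> sat M (\<lambda>_. x (s k)) \<phi>)"
    by (rule deciding_subsequence[of "\<lambda>\<phi> k. sat M (\<lambda>_. x k) \<phi>"]) blast
  define p where "p = {\<phi> \<in> formulas L 1. \<forall>\<^sub>F k in sequentially. sat M (\<lambda>_. x (s k)) \<phi>}"
  have "finitely_satisfiable M p"
    unfolding finitely_satisfiable_def
  proof (intro allI impI)
    fix F assume F: "finite F \<and> F \<subseteq> p"
    then have "\<forall>\<^sub>F k in sequentially. \<forall>\<phi>\<in>F. sat M (\<lambda>_. x (s k)) \<phi>"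
      by (auto simp: eventually_ball_finite_distrib p_def)
    then have "\<exists>k. \<forall>\<phi>\<in>F. sat M (\<lambda>_. x (s k)) \<phi>"
      using eventually_happens by fastforce
    then show "\<exists>e. \<forall>\<phi>\<in>F. sat M e \<phi>" by blast
  qed
  moreover have "\<phi> \<in> p \<or> Neg \<phi> \<in> p" if "\<phi> \<in> formulas L 1" for \<phi>
    using dec[of \<phi>] that by (auto simp: p_def formulas_def)
  ultimately have p: "p \<in> type_space L M 1" by (auto simp: type_space_def p_def)
  have "card F \<le> 2" if F: "finite F" "F \<subseteq> owned E (code_rel p) a" for a F
  proof -
    obtain m where m: "F \<subseteq> {..<m} \<times> {..<m}"
    proof -
      obtain m where "fst ` F \<union> snd ` F \<subseteq> {..<m}"
        using F(1) finite_nat_iff_bounded[of "fst ` F \<union> snd ` F"] by auto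
      then show thesis by (intro that[of m]) force
    qed
    have "\<forall>\<^sub>F k in sequentially. (x (s k), fst c, snd c) \<in> R \<longleftrightarrow> c \<in> code_rel p" for c
    proof (cases "c \<in> code_rel p")
      case True
      then show ?thesis by (simp add: code_rel_def p_def sat_coded)
    next
      case False
      then have "\<not> (\<forall>\<^sub>F k in sequentially. sat M (\<lambda>_. x (s k)) (coded c))"
        using coded_formula by (simp add: code_rel_def p_def)
      then have "\<forall>\<^sub>F k in sequentially. \<not> sat M (\<lambda>_. x (s k)) (coded c)" using dec by blast
      then show ?thesis using False by (simp add: sat_coded)
    qed
    then have "\<forall>\<^sub>F k in sequentially. \<forall>c\<in>F. (x (s k), fst c, snd c) \<in> R \<longleftrightarrow> c \<in> code_rel p"
      using F(1) by (simp add: eventually_ball_finite)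
    moreover have "\<forall>\<^sub>F k in sequentially. m \<le> k" by (rule eventually_ge_at_top)
    ultimately have "\<forall>\<^sub>F k in sequentially. m \<le> k \<and>
        (\<forall>c\<in>F. (x (s k), fst c, snd c) \<in> R \<longleftrightarrow> c \<in> code_rel p)"
      by eventually_elim blast
    then obtain k where k: "m \<le> k" "\<forall>c\<in>F. (x (s k), fst c, snd c) \<in> R \<longleftrightarrow> c \<in> code_rel p"
      unfolding eventually_sequentially by blast
    \<comment> \<open>Hence \<open>F\<close> lies in the square on which \<open>x (s k)\<close>
      codes a good orientation.\<close>
    have "m \<le> s k" using k(1) seq_suble[OF s, of k] by linarith
    then have "F \<subseteq> {..<s k} \<times> {..<s k}" using m by force
    moreover have "F \<subseteq> owned E {c. (x (s k), fst c, snd c) \<in> R} a"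
      using F(2) k(2) by (auto simp: owned_def owner_def)
    ultimately show ?thesis by (intro x)
  qed
  then have "p \<in> orientation_types" using p by (auto simp: orientation_types_def)
  then show ?thesis by blast
qed

lemma not_FPT:
  assumes oc: "omega_categorical L M"
  shows "\<not> FPT L M"
proof
  assume "FPT L M"
  moreover have "is_subflow (stone_topology L M 1) (Aut L M) type_act orientation_types"
    unfolding is_subflow_def
    using orientation_types_closed orientation_types_invariant orientation_types_nonempty by blast
  ultimately obtain p where p: "p \<in> orientation_types" and fix_p: "\<And>g. g \<in> Aut L M \<Longrightarrow> type_act g p = p"
    unfolding FPT_def by (meson order_refl)
  show False
  proof (rule no_invariant_orientation[of "Aut L M" E "code_rel p"])
    show "oligomorphic (Aut L M)" using oc by (rule omega_categorical_imp_oligomorphic)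
    show "(g x, g y) \<in> E \<longleftrightarrow> (x, y) \<in> E" if "g \<in> Aut L M" for g x y
      using that by (rule Aut_edge)
    show "(g x, g y) \<in> code_rel p \<longleftrightarrow> (x, y) \<in> code_rel p" if "g \<in> Aut L M" for g x y
      using code_rel_type_act[OF that, of x y p] fix_p[OF that] by simp
    show "bij g" if "g \<in> Aut L M" for g using that by (rule Aut_bij)
    show "finite (owned E (code_rel p) a)" for a
      using finite_if_finite_subsets_card_bdd[of "owned E (code_rel p) a" 2] p
      by (auto simp: orientation_types_def)
    show "infinite {b. (a, b) \<in> E}" for a by (rule infinite_out)
  qed
qed

end

section \<open>The witness structure and its expansions\<close>

context generic
begin

interpretation permutation_group G
  by (rule permutation_group_G)

text \<open>Symbol 0 stands for \<open>E\<close>, symbol 1 for \<open>R\<close>, and symbol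
  \<open>k + 2\<close> names the orbit of the tuple with code \<open>k\<close>, whose length is its
  arity.\<close>

definition lang :: "nat language" where
  "lang = \<lparr>symbols = UNIV, arity = (\<lambda>r. case r of 0 \<Rightarrow> 2 | Suc r' \<Rightarrow>
     (case r' of 0 \<Rightarrow> 3 | Suc k \<Rightarrow> length (from_nat k :: nat list)))\<rparr>"

definition struc :: "(nat, nat) struct" where
  "struc r xs = (case r of 0 \<Rightarrow> (xs ! 0, xs ! 1) \<in> E | Suc r' \<Rightarrow>
     (case r' of 0 \<Rightarrow> (xs ! 0, xs ! 1, xs ! 2) \<in> R | Suc k \<Rightarrow> orb (from_nat k) xs))"

lemma omega_categorical_struc: "omega_categorical lang struc"
proof (rule oligomorphic_imp_omega_categorical[OF permutation_group_G oligomorphic_G])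
  show "infinite (UNIV :: nat set)" by simp
  fix r and xs :: "nat list" and g
  assume len: "length xs = arity lang r" and g: "g \<in> G"
  have gE: "(g x, g y) \<in> E \<longleftrightarrow> (x, y) \<in> E" and gR: "(g x, g y, g z) \<in> R \<longleftrightarrow> (x, y, z) \<in> R" for x y z
    using g by (simp_all add: G_def iso_on_def)
  have "orb xs (map g xs)" using g by (auto simp: orb_def)
  then have orb_g: "orb zs (map g xs) \<longleftrightarrow> orb zs xs" for zs
    using orb_trans orb_sym by blast
  show "struc r (map g xs) = struc r xs"
  proof (cases "r \<le> 1")
    case True
    then consider "r = 0" | "r = Suc 0" by linarith
    then show ?thesis using len by cases (simp_all add: struc_def lang_def gE gR)
  next
    case False
    then obtain k where "r = Suc (Suc k)"
      using not0_implies_Suc[of r] not0_implies_Suc[of "r - 1"] by auto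
    then show ?thesis by (simp add: struc_def orb_g)
  qed
next
  fix xs :: "nat list"
  show "\<exists>r\<in>symbols lang. arity lang r = length xs \<and>
      (\<forall>ys. length ys = length xs \<longrightarrow> (struc r ys \<longleftrightarrow> orb xs ys))"
    by (intro bexI[of _ "Suc (Suc (to_nat xs))"]) (simp_all add: lang_def struc_def)
qed

lemma expansion_not_FPT:
  fixes L :: "(nat + 's :: countable) language"
  assumes "is_expansion lang struc L M" "omega_categorical L M"
  shows "\<not> FPT L M"
proof -
  have ex: "Inl r \<in> symbols L" "arity L (Inl r) = arity lang r"
    "\<And>xs. length xs = arity lang r \<Longrightarrow> M (Inl r) xs = struc r xs" for r
    using assms(1) by (simp_all add: is_expansion_def lang_def)
  interpret coded_expansion E R L M "Inl 0" "Inl 1"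
    by unfold_locales (use ex in \<open>simp_all add: lang_def struc_def\<close>)
  show ?thesis using assms(2) by (rule not_FPT)
qed

end

theorem theorem5p1:
  shows "\<exists>(L :: nat language) (M :: (nat, nat) struct).
    countable_language L \<and> omega_categorical L M \<and>
    (\<forall>(L' :: (nat + nat) language) (M' :: (nat + nat, nat) struct).
       countable_language L' \<and> is_expansion L M L' M' \<and> omega_categorical L' M' \<longrightarrow>
       \<not> FPT L' M')"
proof -
  obtain E R where "generic E R"
  proof (rule generic_structure)
    fix E R
    assume "sparse E UNIV" and "\<And>(V :: nat set) F Q U (h :: nat \<Rightarrow> nat). finite V \<Longrightarrow> sparse F V \<Longrightarrow>
      strong F V U \<Longrightarrow> iso_on F Q E R U h \<Longrightarrow> strong E UNIV (h ` U) \<Longrightarrow>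
      \<exists>h'. (\<forall>x\<in>U. h' x = h x) \<and> iso_on F Q E R V h' \<and> strong E UNIV (h' ` V)"
    then have "generic E R" by (rule generic.intro)
    then show thesis by (rule that)
  qed
  then interpret generic E R .
  have "countable_language lang" by (simp add: countable_language_def)
  then show ?thesis using omega_categorical_struc expansion_not_FPT by blast
qed

end
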